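(* For every $\nu\in\mathbb C$, $$\int_{0}^1 x\,[P_\nu(x)]^2\left\{[P_\nu(x)]^2-[P_\nu(-x)]^2\right\}dx=\frac{4\sin^2(\nu\pi)}{(2\nu+1)^{2}\pi^{2}}\left[\frac{\psi^{(0)}(\nu+1)+\psi^{(0)}(-\nu)}{2}+\gamma_0+2\log 2\right],$$ where for $\nu\in\{-1/2\}\cup\mathbb Z$ the right-hand side is interpreted as the limit of a continuous function of $\nu$, i.e. as the value at that point of the continuous extension to $\mathbb C$ of the expression, which is well-defined for $\nu\in\mathbb C\smallsetminus(\mathbb Z\cup\{-1/2\})$.
   Context: For $\nu\in\mathbb C$, the Legendre function of the first kind $P_\nu$ is defined on $(-1,1)$ by the Mehler--Dirichlet integral $$P_\nu(\cos\theta)=\frac{2}{\pi}\int_0^\theta\frac{\cos\frac{(2\nu+1)\beta}{2}}{\sqrt{2(\cos\beta-\cos\theta)}}\,d\beta,\qquad \theta\in(0,\pi).$$ The digamma function is $\psi^{(0)}(z)=\frac{d}{dz}\log\Gamma(z)$, where $\Gamma$ is the Euler gamma function, and $\gamma_0=\lim_{n\to\infty}\left(-\log n+\sum_{k=1}^n\frac1k\right)$ is the Euler--Mascheroni constant. *)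

theory Defs
  imports "HOL-Analysis.Analysis"
begin

text \<open>
  Mehler--Dirichlet integral with \<open>\<theta> = arccos x\<close>; only the arguments \<open>-1 < x < 1\<close> are meaningful.
  The integrand has an absolutely integrable singularity at \<open>\<beta> = \<theta>\<close>.
\<close>

definition Legendre_P :: "complex \<Rightarrow> real \<Rightarrow> complex" where
  "Legendre_P \<nu> x = (let \<theta> = arccos x in
     2 / of_real pi *
     (LBINT \<beta>=0..ereal \<theta>.
        cos ((2 * \<nu> + 1) * of_real \<beta> / 2) / of_real (sqrt (2 * (cos \<beta> - cos \<theta>)))))"

definition digamma_expr :: "complex \<Rightarrow> complex" where
  "digamma_expr \<nu> =
     4 * (sin (\<nu> * of_real pi))\<^sup>2 / ((2 * \<nu> + 1)\<^sup>2 * (of_real pi)\<^sup>2) *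
     ((Digamma (\<nu> + 1) + Digamma (- \<nu>)) / 2 + euler_mascheroni + 2 * of_real (ln 2))"

end

theory Submission
  imports Defs "HOL-Complex_Analysis.Complex_Analysis" "HOL-Real_Asymp.Real_Asymp"
begin

text \<open>
  Write \<open>I(\<nu>)\<close> for the integral and \<open>s = \<nu> + 1/2\<close>. The Mehler--Dirichlet integral depends on \<open>\<nu>\<close> only
  through \<open>cos (s \<beta>)\<close>, so \<open>I\<close> is an entire function, even in \<open>s\<close>. The function \<open>I\<close> itself is the
  continuous extension that is asked for; what has to be shown is that the quotient
  \<open>s\<^sup>2 \<pi>\<^sup>2 I / cos\<^sup>2 (\<pi> s)\<close> equals \<open>B(s) = (\<psi>(1/2 + s) + \<psi>(1/2 - s)) / 2 + \<gamma> + 2 ln 2\<close>. This is done by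
  Liouville's theorem, and two inputs about \<open>I\<close> carry it.

  \<^emph>\<open>Growth.\<close> If \<open>x = cos \<theta>\<close>, then \<open>P\<^sub>\<nu>(x) = O(e\<^bsup>\<bar>Im \<nu>\<bar>\<theta>\<^esup>)\<close> for large \<open>\<bar>Im \<nu>\<bar>\<close>. On \<open>0 < x < 1\<close> the angle is at most
  \<open>\<pi>/2\<close>, so \<open>P\<^sub>\<nu>(x)\<^sup>4\<close> and \<open>P\<^sub>\<nu>(x)\<^sup>2 P\<^sub>\<nu>(-x)\<^sup>2\<close> are both \<open>O(e\<^bsup>2\<pi>\<bar>Im \<nu>\<bar>\<^esup>)\<close>, with constants that are integrable
  in \<open>x\<close>. Away from its zeros \<open>cos\<^sup>2 (\<pi> s)\<close> has exactly this growth. Hence the difference \<open>G\<close> of the quotient and \<open>B\<close> is \<open>O(\<bar>s\<bar>\<^sup>2)\<close> on the circles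
  \<open>\<bar>s\<bar> = 1, 2, 3, \<dots>\<close>. Once \<open>G\<close> is known to be entire, it is a polynomial of degree at most 2. It is
  even; it vanishes at \<open>s = 0\<close>, because \<open>\<psi>(1/2) = - \<gamma> - 2 ln 2\<close>; and it has no quadratic term, because
  \<open>e\<^bsup>-t\<theta>\<^esup> P\<^sub>\<nu>(cos \<theta>) \<rightarrow> 0\<close> for \<open>s = i t\<close>, \<open>t \<rightarrow> \<infinity>\<close>. So \<open>G = 0\<close>: this is
  \<open>entire_eq_cos_squared_mult_psi_sym\<close>.

  \<^emph>\<open>Poles.\<close> At a natural number \<open>n\<close> the parity of the Legendre polynomial \<open>P\<^sub>n\<close> gives \<open>I(n) = 0\<close>, so the
  quotient has at most a simple pole there, and it cancels the pole of \<open>B\<close> if and only if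
  \<open>I'(n) = 2 / (2n + 1)\<^sup>2\<close>. Differentiating under the integral sign and using parity,
  \<open>I'(n)\<close> is the integral of \<open>x P\<^sub>n(x)\<^sup>3 D\<^sub>n(x)\<close> over \<open>(-1, 1)\<close>, where \<open>D\<^sub>n(x)\<close> is the derivative of
  \<open>P\<^sub>\<nu>(x) - (-1)\<^sup>n P\<^sub>\<nu>(-x)\<close> with respect to \<open>\<nu>\<close> at \<open>n\<close>. Bonnet's recurrence in \<open>\<nu>\<close>, together with the
  derivative \<open>ln ((1 + x) / 2)\<close> of \<open>P\<^sub>\<nu>(x)\<close> at \<open>\<nu> = 0\<close>, identifies \<open>D\<^sub>n\<close> with the finite Hilbert transform
  \<open>E P\<^sub>n\<close>, the principal value of the integral of \<open>P\<^sub>n(t) / (x - t)\<close> over \<open>-1 < t < 1\<close> (this is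
  \<open>deriv_Legendre_P_of_nat\<close>; \<open>D\<^sub>n\<close> is twice the Legendre function of the second kind). By orthogonality
  \<open>P\<^sub>n E P\<^sub>n = E (P\<^sub>n\<^sup>2)\<close>, and for every polynomial \<open>f\<close> the integral of \<open>x f E f\<close> is half of the square of
  the integral of \<open>f\<close>, since exchanging \<open>x\<close> and \<open>t\<close> and taking the mean formally turns the double integral of
  \<open>x f(x) f(t) / (x - t)\<close> into half of the double integral of \<open>f(x) f(t)\<close>. With
  \<open>f = P\<^sub>n\<^sup>2\<close>, whose integral is \<open>2 / (2n + 1)\<close>, this is the required value.
\<close>

section \<open>Improper integrals over open intervals\<close>

lemma FTC_open_interval:
  fixes F f :: "real \<Rightarrow> 'a::euclidean_space"
  assumes ab: "a < b"
    and F: "\<And>x. a < x \<Longrightarrow> x < b \<Longrightarrow> (F has_vector_derivative f x) (at x)"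
    and f: "\<And>x. a < x \<Longrightarrow> x < b \<Longrightarrow> isCont f x"
    and "set_integrable lborel {a<..<b} f"
    and "(F \<longlongrightarrow> A) (at_right a)" and "(F \<longlongrightarrow> B) (at_left b)"
  shows "(LBINT x:{a<..<b}. f x) = B - A"
proof -
  have "(LBINT x=ereal a..ereal b. f x) = B - A"
    by (rule interval_integral_FTC_integrable[where F = F])
       (use assms in \<open>auto simp: ereal_tendsto_simps\<close>)
  then show ?thesis
    using ab by (simp add: interval_lebesgue_integral_def)
qed

lemma FTC_open_interval_nonneg:
  fixes F f :: "real \<Rightarrow> real"
  assumes ab: "a < b"
    and F: "\<And>x. a < x \<Longrightarrow> x < b \<Longrightarrow> (F has_field_derivative f x) (at x)"
    and f: "\<And>x. a < x \<Longrightarrow> x < b \<Longrightarrow> isCont f x"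
    and nonneg: "\<And>x. a < x \<Longrightarrow> x < b \<Longrightarrow> 0 \<le> f x"
    and "(F \<longlongrightarrow> A) (at_right a)" and "(F \<longlongrightarrow> B) (at_left b)"
  shows "set_integrable lborel {a<..<b} f"
proof -
  have "set_integrable lborel (einterval (ereal a) (ereal b)) f"
    by (rule interval_integral_FTC_nonneg[where F = F and A = A and B = B])
       (use assms in \<open>auto simp: ereal_tendsto_simps\<close>)
  then show ?thesis
    by simp
qed

section \<open>The logarithmic transform of polynomials\<close>

definition poly_integral :: "real poly \<Rightarrow> real" where
  "poly_integral p = (LBINT x:{-1<..<1}. poly p x)"

text \<open>
  The principal value of the integral of \<open>1 / (x - t)\<close> over \<open>-1 < t < 1\<close>.
\<close>

definition log_ratio :: "real \<Rightarrow> real" where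
  "log_ratio x = ln (1 + x) - ln (1 - x)"

definition poly_log_integral :: "real poly \<Rightarrow> real" where
  "poly_log_integral p = (LBINT x:{-1<..<1}. poly p x * log_ratio x)"

text \<open>
  The finite Hilbert transform, that is the principal value of the integral of \<open>p(t) / (x - t)\<close> over
  \<open>-1 < t < 1\<close>. Writing \<open>p(t) = p(x) - (p(x) - p(t))\<close> splits it into a logarithm and the integral of a
  difference quotient; the latter is \<open>synthetic_div p x\<close>, a polynomial in \<open>t\<close>, so that no principal value
  has to be taken.
\<close>

definition log_transform :: "real poly \<Rightarrow> real \<Rightarrow> real" where
  "log_transform p x = poly p x * log_ratio x - poly_integral (synthetic_div p x)"

lemma borel_measurable_poly [measurable]: "poly p \<in> borel_measurable (borel :: real measure)"
  by (intro borel_measurable_continuous_onI continuous_intros)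

lemma borel_measurable_log_ratio [measurable]: "log_ratio \<in> borel_measurable borel"
  unfolding log_ratio_def[abs_def] by measurable

lemma set_integrable_poly: "set_integrable lborel {-1<..<1::real} (poly p)"
proof -
  have "set_integrable lborel {-1..1::real} (poly p)"
    by (intro borel_integrable_atLeastAtMost') (auto intro!: continuous_intros)
  then show ?thesis
    by (rule set_integrable_subset) auto
qed

lemma poly_integral_add [simp]: "poly_integral (p + q) = poly_integral p + poly_integral q"
  and poly_integral_diff [simp]: "poly_integral (p - q) = poly_integral p - poly_integral q"
  using set_integral_add(2)[OF set_integrable_poly[of p] set_integrable_poly[of q]]
    set_integral_diff(2)[OF set_integrable_poly[of p] set_integrable_poly[of q]]
  by (simp_all add: poly_integral_def)

lemma poly_integral_smult [simp]: "poly_integral (smult c p) = c * poly_integral p"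
  by (simp add: poly_integral_def)

lemma poly_integral_0 [simp]: "poly_integral 0 = 0"
  by (simp add: poly_integral_def set_lebesgue_integral_def)

lemma poly_integral_pderiv: "poly_integral (pderiv p) = poly p 1 - poly p (-1)"
  unfolding poly_integral_def
proof (rule FTC_open_interval[where F = "poly p"])
  show "(poly p \<longlongrightarrow> poly p (-1)) (at_right (-1))" "(poly p \<longlongrightarrow> poly p 1) (at_left 1)"
    by (intro tendsto_intros; simp)+
qed (auto simp: set_integrable_poly poly_isCont intro: poly_DERIV simp flip: has_real_derivative_iff_has_vector_derivative)

lemma poly_integral_monom: "poly_integral (monom 1 n) = (1 + (-1) ^ n) / (real n + 1)"
proof -
  have "monom 1 n = pderiv (monom (1 / (real n + 1)) (Suc n))"
    by (simp add: pderiv_monom add.commute)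
  then show ?thesis
    by (simp add: poly_integral_pderiv poly_monom diff_divide_distrib add_divide_distrib)
qed

lemma set_integrable_log_plus: "set_integrable lborel {-1<..<1} (\<lambda>x::real. ln (1 + x))"
proof -
  have "set_integrable lborel {-1<..<1} (\<lambda>x::real. ln 2 - ln (1 + x))"
  proof (rule FTC_open_interval_nonneg)
    show "((\<lambda>x. x * ln 2 - (1 + x) * ln (1 + x) + x) has_field_derivative ln 2 - ln (1 + x)) (at x)"
      if "-1 < x" for x :: real
      using that by (auto intro!: derivative_eq_intros simp: field_simps)
    show "((\<lambda>x::real. x * ln 2 - (1 + x) * ln (1 + x) + x) \<longlongrightarrow> - ln 2 - 1) (at_right (-1))"
      by real_asymp
    show "((\<lambda>x::real. x * ln 2 - (1 + x) * ln (1 + x) + x) \<longlongrightarrow> ln 2 - 2 * ln 2 + 1) (at_left 1)"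
      by real_asymp
  qed (auto intro!: continuous_intros)
  from set_integral_diff(1)[OF set_integrable_poly[of "[:ln 2:]"] this] show ?thesis
    by simp
qed

lemma set_integrable_reflect:
  fixes f :: "real \<Rightarrow> 'a::{banach, second_countable_topology}"
  assumes "set_integrable lborel {-a<..<a} f"
  shows "set_integrable lborel {-a<..<a} (\<lambda>x. f (-x))"
proof -
  have "integrable lborel (\<lambda>x. indicator {-a<..<a} (0 + (-1) * x) *\<^sub>R f (0 + (-1) * x))"
    using assms unfolding set_integrable_def by (rule lborel_integrable_real_affine) simp
  moreover have "indicator {-a<..<a} (0 + (-1) * x) = (indicator {-a<..<a} x :: real)" for x :: real
    by (auto simp: indicator_def)
  ultimately show ?thesis
    by (simp add: set_integrable_def)
qed

lemma set_integral_reflect: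
  fixes f :: "real \<Rightarrow> 'a::{banach, second_countable_topology}"
  shows "(LBINT x:{-a<..<a}. f (-x)) = (LBINT x:{-a<..<a}. f x)"
proof -
  have "indicator {-a<..<a} (-x) = (indicator {-a<..<a} x :: real)" for x :: real
    by (auto simp: indicator_def)
  then show ?thesis
    unfolding set_lebesgue_integral_def
    using lborel_integral_real_affine[of "-1" "\<lambda>x. indicator {-a<..<a} x *\<^sub>R f x" 0] by simp
qed

lemma set_integrable_log_ratio: "set_integrable lborel {-1<..<1} log_ratio"
proof -
  have "set_integrable lborel {-1<..<1} (\<lambda>x::real. ln (1 - x))"
    using set_integrable_reflect[OF set_integrable_log_plus] by simp
  from set_integral_diff(1)[OF set_integrable_log_plus this] show ?thesis
    by (simp add: log_ratio_def[abs_def])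
qed

lemma set_integrable_poly_log: "set_integrable lborel {-1<..<1} (\<lambda>x. poly p x * log_ratio x)"
proof -
  have "bounded (poly p ` {-1..1})"
    by (intro compact_imp_bounded compact_continuous_image continuous_intros) auto
  then have "\<exists>C. \<forall>x\<in>{-1..1}. \<bar>poly p x\<bar> \<le> C"
    by (simp add: bounded_iff)
  then obtain C where C: "\<And>x. x \<in> {-1..1} \<Longrightarrow> \<bar>poly p x\<bar> \<le> C"
    by blast
  have "set_integrable lborel {-1<..<1} (\<lambda>x. C * log_ratio x)"
    using set_integrable_log_ratio by simp
  then show ?thesis
  proof (rule set_integrable_bound)
    show "set_borel_measurable lborel {-1<..<1} (\<lambda>x. poly p x * log_ratio x)"
      unfolding set_borel_measurable_def by measurable
    show "AE x in lborel. x \<in> {-1<..<1} \<longrightarrow> norm (poly p x * log_ratio x) \<le> norm (C * log_ratio x)"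
      using C by (intro AE_I2) (force simp: abs_mult intro!: mult_right_mono order_trans[OF C abs_ge_self])
  qed
qed

lemma poly_log_integral_add [simp]:
    "poly_log_integral (p + q) = poly_log_integral p + poly_log_integral q"
  and poly_log_integral_smult [simp]: "poly_log_integral (smult c p) = c * poly_log_integral p"
  using set_integral_add(2)[OF set_integrable_poly_log set_integrable_poly_log]
  by (simp_all add: poly_log_integral_def ring_distribs mult.assoc)

text \<open>
  The function \<open>(1 - x\<^sup>2) x\<^sup>n ln ((1 + x) / (1 - x))\<close> vanishes at both ends of the interval; integrating its
  derivative gives the recurrence. The truncated index \<open>n - 1\<close> is harmless at \<open>n = 0\<close>, where its term
  has the factor 0.
\<close>

lemma poly_log_integral_rec:
  "(real n + 2) * poly_log_integral (monom 1 (Suc n)) =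
     real n * poly_log_integral (monom 1 (n - 1)) + 2 * poly_integral (monom 1 n)"
proof -
  define q where "q = smult (real n) (monom 1 (n - 1)) - smult (real n + 2) (monom 1 (Suc n) :: real poly)"
  have int: "set_integrable lborel {-1<..<1} (\<lambda>x. 2 * poly (monom 1 n) x + poly q x * log_ratio x)"
    by (intro set_integral_add(1) set_integrable_poly_log set_integrable_mult_right set_integrable_poly)
  have lim: "((\<lambda>x. (1 - x^2) * log_ratio x * x ^ n) \<longlongrightarrow> 0 * 1) (at_left 1)"
            "((\<lambda>x. (1 - x^2) * log_ratio x * x ^ n) \<longlongrightarrow> 0 * (-1) ^ n) (at_right (-1))"
    unfolding log_ratio_def
    by (intro tendsto_mult; (real_asymp | (auto intro!: tendsto_eq_intros)))+
  have "(LBINT x:{-1<..<1}. 2 * poly (monom 1 n) x + poly q x * log_ratio x) = 0 - 0"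
  proof (rule FTC_open_interval[OF _ _ _ int])
    fix x :: real assume x: "-1 < x" "x < 1"
    have pos: "1 + x \<noteq> 0" "1 - x \<noteq> 0" using x by auto
    have "(log_ratio has_field_derivative 1 / (1 + x) + 1 / (1 - x)) (at x)"
      unfolding log_ratio_def[abs_def] using x by (auto intro!: derivative_eq_intros)
    then have "((\<lambda>x. (1 - x^2) * log_ratio x * x ^ n) has_field_derivative
        ((- (2 * x)) * log_ratio x + (1 - x^2) * (1 / (1 + x) + 1 / (1 - x))) * x ^ n +
        (1 - x^2) * log_ratio x * (real n * x ^ (n - 1))) (at x)"
      by (auto intro!: derivative_eq_intros)
    also have "(1 - x^2) * (1 / (1 + x) + 1 / (1 - x)) = 2"
      using pos by (simp add: divide_simps power2_eq_square) (simp add: algebra_simps)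
    also have "((- (2 * x)) * log_ratio x + 2) * x ^ n + (1 - x^2) * log_ratio x * (real n * x ^ (n - 1))
        = 2 * poly (monom 1 n) x + poly q x * log_ratio x"
      by (cases n) (simp_all add: q_def poly_monom algebra_simps power2_eq_square)
    finally show "((\<lambda>x. (1 - x^2) * log_ratio x * x ^ n) has_vector_derivative
         2 * poly (monom 1 n) x + poly q x * log_ratio x) (at x)"
      by (simp add: has_real_derivative_iff_has_vector_derivative)
    show "isCont (\<lambda>x. 2 * poly (monom 1 n) x + poly q x * log_ratio x) x"
      unfolding log_ratio_def using x by (intro continuous_intros) auto
  qed (use lim in simp_all)
  also have "(LBINT x:{-1<..<1}. 2 * poly (monom 1 n) x + poly q x * log_ratio x) =
      2 * poly_integral (monom 1 n) + poly_log_integral q"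
    by (subst set_integral_add(2))
       (auto simp: set_integrable_poly_log set_integrable_poly poly_integral_def poly_log_integral_def)
  finally show ?thesis
    unfolding q_def diff_conv_add_uminus smult_minus_left [symmetric]
    by (simp only: poly_log_integral_add poly_log_integral_smult)
qed

lemma poly_log_integral_1 [simp]: "poly_log_integral 1 = 0"
proof -
  have "(LBINT x:{-1<..<1}. log_ratio (-x)) = (LBINT x:{-1<..<1}. log_ratio x)"
    by (rule set_integral_reflect)
  moreover have "log_ratio (-x) = - log_ratio x" for x
    by (simp add: log_ratio_def)
  ultimately show ?thesis
    by (simp add: poly_log_integral_def set_lebesgue_integral_def)
qed

text \<open>
  The recursion that defines \<open>synthetic_div\<close> attaches the value \<open>p(x)\<close> as new constant coefficient. The
  form here, \<open>(x p(x) - t p(t)) / (x - t) = x (p(x) - p(t)) / (x - t) + p(t)\<close>, keeps the difference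
  quotient and \<open>p\<close> apart.
\<close>

lemma synthetic_div_pCons':
  "synthetic_div (pCons a p) x = smult x (synthetic_div p x) + p"
  using synthetic_div_correct[of p x] by (simp add: add.commute)

lemma log_transform_pCons_0: "log_transform (pCons 0 p) x = x * log_transform p x - poly_integral p"
  by (simp add: log_transform_def synthetic_div_pCons' algebra_simps del: synthetic_div_pCons)

lemma synthetic_div_add: "synthetic_div (p + q) c = synthetic_div p c + synthetic_div q c"
  by (induction p q rule: poly_induct2)
     (simp_all add: synthetic_div_pCons' smult_add_right add_ac del: synthetic_div_pCons)

lemma synthetic_div_smult: "synthetic_div (smult a p) c = smult a (synthetic_div p c)"
  by (induction p) (simp_all add: synthetic_div_pCons' smult_add_right mult.commute del: synthetic_div_pCons)

lemma log_transform_add: "log_transform (p + q) x = log_transform p x + log_transform q x"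
  and log_transform_smult: "log_transform (smult a p) x = a * log_transform p x"
  by (simp_all add: log_transform_def synthetic_div_add synthetic_div_smult algebra_simps)

lemma log_transform_0: "log_transform 0 x = 0"
  by (simp add: log_transform_def)

lemma log_transform_1: "log_transform 1 x = log_ratio x"
  by (simp add: log_transform_def one_pCons)

text \<open>
  The non-logarithmic part of the transform is again a polynomial in \<open>x\<close>; this is what makes products
  with the transform integrable.
\<close>

lemma log_transform_remainder_poly:
  obtains w where "\<And>x. poly_integral (synthetic_div p x) = poly w x"
proof -
  have "\<exists>w. \<forall>x. poly_integral (synthetic_div p x) = poly w x"
  proof (induction p)
    case (pCons a p)
    then obtain w where "\<And>x. poly_integral (synthetic_div p x) = poly w x"
      by blast
    then have "poly_integral (synthetic_div (pCons a p) x) = poly (pCons (poly_integral p) w) x" for x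
      by (simp add: synthetic_div_pCons' del: synthetic_div_pCons)
    then show ?case
      by blast
  qed (auto intro: exI[of _ 0])
  then show ?thesis
    using that by blast
qed

lemma set_integrable_poly_log_transform:
  "set_integrable lborel {-1<..<1} (\<lambda>x. poly p x * log_transform q x)"
proof -
  obtain w where w: "\<And>x. poly_integral (synthetic_div q x) = poly w x"
    using log_transform_remainder_poly[of q] by metis
  have "(\<lambda>x. poly p x * log_transform q x) = (\<lambda>x. poly (p * q) x * log_ratio x - poly (p * w) x)"
    by (simp add: log_transform_def w algebra_simps)
  then show ?thesis
    using set_integrable_poly_log[of "p * q"] set_integrable_poly[of "p * w"]
    by (simp only:) (rule set_integral_diff(1))
qed

definition log_pairing :: "real poly \<Rightarrow> real poly \<Rightarrow> real" where
  "log_pairing p q = (LBINT x:{-1<..<1}. poly p x * log_transform q x)"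

lemma log_pairing_add_left: "log_pairing (p + p') q = log_pairing p q + log_pairing p' q"
  using set_integral_add(2)[OF set_integrable_poly_log_transform[of p q] set_integrable_poly_log_transform[of p' q]]
  by (simp add: log_pairing_def ring_distribs)

lemma log_pairing_add_right: "log_pairing p (q + q') = log_pairing p q + log_pairing p q'"
  using set_integral_add(2)[OF set_integrable_poly_log_transform[of p q] set_integrable_poly_log_transform[of p q']]
  by (simp add: log_pairing_def ring_distribs log_transform_add)

lemma log_pairing_smult_left: "log_pairing (smult a p) q = a * log_pairing p q"
  by (simp add: log_pairing_def mult.assoc)

lemma log_pairing_smult_right: "log_pairing p (smult a q) = a * log_pairing p q"
  by (simp add: log_pairing_def log_transform_smult mult.left_commute)

lemma log_pairing_0 [simp]: "log_pairing 0 q = 0" "log_pairing p 0 = 0"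
  by (simp_all add: log_pairing_def log_transform_0 set_lebesgue_integral_def)

lemma log_pairing_pCons_right:
  "log_pairing p (pCons 0 q) = log_pairing (pCons 0 p) q - poly_integral q * poly_integral p"
proof -
  have "log_pairing p (pCons 0 q) =
      (LBINT x:{-1<..<1}. poly (pCons 0 p) x * log_transform q x - poly (smult (poly_integral q) p) x)"
    unfolding log_pairing_def by (simp add: log_transform_pCons_0 algebra_simps)
  also have "\<dots> = log_pairing (pCons 0 p) q - poly_integral (smult (poly_integral q) p)"
    unfolding log_pairing_def poly_integral_def
    by (rule set_integral_diff(2)[OF set_integrable_poly_log_transform set_integrable_poly])
  finally show ?thesis
    by simp
qed

lemma log_pairing_1: "log_pairing p 1 = poly_log_integral p"
  by (simp add: log_pairing_def poly_log_integral_def log_transform_1)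

text \<open>
  Moving the factors of \<open>x\<^sup>n\<close> one after the other from the transformed argument to the other one leaves
  a defect for each factor.
\<close>

lemma log_pairing_monom:
  "log_pairing p (monom 1 n) =
     poly_log_integral (monom 1 n * p) -
     (\<Sum>j<n. poly_integral (monom 1 j) * poly_integral (monom 1 (n - 1 - j) * p))"
proof (induction n arbitrary: p)
  case 0
  then show ?case
    by (simp add: log_pairing_1)
next
  case (Suc n)
  have "log_pairing p (monom 1 (Suc n)) = log_pairing (pCons 0 p) (monom 1 n) -
      poly_integral (monom 1 n) * poly_integral p"
    by (simp add: monom_Suc log_pairing_pCons_right)
  moreover have "monom 1 (n - 1 - j) * pCons 0 p = monom 1 (n - j) * p" if "j < n" for j
    using that Suc_diff_Suc[of j n] by (simp add: monom_Suc flip: Suc_diff_Suc)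
  ultimately show ?case
    by (simp add: Suc monom_Suc)
qed

text \<open>
  Formally both sides are the double integral of \<open>(x\<^sup>n - t\<^sup>n) / (x - t)\<close>: on the left each of the two
  terms contributes once, on the right the quotient is expanded. The proof shows that the right-hand side
  obeys the recurrence of \<open>poly_log_integral_rec\<close>. The key is
  \<open>(n + 1) / ((j + 1) (n - j)) = 1 / (j + 1) + 1 / (n - j)\<close>, which turns the convolution into a sum whose
  terms do not change when \<open>n\<close> grows by 2.
\<close>

lemma poly_log_integral_monom:
  "2 * poly_log_integral (monom 1 n) =
     (\<Sum>j<n. poly_integral (monom 1 j) * poly_integral (monom 1 (n - 1 - j)))"
proof -
  define S where "S n = (\<Sum>j<n. poly_integral (monom 1 j) * poly_integral (monom 1 (n - 1 - j)))" for n
  define t :: "nat \<Rightarrow> nat \<Rightarrow> real" where "t n j = (1 + (-1) ^ j) * (1 + (-1) ^ (n - 1 - j)) / (real j + 1)" for n j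
  have S: "(real n + 1) * S n = 2 * (\<Sum>j<n. t n j)" for n
  proof -
    have "(real n + 1) * S n = (\<Sum>j<n. t n j + t n (n - Suc j))"
      unfolding S_def sum_distrib_left
    proof (rule sum.cong)
      fix j assume "j \<in> {..<n}"
      then have j: "n - 1 - (n - Suc j) = j" "real (n - 1 - j) = real n - real j - 1" "real j < real n"
        by auto
      then show "(real n + 1) * (poly_integral (monom 1 j) * poly_integral (monom 1 (n - 1 - j))) =
          t n j + t n (n - Suc j)"
        unfolding t_def poly_integral_monom by (simp add: divide_simps) (simp add: algebra_simps)
    qed simp
    also have "\<dots> = 2 * (\<Sum>j<n. t n j)"
      by (simp add: sum.distrib sum.nat_diff_reindex)
    finally show ?thesis .
  qed
  \<comment> \<open>the terms with index below \<open>n - 1\<close> agree; of the two new ones, one is 0 for parity reasons\<close>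
  have rec: "(real n + 2) * S (Suc n) = real n * S (n - 1) + 4 * poly_integral (monom 1 n)" for n
  proof (cases n)
    case 0
    then show ?thesis
      using S[of 1] poly_integral_monom[of 0] by (simp add: t_def)
  next
    case (Suc k)
    have "(\<Sum>j<Suc n. t (Suc n) j) = (\<Sum>j<k. t (Suc n) j) + t (Suc n) k + t (Suc n) n"
      using Suc by simp
    also have "t (Suc n) k = 0"
      using Suc by (simp add: t_def)
    also have "t (Suc n) n = 2 * poly_integral (monom 1 n)"
      by (simp add: t_def poly_integral_monom)
    also have "(\<Sum>j<k. t (Suc n) j) = (\<Sum>j<k. t k j)"
    proof (rule sum.cong)
      fix j assume "j \<in> {..<k}"
      then have "Suc n - 1 - j = k - 1 - j + 2"
        using Suc by simp
      then show "t (Suc n) j = t k j"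
        unfolding t_def by (simp only: power_add) simp
    qed simp
    finally show ?thesis
      using S[of "Suc n"] S[of k] Suc by (simp add: algebra_simps)
  qed
  have "2 * poly_log_integral (monom 1 n) = S n"
  proof (induction n rule: less_induct)
    case (less n)
    show ?case
    proof (cases n)
      case 0
      then show ?thesis
        by (simp add: S_def)
    next
      case (Suc k)
      have "real k * (2 * poly_log_integral (monom 1 (k - 1))) = real k * S (k - 1)"
        using less[of "k - 1"] Suc by (cases k) auto
      then have "(real k + 2) * (2 * poly_log_integral (monom 1 (Suc k))) = (real k + 2) * S (Suc k)"
        unfolding rec[of k] using poly_log_integral_rec[of k] by (simp add: algebra_simps)
      then show ?thesis
        using Suc by simp
    qed
  qed
  then show ?thesis
    by (simp add: S_def)
qed

lemma log_pairing_shifted_1: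
  "log_pairing (pCons 0 1) g + log_pairing (pCons 0 g) 1 = 2 * poly_integral g"
proof -
  have monom: "log_pairing (pCons 0 1) (monom 1 n) + log_pairing (pCons 0 (monom 1 n)) 1 =
      2 * poly_integral (monom 1 n)" for n
  proof -
    have X: "pCons 0 1 = (monom 1 1 :: real poly)"
      by (simp add: monom_Suc)
    have "(\<Sum>j<n. poly_integral (monom 1 j) * poly_integral (monom 1 (n - 1 - j) * pCons 0 1)) =
        (\<Sum>j<n. poly_integral (monom 1 j) * poly_integral (monom 1 (n - j)))"
    proof (rule sum.cong)
      fix j assume "j \<in> {..<n}"
      then have "Suc (n - 1 - j) = n - j"
        by auto
      then show "poly_integral (monom 1 j) * poly_integral (monom 1 (n - 1 - j) * pCons 0 1) =
          poly_integral (monom 1 j) * poly_integral (monom 1 (n - j))"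
        by (simp add: X mult_monom del: One_nat_def)
    qed simp
    moreover have "2 * poly_log_integral (monom 1 (Suc n)) =
        (\<Sum>j<n. poly_integral (monom 1 j) * poly_integral (monom 1 (n - j))) +
        poly_integral (monom 1 n) * 2"
    proof -
      have L0: "poly_integral (monom 1 0) = 2"
        by (subst poly_integral_monom) simp
      show ?thesis
        unfolding poly_log_integral_monom[of "Suc n"]
        by (simp only: sum.lessThan_Suc diff_Suc_1 diff_self_eq_0 L0)
    qed
    moreover have "monom 1 n * pCons 0 1 = (monom 1 (Suc n) :: real poly)"
        "pCons 0 (monom 1 n) = (monom 1 (Suc n) :: real poly)"
      by (simp_all add: monom_Suc)
    ultimately show ?thesis
      unfolding log_pairing_monom log_pairing_1 by (simp only:)
  qed
  have "log_pairing (pCons 0 1) (\<Sum>i\<in>A. monom (coeff g i) i) +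
      log_pairing (pCons 0 (\<Sum>i\<in>A. monom (coeff g i) i)) 1 =
      2 * poly_integral (\<Sum>i\<in>A. monom (coeff g i) i)" if "finite A" for A
    using that
  proof (induction A)
    case (insert i A)
    define h where "h = (\<Sum>i\<in>A. monom (coeff g i) i)"
    have "(\<Sum>i\<in>insert i A. monom (coeff g i) i) = smult (coeff g i) (monom 1 i) + h"
      using insert by (simp add: h_def smult_monom)
    moreover have "log_pairing (pCons 0 1) (smult c (monom 1 i) + h) +
        log_pairing (pCons 0 (smult c (monom 1 i) + h)) 1 = 2 * poly_integral (smult c (monom 1 i) + h)" for c
    proof -
      have "pCons 0 (smult c (monom 1 i) + h) = smult c (pCons 0 (monom 1 i)) + pCons 0 h"
        by simp
      then have "log_pairing (pCons 0 1) (smult c (monom 1 i) + h) +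
          log_pairing (pCons 0 (smult c (monom 1 i) + h)) 1 =
          c * (log_pairing (pCons 0 1) (monom 1 i) + log_pairing (pCons 0 (monom 1 i)) 1) +
          (log_pairing (pCons 0 1) h + log_pairing (pCons 0 h) 1)"
        by (simp only: log_pairing_add_left log_pairing_add_right log_pairing_smult_left
            log_pairing_smult_right) (simp only: algebra_simps)
      also have "\<dots> = 2 * poly_integral (smult c (monom 1 i) + h)"
        using insert.IH monom[of i] unfolding h_def [symmetric] by simp
      finally show ?thesis .
    qed
    ultimately show ?case
      by (simp only:)
  qed simp
  from this[of "{..degree g}"] show ?thesis
    by (simp add: poly_as_sum_of_monoms)
qed

text \<open>
  In the double integral of \<open>x f(x) g(t) / (x - t)\<close>, exchanging the variables and adding gives
  \<open>(x - t) f(x) g(t) / (x - t)\<close>. Without double integrals: the difference of the two sides does not change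
  when a factor \<open>x\<close> is moved from \<open>f\<close> to \<open>g\<close>, which reduces the claim to constant \<open>f\<close>, that is to
  \<open>log_pairing_shifted_1\<close>.
\<close>

lemma log_pairing_symmetric:
  "log_pairing (pCons 0 f) g + log_pairing (pCons 0 g) f = poly_integral f * poly_integral g"
proof (induction f arbitrary: g)
  case 0
  then show ?case
    by simp
next
  case (pCons a f)
  have split: "pCons a f = smult a 1 + pCons 0 f"
    by (simp add: one_pCons)
  have 1: "poly_integral 1 = 2"
    using poly_integral_monom[of 0] by (simp add: one_pCons monom_0)
  have "log_pairing (pCons 0 (pCons a f)) g + log_pairing (pCons 0 g) (pCons a f) =
     a * (log_pairing (pCons 0 1) g + log_pairing (pCons 0 g) 1) +
     (log_pairing (pCons 0 (pCons 0 f)) g + log_pairing (pCons 0 g) (pCons 0 f))"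
  proof -
    have "pCons 0 (pCons a f) = smult a (pCons 0 1) + pCons 0 (pCons 0 f)"
      by (simp add: one_pCons)
    moreover have "log_pairing (pCons 0 g) (pCons a f) =
        a * log_pairing (pCons 0 g) 1 + log_pairing (pCons 0 g) (pCons 0 f)"
      by (simp only: split log_pairing_add_right log_pairing_smult_right)
    ultimately show ?thesis
      by (simp only: log_pairing_add_left log_pairing_smult_left) (simp add: algebra_simps)
  qed
  also have "log_pairing (pCons 0 (pCons 0 f)) g =
      log_pairing (pCons 0 f) (pCons 0 g) + poly_integral g * poly_integral (pCons 0 f)"
    by (simp add: log_pairing_pCons_right)
  also have "log_pairing (pCons 0 g) (pCons 0 f) =
      log_pairing (pCons 0 (pCons 0 g)) f - poly_integral f * poly_integral (pCons 0 g)"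
    by (simp add: log_pairing_pCons_right)
  finally have "log_pairing (pCons 0 (pCons a f)) g + log_pairing (pCons 0 g) (pCons a f) =
     a * (2 * poly_integral g) + poly_integral g * poly_integral (pCons 0 f)"
    using pCons.IH[of "pCons 0 g"] unfolding log_pairing_shifted_1 by linarith
  moreover have "poly_integral (pCons a f) = a * 2 + poly_integral (pCons 0 f)"
    unfolding split by (simp only: poly_integral_add poly_integral_smult 1)
  ultimately show ?case
    by (simp only:) (simp add: algebra_simps)
qed

corollary integral_x_mult_log_transform:
  "(LBINT x:{-1<..<1}. x * poly f x * log_transform f x) = (poly_integral f)\<^sup>2 / 2"
  using log_pairing_symmetric[of f f] by (simp add: log_pairing_def power2_eq_square)

section \<open>Legendre polynomials and the logarithmic transform\<close>

text \<open>
  Bonnet's recurrence serves as the definition because Legendre functions of every complex degree satisfy it;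
  for natural degrees it can then simply be compared.
\<close>

fun legendre_poly :: "nat \<Rightarrow> real poly" where
  "legendre_poly 0 = 1"
| "legendre_poly (Suc 0) = pCons 0 1"
| "legendre_poly (Suc (Suc n)) =
     smult (1 / (real n + 2))
       (smult (2 * real n + 3) (pCons 0 (legendre_poly (Suc n))) - smult (real n + 1) (legendre_poly n))"

lemma poly_eqI_real:
  fixes p q :: "real poly"
  assumes "\<And>x. poly p x = poly q x"
  shows "p = q"
  using assms poly_eq_poly_eq_iff[of p q] by auto

lemma legendre_poly_Bonnet:
  "pCons 0 (legendre_poly (Suc n)) =
     smult (1 / (2 * real n + 3))
       (smult (real n + 2) (legendre_poly (Suc (Suc n))) + smult (real n + 1) (legendre_poly n))"
proof -
  have *: "real n + 2 \<noteq> 0" "2 * real n + 3 \<noteq> 0" by auto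
  show ?thesis
    using * by (simp add: smult_add_right smult_diff_right)
qed

lemma poly_legendre_rec:
  "(real n + 2) * poly (legendre_poly (Suc (Suc n))) x =
     (2 * real n + 3) * x * poly (legendre_poly (Suc n)) x - (real n + 1) * poly (legendre_poly n) x"
  by (simp add: field_simps add_pos_nonneg)

lemma degree_legendre_poly: "degree (legendre_poly n) \<le> n"
proof (induction n rule: legendre_poly.induct)
  case (3 n)
  then show ?case
    by (auto intro!: degree_diff_le order_trans[OF degree_smult_le] order_trans[OF degree_pCons_le]
        simp del: degree_smult_eq simp: legendre_poly.simps(3))
qed auto

lemma poly_legendre_minus: "poly (legendre_poly n) (-x) = (-1) ^ n * poly (legendre_poly n) x"
proof (induction n rule: legendre_poly.induct)
  case (3 n)
  then show ?case
    by (simp add: algebra_simps)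
qed auto

lemma poly_legendre_1: "poly (legendre_poly n) 1 = 1"
proof (induction n rule: legendre_poly.induct)
  case (3 n)
  then show ?case
    by (simp add: field_simps)
qed auto

text \<open>
  The two classical differential recurrences support each other in the induction; they are needed only for
  \<open>(2n + 3) P\<^sub>n\<^sub>+\<^sub>1 = P'\<^sub>n\<^sub>+\<^sub>2 - P'\<^sub>n\<close>.
\<close>

lemma poly_pderiv_legendre:
  "poly (pderiv (legendre_poly (Suc n))) x =
     x * poly (pderiv (legendre_poly n)) x + (real n + 1) * poly (legendre_poly n) x \<and>
   (x\<^sup>2 - 1) * poly (pderiv (legendre_poly n)) x =
     (real n + 1) * (poly (legendre_poly (Suc n)) x - x * poly (legendre_poly n) x)"
proof (induction n)
  case 0
  then show ?case
    by (simp add: pderiv_pCons)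
next
  case (Suc n)
  define d where "d k = poly (pderiv (legendre_poly k)) x" for k
  define p where "p k = poly (legendre_poly k) x" for k
  have IH: "d (Suc n) = x * d n + (real n + 1) * p n"
      "(x\<^sup>2 - 1) * d n = (real n + 1) * (p (Suc n) - x * p n)"
    using Suc by (simp_all add: d_def p_def)
  have rec: "(real n + 2) * p (Suc (Suc n)) = (2 * real n + 3) * x * p (Suc n) - (real n + 1) * p n"
    unfolding p_def by (rule poly_legendre_rec)
  \<comment> \<open>a third recurrence, which links the two that are proved by induction\<close>
  have b: "x * d (Suc n) - d n = (real n + 1) * p (Suc n)"
    using IH by (simp add: algebra_simps power2_eq_square)
  have drec: "(real n + 2) * d (Suc (Suc n)) = (2 * real n + 3) * (p (Suc n) + x * d (Suc n)) - (real n + 1) * d n"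
    unfolding d_def p_def by (simp add: pderiv_smult pderiv_diff pderiv_pCons field_simps add_pos_nonneg)
  have "(real n + 2) * d (Suc (Suc n)) = (real n + 2) * (x * d (Suc n) + (real n + 2) * p (Suc n))"
    using b drec by algebra
  moreover have "real n + 2 \<noteq> 0"
    by auto
  ultimately have 1: "d (Suc (Suc n)) = x * d (Suc n) + (real n + 2) * p (Suc n)"
    by simp
  have "(x\<^sup>2 - 1) * d (Suc n) = (real n + 1) * (x * p (Suc n) - p n)"
    using IH by algebra
  also have "\<dots> = (real n + 2) * (p (Suc (Suc n)) - x * p (Suc n))"
    using rec by algebra
  finally show ?case
    using 1 by (simp add: d_def p_def add.commute)
qed

lemma poly_integral_legendre_Suc [simp]: "poly_integral (legendre_poly (Suc n)) = 0"
proof -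
  have "poly (smult (2 * real n + 3) (legendre_poly (Suc n))) x =
      poly (pderiv (legendre_poly (Suc (Suc n))) - pderiv (legendre_poly n)) x" for x
    using poly_pderiv_legendre[of n x] poly_pderiv_legendre[of "Suc n" x]
    by (simp add: power2_eq_square del: legendre_poly.simps) algebra
  then have "smult (2 * real n + 3) (legendre_poly (Suc n)) =
      pderiv (legendre_poly (Suc (Suc n))) - pderiv (legendre_poly n)"
    by (rule poly_eqI_real)
  then have "(2 * real n + 3) * poly_integral (legendre_poly (Suc n)) =
      poly_integral (pderiv (legendre_poly (Suc (Suc n))) - pderiv (legendre_poly n))"
    by (metis poly_integral_smult)
  also have "\<dots> = 0"
    using poly_legendre_minus[of n 1] poly_legendre_minus[of "Suc (Suc n)" 1]
    by (simp add: poly_integral_pderiv poly_legendre_1 del: legendre_poly.simps)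
  finally show ?thesis
    by (simp add: add_nonneg_eq_0_iff)
qed

text \<open>
  Bonnet's recurrence trades a factor \<open>x\<close> for a change of the index by one, so the claim for \<open>x q\<close> follows
  from the claim for \<open>q\<close>, down to the vanishing integral of a single \<open>P\<^sub>n\<close>, \<open>n > 0\<close>. The case \<open>q = 0\<close>
  is listed separately because the zero polynomial has degree 0.
\<close>

lemma poly_integral_legendre_orthogonal:
  "degree q < n \<or> q = 0 \<Longrightarrow> poly_integral (q * legendre_poly n) = 0"
proof (induction q arbitrary: n)
  case (pCons a q)
  then obtain m where n: "n = Suc m"
    by (cases n) auto
  have q: "degree q < m \<or> q = 0"
    using pCons.prems pCons.hyps n by (auto split: if_splits)
  have "pCons a q * legendre_poly n =
     smult a (legendre_poly (Suc m)) + q * pCons 0 (legendre_poly (Suc m))"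
    by (simp add: n del: legendre_poly.simps)
  also have "\<dots> = smult a (legendre_poly (Suc m)) + smult (1 / (2 * real m + 3))
       (smult (real m + 2) (q * legendre_poly (Suc (Suc m))) + smult (real m + 1) (q * legendre_poly m))"
    unfolding legendre_poly_Bonnet by (simp add: algebra_simps del: legendre_poly.simps)
  finally have eq: "pCons a q * legendre_poly n = \<dots>" .
  have "poly_integral (q * legendre_poly (Suc (Suc m))) = 0" "poly_integral (q * legendre_poly m) = 0"
    by (rule pCons.IH, use q in auto)+
  then show ?case
    by (simp only: eq poly_integral_add poly_integral_smult poly_integral_legendre_Suc) simp
qed simp

text \<open>
  The integral of \<open>x P\<^sub>n P\<^sub>n\<^sub>+\<^sub>1\<close> is computed twice, expanding \<open>x P\<^sub>n\<^sub>+\<^sub>1\<close> and \<open>x P\<^sub>n\<close> by Bonnet's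
  recurrence; orthogonality leaves one square on each side.
\<close>

lemma poly_integral_legendre_square:
  "poly_integral (legendre_poly n * legendre_poly n) = 2 / (2 * real n + 1)"
proof (induction n)
  case 0
  show ?case
    using poly_integral_monom[of 0] by simp
next
  case (Suc n)
  have 1: "pCons 0 (legendre_poly (Suc n)) * legendre_poly n = smult (1 / (2 * real n + 3))
      (smult (real n + 2) (legendre_poly n * legendre_poly (Suc (Suc n))) +
       smult (real n + 1) (legendre_poly n * legendre_poly n))"
    unfolding legendre_poly_Bonnet by (simp add: algebra_simps del: legendre_poly.simps)
  have "poly_integral (legendre_poly n * legendre_poly (Suc (Suc n))) = 0"
    using degree_legendre_poly[of n] by (intro poly_integral_legendre_orthogonal) auto
  with 1 Suc have eq1: "poly_integral (pCons 0 (legendre_poly (Suc n)) * legendre_poly n) =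
      2 * (real n + 1) / ((2 * real n + 3) * (2 * real n + 1))"
    by (simp only: poly_integral_add poly_integral_smult) simp
  have eq2: "poly_integral (legendre_poly (Suc n) * pCons 0 (legendre_poly n)) =
      (real n + 1) / (2 * real n + 1) * poly_integral (legendre_poly (Suc n) * legendre_poly (Suc n))"
  proof (cases n)
    case 0
    then show ?thesis by simp
  next
    case (Suc m)
    have "legendre_poly (Suc n) * pCons 0 (legendre_poly n) = smult (1 / (2 * real n + 1))
      (smult (real n + 1) (legendre_poly (Suc n) * legendre_poly (Suc n)) +
       smult (real n) (legendre_poly m * legendre_poly (Suc n)))"
      unfolding Suc legendre_poly_Bonnet by (simp add: algebra_simps del: legendre_poly.simps)
    moreover have "poly_integral (legendre_poly m * legendre_poly (Suc n)) = 0"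
      using degree_legendre_poly[of m] Suc by (intro poly_integral_legendre_orthogonal) auto
    ultimately show ?thesis
      by (simp only: poly_integral_add poly_integral_smult) simp
  qed
  have "pCons 0 (legendre_poly (Suc n)) * legendre_poly n = legendre_poly (Suc n) * pCons 0 (legendre_poly n)"
    by (simp add: mult.commute del: legendre_poly.simps)
  then have "(real n + 1) / (2 * real n + 1) * poly_integral (legendre_poly (Suc n) * legendre_poly (Suc n)) =
      (real n + 1) / (2 * real n + 1) * (2 / (2 * real n + 3))"
    using eq1 eq2 by (simp only:) (simp add: mult_ac)
  then have "poly_integral (legendre_poly (Suc n) * legendre_poly (Suc n)) = 2 / (2 * real n + 3)"
    by (subst (asm) mult_left_cancel) auto
  then show ?case
    by (simp add: add.commute del: legendre_poly.simps)
qed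

text \<open>
  The difference quotient of \<open>P\<^sub>n\<^sup>2\<close> is the one of \<open>P\<^sub>n\<close> times \<open>P\<^sub>n(t) + P\<^sub>n(x)\<close>. The first summand
  integrates to 0, since the difference quotient of \<open>P\<^sub>n\<close> has degree less than \<open>n\<close> in \<open>t\<close>.
\<close>

lemma log_transform_legendre_square:
  "log_transform (legendre_poly n * legendre_poly n) x =
     poly (legendre_poly n) x * log_transform (legendre_poly n) x"
proof -
  define p where "p = legendre_poly n"
  define s where "s = synthetic_div p x"
  have p: "p = [:-x, 1:] * s + [:poly p x:]"
    unfolding s_def by (rule synthetic_div_correct'[symmetric])
  have factor: "q * q = b * (s * (q + c)) + c * c" if "q = b * s + c" for q b c :: "real poly"
    unfolding that by (simp add: algebra_simps)
  from factor[OF p] have "p * p + smult x (s * (p + [:poly p x:])) =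
      smult x (s * (p + [:poly p x:])) + [:-x, 1:] * (s * (p + [:poly p x:])) + [:poly (p * p) x:]"
    by simp
  also have "\<dots> = pCons (poly (p * p) x) (s * (p + [:poly p x:]))"
    by simp
  finally have "p * p + smult x (s * (p + [:poly p x:])) = pCons (poly (p * p) x) (s * (p + [:poly p x:]))" .
  then have "synthetic_div (p * p) x = s * (p + [:poly p x:])"
    by (metis synthetic_div_unique)
  moreover have "poly_integral (s * p) = 0"
    unfolding p_def using degree_legendre_poly[of n] degree_synthetic_div[of p x]
    by (intro poly_integral_legendre_orthogonal) (cases n; auto simp: s_def p_def one_pCons)
  ultimately show ?thesis
    by (simp add: log_transform_def s_def [symmetric] p_def [symmetric] algebra_simps)
qed

theorem integral_x_legendre_cubed_log_transform:
  "(LBINT x:{-1<..<1}. x * poly (legendre_poly n) x ^ 3 * log_transform (legendre_poly n) x) =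
     2 / (2 * real n + 1)\<^sup>2"
  using integral_x_mult_log_transform[of "legendre_poly n * legendre_poly n"]
  by (simp add: log_transform_legendre_square poly_integral_legendre_square power3_eq_cube
      power2_eq_square mult_ac)

lemma log_transform_legendre_rec:
  "(real n + 2) * log_transform (legendre_poly (Suc (Suc n))) x =
     (2 * real n + 3) * x * log_transform (legendre_poly (Suc n)) x -
     (real n + 1) * log_transform (legendre_poly n) x"
proof -
  have "smult (real n + 2) (legendre_poly (Suc (Suc n))) =
      smult (2 * real n + 3) (pCons 0 (legendre_poly (Suc n))) + smult (-(real n + 1)) (legendre_poly n)"
    by (simp only: smult_minus_left) (simp add: smult_diff_right add_nonneg_eq_0_iff)
  then have "(real n + 2) * log_transform (legendre_poly (Suc (Suc n))) x =
      log_transform (smult (2 * real n + 3) (pCons 0 (legendre_poly (Suc n))) + smult (-(real n + 1)) (legendre_poly n)) x"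
    by (metis log_transform_smult)
  then show ?thesis
    by (simp only: log_transform_add log_transform_smult log_transform_pCons_0 poly_integral_legendre_Suc)
       (simp add: algebra_simps)
qed

section \<open>The Mehler--Dirichlet integral as an integral over a fixed interval\<close>

text \<open>
  The integrand of the Mehler--Dirichlet integral after the substitution
  \<open>sin (\<beta> / 2) = y = k sin u\<close> with \<open>k = sin (\<theta> / 2)\<close>, including the factor from \<open>d\<beta>\<close>.
\<close>

definition mehler_kernel :: "complex \<Rightarrow> real \<Rightarrow> complex" where
  "mehler_kernel \<nu> y = cos ((2 * \<nu> + 1) * of_real (arcsin y)) / of_real (sqrt (1 - y\<^sup>2))"

text \<open>
  The substitution removes both defects of the Mehler--Dirichlet integral: the interval of integration does
  not depend on \<open>x\<close> any more, and the singularity at \<open>\<beta> = \<theta>\<close> is gone, so that for \<open>k < 1\<close> the integrand is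
  continuous on a compact interval.
\<close>

definition mehler :: "complex \<Rightarrow> real \<Rightarrow> complex" where
  "mehler \<nu> k = integral {0..pi/2} (\<lambda>u. mehler_kernel \<nu> (k * sin u))"

text \<open>
  For \<open>x = cos \<theta>\<close> this is \<open>sin (\<theta> / 2)\<close>, the modulus \<open>k\<close> of the substitution.
\<close>

definition half_chord :: "real \<Rightarrow> real" where
  "half_chord x = sqrt ((1 - x) / 2)"

lemma half_chord_bounds:
  assumes "-1 < x" "x < 1"
  shows "0 < half_chord x" "half_chord x < 1" "(half_chord x)\<^sup>2 = (1 - x) / 2"
  using assms by (simp_all add: half_chord_def)

lemma arccos_eq_arcsin_half_chord:
  assumes "-1 < x" "x < 1"
  shows "arccos x = 2 * arcsin (half_chord x)"
proof -
  define k where "k = half_chord x"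
  have k: "0 < k" "k < 1" "k\<^sup>2 = (1 - x) / 2"
    using half_chord_bounds[OF assms] by (simp_all add: k_def)
  have "cos (2 * arcsin k) = 1 - 2 * k\<^sup>2"
    using k by (simp add: cos_double_sin)
  also have "\<dots> = x"
    using k by simp
  finally have "arccos x = arccos (cos (2 * arcsin k))"
    by simp
  also have "\<dots> = 2 * arcsin k"
    using k arcsin_bounded[of k] arcsin_le_arcsin[of 0 k] by (intro arccos_cos) auto
  finally show ?thesis
    by (simp add: k_def)
qed

lemma abs_mult_sin_le:
  fixes k :: real
  assumes "0 \<le> k"
  shows "\<bar>k * sin u\<bar> \<le> k"
  using assms abs_sin_le_one[of u] by (simp add: abs_mult mult_left_le)

lemma one_minus_square_pos:
  fixes y :: real
  assumes "\<bar>y\<bar> < 1"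
  shows "0 < 1 - y\<^sup>2"
  using assms by (simp add: abs_square_less_1)

lemma one_minus_mult_sin_square_pos:
  fixes k :: real
  assumes "0 \<le> k" "k < 1"
  shows "0 < 1 - (k * sin u)\<^sup>2"
  using abs_mult_sin_le[OF assms(1), of u] assms by (intro one_minus_square_pos) simp

lemma continuous_on_mehler_kernel:
  fixes S :: "'b::t2_space set"
  assumes "continuous_on S f" "continuous_on S g" "\<And>z. z \<in> S \<Longrightarrow> \<bar>g z\<bar> < 1"
  shows "continuous_on S (\<lambda>z. mehler_kernel (f z) (g z))"
proof -
  have "0 < 1 - (g z)\<^sup>2" "-1 \<le> g z" "g z \<le> 1" if "z \<in> S" for z
    using one_minus_square_pos[OF assms(3)[OF that]] assms(3)[OF that] by auto
  then have "\<forall>z\<in>S. -1 \<le> g z \<and> g z \<le> 1" "\<forall>z\<in>S. of_real (sqrt (1 - (g z)\<^sup>2)) \<noteq> (0::complex)"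
    by force+
  then show ?thesis
    unfolding mehler_kernel_def using assms(1,2) by (intro continuous_intros) auto
qed

lemma continuous_on_mehler_kernel_sin:
  assumes "0 \<le> k" "k < 1"
  shows "continuous_on S (\<lambda>u. mehler_kernel \<nu> (k * sin u))"
  by (intro continuous_on_mehler_kernel continuous_intros)
     (use abs_mult_sin_le[OF assms(1)] assms in \<open>meson le_less_trans\<close>)

lemma integrable_on_mehler_kernel:
  assumes "0 \<le> k" "k < 1"
  shows "(\<lambda>u. mehler_kernel \<nu> (k * sin u)) integrable_on {0..pi/2}"
  using integrable_continuous_real[OF continuous_on_mehler_kernel_sin[OF assms]] .

text \<open>
  With \<open>\<beta> = 2 arcsin (k sin u)\<close> one has \<open>2 (cos \<beta> - cos \<theta>) = (2 k cos u)\<^sup>2\<close>, and the factor \<open>2 k cos u\<close> cancels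
  against the derivative of the substitution. The integrability of the original integrand, which the
  substitution rule wants in advance, comes from the nonnegative integrand \<open>1 / sqrt (2 (cos \<beta> - cos \<theta>))\<close>.
\<close>

lemma Legendre_P_eq_mehler:
  assumes x: "-1 < x" "x < 1"
  shows "Legendre_P \<nu> x = 2 / of_real pi * mehler \<nu> (half_chord x)"
proof -
  define k where "k = half_chord x"
  define \<theta> where "\<theta> = arccos x"
  have k: "0 < k" "k < 1" "k\<^sup>2 = (1 - x) / 2"
    using half_chord_bounds[OF x] by (simp_all add: k_def)
  have \<theta>: "\<theta> = 2 * arcsin k" "cos \<theta> = x" "0 < \<theta>"
    using arccos_eq_arcsin_half_chord[OF x] x arccos_lt_bounded[of x] cos_arccos[of x]
    unfolding \<theta>_def k_def by simp_all
  define w where "w \<beta> = sqrt (2 * (cos \<beta> - cos \<theta>))" for \<beta>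
  define g where "g u = 2 * arcsin (k * sin u)" for u
  define g' where "g' u = 2 * (k * cos u) / sqrt (1 - (k * sin u)\<^sup>2)" for u
  define c where "c \<beta> = cos ((2 * \<nu> + 1) * complex_of_real \<beta> / 2)" for \<beta>
  have ks: "\<bar>k * sin u\<bar> < 1" "0 < sqrt (1 - (k * sin u)\<^sup>2)" for u
    using abs_mult_sin_le[of k u] one_minus_mult_sin_square_pos[of k u] k by auto
  have g: "(g has_field_derivative g' u) (at u)" for u
    unfolding g_def g'_def using ks[of u]
    by (auto intro!: derivative_eq_intros simp: field_simps abs_less_iff)
  have cont_g: "continuous_on S g" for S
    by (meson DERIV_isCont continuous_at_imp_continuous_on g)
  have cont_g': "isCont g' u" for u
    unfolding g'_def using ks[of u] by (intro continuous_intros) auto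
  have cos_pos: "0 < cos u" if "0 < u" "u < pi/2" for u
    using that by (intro cos_gt_zero_pi) auto
  have w: "w (g u) = 2 * (k * cos u)" "0 < w (g u)" "0 < cos (g u) - cos \<theta>" if "0 < u" "u < pi/2" for u
  proof -
    have "cos (g u) = 1 - 2 * (k * sin u)\<^sup>2"
      unfolding g_def using ks(1)[of u] by (simp add: cos_double_sin)
    moreover have "cos \<theta> = 1 - 2 * k\<^sup>2"
      using k(3) \<theta>(2) by simp
    ultimately have eq: "2 * (cos (g u) - cos \<theta>) = (2 * (k * cos u))\<^sup>2"
      by (simp only: power_mult_distrib cos_squared_eq) (simp add: algebra_simps)
    show 1: "w (g u) = 2 * (k * cos u)"
      unfolding w_def eq using k cos_pos[OF that] by (simp only: real_sqrt_abs) simp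
    show "0 < w (g u)"
      unfolding 1 using k cos_pos[OF that] by simp
    have "0 < (2 * (k * cos u))\<^sup>2"
      using k cos_pos[OF that] by simp
    then show "0 < cos (g u) - cos \<theta>"
      unfolding eq[symmetric] by simp
  qed
  have g_lim: "(g \<longlongrightarrow> 0) (at_right 0)" "(g \<longlongrightarrow> \<theta>) (at_left (pi/2))"
  proof -
    have "(g \<longlongrightarrow> g 0) (at_right 0)" "(g \<longlongrightarrow> g (pi/2)) (at_left (pi/2))"
      using g by (meson DERIV_isCont Lim_at_imp_Lim_at_within isContD)+
    then show "(g \<longlongrightarrow> 0) (at_right 0)" "(g \<longlongrightarrow> \<theta>) (at_left (pi/2))"
      by (simp_all add: g_def \<theta>)
  qed
  have g'_nonneg: "0 \<le> g' u" if "0 \<le> u" "u \<le> pi/2" for u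
    unfolding g'_def using that k ks(2)[of u] cos_ge_zero[of u] by (intro divide_nonneg_pos mult_nonneg_nonneg) auto
  \<comment> \<open>the majorant \<open>1 / w\<close>: here the substitution rule for nonnegative functions provides integrability\<close>
  have int_w: "set_integrable lborel {0<..<\<theta>} (\<lambda>\<beta>. 1 / w \<beta>)"
  proof -
    have eq: "1 / w (g u) * g' u = 1 / sqrt (1 - (k * sin u)\<^sup>2)" if "0 < u" "u < pi/2" for u
      using w(1)[OF that] k cos_pos[OF that] by (simp add: g'_def)
    have "continuous_on {0..pi/2} (\<lambda>u. 1 / sqrt (1 - (k * sin u)\<^sup>2))"
      using ks(2) by (intro continuous_intros ballI) (metis less_irrefl)
    then have "set_integrable lborel {0..pi/2} (\<lambda>u. 1 / sqrt (1 - (k * sin u)\<^sup>2))"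
      by (rule borel_integrable_atLeastAtMost')
    then have "set_integrable lborel {0<..<pi/2} (\<lambda>u. 1 / sqrt (1 - (k * sin u)\<^sup>2))"
      by (rule set_integrable_subset) auto
    also have "?this \<longleftrightarrow> set_integrable lborel {0<..<pi/2} (\<lambda>u. 1 / w (g u) * g' u)"
      by (rule set_integrable_cong[OF refl refl]) (simp only: eq greaterThanLessThan_iff)
    finally have int: "set_integrable lborel {0<..<pi/2} (\<lambda>u. 1 / w (g u) * g' u)" .
    have "set_integrable lborel (einterval (ereal 0) (ereal \<theta>)) (\<lambda>\<beta>. 1 / w \<beta>)"
    proof (rule interval_integral_substitution_nonneg(1)[where a = "ereal 0" and b = "ereal (pi/2)" and g = g and g' = g'])
      show "isCont (\<lambda>\<beta>. 1 / w \<beta>) (g u)" if "ereal 0 < ereal u" "ereal u < ereal (pi/2)" for u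
        using w[of u] that unfolding w_def by (intro continuous_intros) auto
      show "0 \<le> 1 / w (g u)" if "ereal 0 < ereal u" "ereal u < ereal (pi/2)" for u
        using w(2)[of u] that by simp
      show "((ereal \<circ> g \<circ> real_of_ereal) \<longlongrightarrow> ereal 0) (at_right (ereal 0))"
           "((ereal \<circ> g \<circ> real_of_ereal) \<longlongrightarrow> ereal \<theta>) (at_left (ereal (pi/2)))"
        using g_lim by (simp_all add: ereal_tendsto_simps)
    qed (use g cont_g' g'_nonneg int in simp_all)
    then show ?thesis
      by simp
  qed
  have "bounded (c ` {0..\<theta>})"
    unfolding c_def by (intro compact_imp_bounded compact_continuous_image continuous_intros) auto
  then have "\<exists>C. \<forall>\<beta>\<in>{0..\<theta>}. norm (c \<beta>) \<le> C"
    by (simp add: bounded_iff)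
  then obtain C where C: "\<And>\<beta>. \<beta> \<in> {0..\<theta>} \<Longrightarrow> norm (c \<beta>) \<le> C"
    by blast
  have int_f: "set_integrable lborel {0<..<\<theta>} (\<lambda>\<beta>. c \<beta> / of_real (w \<beta>))"
  proof (rule set_integrable_bound)
    show "set_integrable lborel {0<..<\<theta>} (\<lambda>\<beta>. C * (1 / w \<beta>))"
      using int_w by (intro set_integrable_mult_right)
    have "c \<in> borel_measurable borel"
      unfolding c_def by (intro borel_measurable_continuous_onI continuous_intros) auto
    moreover have "w \<in> borel_measurable borel"
      unfolding w_def by (intro borel_measurable_continuous_onI continuous_intros)
    ultimately show "set_borel_measurable lborel {0<..<\<theta>} (\<lambda>\<beta>. c \<beta> / of_real (w \<beta>))"
      unfolding set_borel_measurable_def by measurable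
    show "AE \<beta> in lborel. \<beta> \<in> {0<..<\<theta>} \<longrightarrow> norm (c \<beta> / of_real (w \<beta>)) \<le> norm (C * (1 / w \<beta>))"
    proof (intro AE_I2 impI)
      fix \<beta> assume "\<beta> \<in> {0<..<\<theta>}"
      then have "norm (c \<beta>) \<le> \<bar>C\<bar>"
        using C[of \<beta>] by auto
      then show "norm (c \<beta> / of_real (w \<beta>)) \<le> norm (C * (1 / w \<beta>))"
        by (simp add: norm_divide abs_mult divide_right_mono)
    qed
  qed
  have eq: "g' u *\<^sub>R (c (g u) / of_real (w (g u))) = mehler_kernel \<nu> (k * sin u)" if "0 < u" "u < pi/2" for u
  proof -
    have "c (g u) = cos ((2 * \<nu> + 1) * of_real (arcsin (k * sin u)))"
      by (simp add: c_def g_def)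
    moreover have "complex_of_real (w (g u)) \<noteq> 0"
      using w(2)[OF that] by simp
    ultimately show ?thesis
      unfolding w(1)[OF that] g'_def mehler_kernel_def by (simp add: scaleR_conv_of_real)
  qed
  have int_kernel: "set_integrable lborel {0..pi/2} (\<lambda>u. mehler_kernel \<nu> (k * sin u))"
    using k by (intro borel_integrable_atLeastAtMost' continuous_on_mehler_kernel_sin) auto
  have "(LBINT \<beta>=ereal 0..ereal \<theta>. c \<beta> / of_real (w \<beta>)) =
      (LBINT u=ereal 0..ereal (pi/2). g' u *\<^sub>R (c (g u) / of_real (w (g u))))"
  proof (rule interval_integral_substitution_integrable)
    show "isCont (\<lambda>\<beta>. c \<beta> / of_real (w \<beta>)) (g u)" if "ereal 0 < ereal u" "ereal u < ereal (pi/2)" for u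
      using w[of u] that unfolding w_def c_def by (intro continuous_intros) auto
    have "set_integrable lborel {0<..<pi/2} (\<lambda>u. mehler_kernel \<nu> (k * sin u))"
      using int_kernel by (rule set_integrable_subset) auto
    also have "?this \<longleftrightarrow> set_integrable lborel {0<..<pi/2} (\<lambda>u. g' u *\<^sub>R (c (g u) / of_real (w (g u))))"
      by (rule set_integrable_cong) (auto simp: eq)
    finally show "set_integrable lborel (einterval (ereal 0) (ereal (pi/2))) (\<lambda>u. g' u *\<^sub>R (c (g u) / of_real (w (g u))))"
      by simp
    show "((ereal \<circ> g \<circ> real_of_ereal) \<longlongrightarrow> ereal 0) (at_right (ereal 0))"
         "((ereal \<circ> g \<circ> real_of_ereal) \<longlongrightarrow> ereal \<theta>) (at_left (ereal (pi/2)))"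
      using g_lim by (simp_all add: ereal_tendsto_simps)
  qed (use g cont_g' g'_nonneg int_f in simp_all)
  also have "\<dots> = (LBINT u=ereal 0..ereal (pi/2). mehler_kernel \<nu> (k * sin u))"
    by (rule interval_integral_cong) (auto simp: eq)
  also have "\<dots> = mehler \<nu> k"
    unfolding mehler_def using int_kernel by (intro interval_integral_eq_integral) auto
  finally have "(LBINT \<beta>=0..ereal \<theta>. c \<beta> / of_real (w \<beta>)) = mehler \<nu> k"
    by (simp add: zero_ereal_def)
  then show ?thesis
    by (simp add: Legendre_P_def Let_def c_def w_def \<theta>_def k_def)
qed

lemma mehler_reflect: "mehler (- 1 - \<nu>) k = mehler \<nu> k"
proof -
  have "(2 * (- 1 - \<nu>) + 1) * of_real a = - ((2 * \<nu> + 1) * of_real a)" for a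
    by (simp add: algebra_simps)
  then have "mehler_kernel (- 1 - \<nu>) y = mehler_kernel \<nu> y" for y
    unfolding mehler_kernel_def by (metis cos_minus)
  then show ?thesis
    by (simp add: mehler_def)
qed

lemma has_field_derivative_mehler:
  assumes k: "0 \<le> k" "k < 1"
  shows "((\<lambda>\<nu>. mehler \<nu> k) has_field_derivative
      integral {0..pi/2} (\<lambda>u. - 2 * of_real (arcsin (k * sin u)) *
        sin ((2 * \<nu> + 1) * of_real (arcsin (k * sin u))) / of_real (sqrt (1 - (k * sin u)\<^sup>2)))) (at \<nu>)"
proof -
  define a where "a u = arcsin (k * sin u)" for u
  define r where "r u = sqrt (1 - (k * sin u)\<^sup>2)" for u
  have ks: "\<bar>k * sin u\<bar> \<le> 1" "r u \<noteq> 0" for u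
    using abs_mult_sin_le[of k u] one_minus_mult_sin_square_pos[of k u] k by (auto simp: r_def)
  have cont: "continuous_on S (\<lambda>z. a (f z))" "continuous_on S (\<lambda>z. r (f z))" if "continuous_on S f"
    for f :: "complex \<times> real \<Rightarrow> real" and S
    unfolding a_def r_def using ks(1) that by (auto intro!: continuous_intros simp: abs_le_iff)
  have "((\<lambda>\<nu>. integral (cbox 0 (pi/2)) (\<lambda>u. cos ((2 * \<nu> + 1) * of_real (a u)) / of_real (r u))) has_field_derivative
      integral (cbox 0 (pi/2)) (\<lambda>u. - 2 * of_real (a u) * sin ((2 * \<nu> + 1) * of_real (a u)) / of_real (r u))) (at \<nu> within UNIV)"
  proof (rule leibniz_rule_field_derivative)
    show "((\<lambda>\<nu>. cos ((2 * \<nu> + 1) * of_real (a u)) / of_real (r u)) has_field_derivative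
        - 2 * of_real (a u) * sin ((2 * \<nu> + 1) * of_real (a u)) / of_real (r u)) (at \<nu> within UNIV)" for \<nu> :: complex and u
      using ks(2)[of u] by (auto intro!: derivative_eq_intros simp: field_simps)
    show "(\<lambda>u. cos ((2 * \<nu> + 1) * of_real (a u)) / of_real (r u)) integrable_on cbox 0 (pi/2)" for \<nu> :: complex
      using integrable_on_mehler_kernel[OF k, of \<nu>] by (simp add: mehler_kernel_def a_def r_def)
    show "continuous_on (UNIV \<times> cbox 0 (pi/2)) (\<lambda>(\<nu>, u). - 2 * of_real (a u) *
        sin ((2 * \<nu> + 1) * of_real (a u)) / complex_of_real (r u))"
      unfolding split_def using ks(2) by (intro continuous_intros cont) auto
  qed auto
  then show ?thesis
    by (simp add: mehler_def mehler_kernel_def a_def r_def)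
qed

lemma continuous_on_mehler: "continuous_on {0..<1} (mehler \<nu>)"
proof -
  have "continuous_on ({0..<1} \<times> cbox 0 (pi/2)) (\<lambda>(k, u). mehler_kernel \<nu> (k * sin u))"
    unfolding split_def
  proof (intro continuous_on_mehler_kernel continuous_intros)
    fix z :: "real \<times> real" assume "z \<in> {0..<1} \<times> cbox 0 (pi/2)"
    then show "\<bar>fst z * sin (snd z)\<bar> < 1"
      using abs_mult_sin_le[of "fst z" "snd z"] by auto
  qed
  from integral_continuous_on_param[OF this] show ?thesis
    by (simp add: mehler_def[abs_def])
qed

lemma mehler_0:
  assumes "0 \<le> k" "k < 1"
  shows "mehler 0 k = of_real (pi / 2)"
proof -
  have "mehler_kernel 0 (k * sin u) = 1" for u
  proof -
    have "\<bar>k * sin u\<bar> \<le> 1"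
      using abs_mult_sin_le[of k u] assms by simp
    then have "cos (arcsin (k * sin u)) = sqrt (1 - (k * sin u)\<^sup>2)"
      by (intro cos_arcsin) (auto simp: abs_le_iff)
    then show ?thesis
      using one_minus_mult_sin_square_pos[OF assms, of u]
      by (simp add: mehler_kernel_def cos_of_real)
  qed
  then show ?thesis
    by (simp add: mehler_def scaleR_conv_of_real)
qed

text \<open>
  Bonnet's recurrence holds for complex degrees because the corresponding combination of the integrands is the
  derivative of \<open>2 k cos u sin ((2\<nu> + 1) arcsin (k sin u))\<close>, which is 0 at both ends of the interval.
\<close>

lemma mehler_Bonnet:
  assumes k: "0 \<le> k" "k < 1"
  shows "(\<nu> + 1) * mehler (\<nu> + 1) k - (2 * \<nu> + 1) * of_real (1 - 2 * k\<^sup>2) * mehler \<nu> k + \<nu> * mehler (\<nu> - 1) k = 0"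
proof -
  define a where "a u = arcsin (k * sin u)" for u
  define r where "r u = sqrt (1 - (k * sin u)\<^sup>2)" for u
  define A where "A = 2 * \<nu> + 1"
  define F where "F u = 2 * of_real (k * cos u) * sin (A * of_real (a u))" for u
  define f where "f u = (\<nu> + 1) * mehler_kernel (\<nu> + 1) (k * sin u) -
      (2 * \<nu> + 1) * of_real (1 - 2 * k\<^sup>2) * mehler_kernel \<nu> (k * sin u) + \<nu> * mehler_kernel (\<nu> - 1) (k * sin u)" for u
  have ks: "\<bar>k * sin u\<bar> < 1" "r u > 0" for u
    using abs_mult_sin_le[of k u] one_minus_mult_sin_square_pos[of k u] k by (auto simp: r_def)
  have F: "(F has_vector_derivative f u) (at u)" for u
  proof -
    have da: "(a has_field_derivative k * cos u / r u) (at u)"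
      unfolding a_def r_def using ks(1)[of u]
      by (auto intro!: derivative_eq_intros simp: field_simps abs_less_iff)
    have "((\<lambda>u. complex_of_real (a u)) has_vector_derivative of_real (k * cos u / r u)) (at u)"
      using da by (intro has_vector_derivative_of_real) (simp add: has_real_derivative_iff_has_vector_derivative)
    from has_vector_derivative_mult_right[OF this, of A]
    have "((\<lambda>u. sin (A * of_real (a u))) has_vector_derivative (A * of_real (k * cos u / r u)) * cos (A * of_real (a u))) (at u)"
      by (rule field_vector_diff_chain_at[unfolded o_def]) (rule DERIV_sin)
    moreover have "((\<lambda>u. complex_of_real (k * cos u)) has_vector_derivative of_real (- k * sin u)) (at u)"
      by (intro has_vector_derivative_of_real)
         (auto intro!: derivative_eq_intros simp flip: has_real_derivative_iff_has_vector_derivative)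
    ultimately have "(F has_vector_derivative 2 * (of_real (k * cos u) *
        ((A * of_real (k * cos u / r u)) * cos (A * of_real (a u))) +
        of_real (- k * sin u) * sin (A * of_real (a u)))) (at u)"
      unfolding F_def mult.assoc by (intro has_vector_derivative_mult_right has_vector_derivative_mult)
    moreover have "f u = 2 * (of_real (k * cos u) *
        ((A * of_real (k * cos u / r u)) * cos (A * of_real (a u))) +
        of_real (- k * sin u) * sin (A * of_real (a u)))"
    proof -
      define C where "C = cos (A * of_real (a u))"
      define S where "S = sin (A * of_real (a u))"
      define y where "y = k * sin u"
      have r: "of_real (r u) \<noteq> (0::complex)" "(r u)\<^sup>2 = 1 - y\<^sup>2"
        using ks(2)[of u] by (auto simp: r_def y_def)
      have cs: "sin (a u) = y" "cos (a u) = r u"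
        using ks(1)[of u] by (simp_all add: a_def r_def y_def cos_arcsin abs_less_iff)
      have cs2: "cos (2 * complex_of_real (a u)) = of_real (1 - 2 * y\<^sup>2)" "sin (2 * complex_of_real (a u)) = of_real (2 * y * r u)"
        using cos_double_sin[of "a u"] sin_double[of "a u"] unfolding cs
        by (metis cos_of_real of_real_mult of_real_numeral, metis sin_of_real of_real_mult of_real_numeral)
      have "(2 * (\<nu> + 1) + 1) * complex_of_real (a u) = A * of_real (a u) + 2 * of_real (a u)"
           "(2 * (\<nu> - 1) + 1) * complex_of_real (a u) = A * of_real (a u) - 2 * of_real (a u)"
        by (simp_all add: A_def algebra_simps)
      then have kern: "mehler_kernel (\<nu> + 1) y = (C * of_real (1 - 2 * y\<^sup>2) - S * of_real (2 * y * r u)) / of_real (r u)"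
        "mehler_kernel (\<nu> - 1) y = (C * of_real (1 - 2 * y\<^sup>2) + S * of_real (2 * y * r u)) / of_real (r u)"
        "mehler_kernel \<nu> y = C / of_real (r u)"
        unfolding mehler_kernel_def C_def S_def
        by (simp_all only: y_def flip: a_def r_def A_def) (simp_all only: cos_add cos_diff cs2 y_def)
      have "k\<^sup>2 - y\<^sup>2 = (k * cos u)\<^sup>2"
        by (simp add: y_def power_mult_distrib cos_squared_eq algebra_simps)
      then have ky: "complex_of_real (1 - 2 * y\<^sup>2) - of_real (1 - 2 * k\<^sup>2) = 2 * (of_real (k * cos u))\<^sup>2"
      proof -
        have "complex_of_real (1 - 2 * y\<^sup>2) - of_real (1 - 2 * k\<^sup>2) = of_real (2 * (k\<^sup>2 - y\<^sup>2))"
          by simp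
        also have "\<dots> = of_real (2 * (k * cos u)\<^sup>2)"
          by (simp only: \<open>k\<^sup>2 - y\<^sup>2 = (k * cos u)\<^sup>2\<close>)
        finally show ?thesis
          by simp
      qed
      have nu: "\<nu> + 1 = (A + 1) / 2" "\<nu> = (A - 1) / 2"
        by (simp_all add: A_def)
      \<comment> \<open>expand \<open>cos (A \<alpha> \<plusminus> 2 \<alpha>)\<close>, where \<open>\<alpha> = arcsin y\<close> and \<open>\<nu> \<plusminus> 1\<close> shifts \<open>A = 2\<nu> + 1\<close> by \<open>\<plusminus> 2\<close>\<close>
      have "f u * of_real (r u) = A * C * (of_real (1 - 2 * y\<^sup>2) - of_real (1 - 2 * k\<^sup>2)) - S * of_real (2 * y * r u)"
        unfolding f_def y_def[symmetric] kern A_def[symmetric] using r(1) by (simp add: nu field_simps)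
      also have "\<dots> = (2 * (of_real (k * cos u) * ((A * of_real (k * cos u / r u)) * C) +
        of_real (- k * sin u) * S)) * of_real (r u)"
        unfolding ky using r(1) by (simp add: y_def power2_eq_square field_simps)
      finally show ?thesis
        using r(1) by (simp add: C_def S_def)
    qed
    ultimately show ?thesis
      by simp
  qed
  have "(f has_integral F (pi/2) - F 0) {0..pi/2}"
    using F by (intro fundamental_theorem_of_calculus) (auto intro: has_vector_derivative_at_within)
  moreover have "F (pi/2) - F 0 = 0"
    by (simp add: F_def a_def)
  moreover have "(f has_integral (\<nu> + 1) * mehler (\<nu> + 1) k -
      (2 * \<nu> + 1) * of_real (1 - 2 * k\<^sup>2) * mehler \<nu> k + \<nu> * mehler (\<nu> - 1) k) {0..pi/2}"
    unfolding f_def mehler_def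
    by (intro has_integral_add has_integral_diff has_integral_mult_right integrable_integral
        integrable_on_mehler_kernel k)
  ultimately show ?thesis
    by (metis has_integral_unique)
qed

text \<open>
  This integral is, up to a factor, the derivative of \<open>P\<^sub>\<nu>(x)\<close> at \<open>\<nu> = 0\<close>. It is found by differentiating
  with respect to \<open>k\<close>: with \<open>g(y) = arcsin y / sqrt (1 - y\<^sup>2)\<close> and \<open>h(y) = y g(y)\<close>, let \<open>F(k)\<close> be the integral
  of \<open>h(k sin u)\<close> and \<open>I\<close> that of \<open>g'(k sin u)\<close>. The derivative of \<open>- cos u g(k sin u)\<close> gives
  \<open>F'(k) = k I\<close>, and \<open>y h'(y) = g'(y) - 1\<close> gives \<open>k F'(k) = I - \<pi>/2\<close>. Eliminating \<open>I\<close> yields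
  \<open>F'(k) = (\<pi>/2) k / (1 - k\<^sup>2)\<close>.
\<close>

lemma integral_arcsin_kernel:
  assumes k: "0 \<le> k" "k < 1"
  shows "integral {0..pi/2} (\<lambda>u. k * sin u * arcsin (k * sin u) / sqrt (1 - (k * sin u)\<^sup>2)) =
    - (pi / 4) * ln (1 - k\<^sup>2)"
proof -
  define g where "g y = arcsin y / sqrt (1 - y\<^sup>2)" for y :: real
  define g' where "g' y = (1 + y * g y) / (1 - y\<^sup>2)" for y
  define h where "h y = y * g y" for y
  define h' where "h' y = g y + y * g' y" for y
  define F where "F k = integral {0..pi/2} (\<lambda>u. h (k * sin u))" for k
  define F' where "F' k = integral {0..pi/2} (\<lambda>u. h' (k * sin u) * sin u)" for k
  have dg: "(g has_field_derivative g' y) (at y)" if "\<bar>y\<bar> < 1" for y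
  proof -
    have p: "0 < 1 - y\<^sup>2" "0 < sqrt (1 - y\<^sup>2)"
      using one_minus_square_pos[OF that] by auto
    define r where "r = sqrt (1 - y\<^sup>2)"
    have r: "0 < r" "r * r = 1 - y\<^sup>2"
      using p by (simp_all add: r_def)
    have d1: "(arcsin has_field_derivative inverse r) (at y)"
      using that DERIV_arcsin[of y] by (simp add: r_def abs_less_iff)
    have "((\<lambda>y. 1 - y\<^sup>2) has_field_derivative - (2 * y)) (at y)"
      by (auto intro!: derivative_eq_intros)
    from DERIV_chain2[OF DERIV_real_sqrt this] p
    have d2: "((\<lambda>y. sqrt (1 - y\<^sup>2)) has_field_derivative inverse r / 2 * - (2 * y)) (at y)"
      by (simp add: r_def)
    have "(g has_field_derivative
        (inverse r * r - arcsin y * (inverse r / 2 * - (2 * y))) / (r * r)) (at y)"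
      unfolding g_def r_def using r(1) by (intro DERIV_divide d1[unfolded r_def] d2[unfolded r_def]) (simp add: r_def)
    also have "(inverse r * r - arcsin y * (inverse r / 2 * - (2 * y))) / (r * r) = g' y"
    proof -
      have "inverse r * r - arcsin y * (inverse r / 2 * - (2 * y)) = 1 + y * (arcsin y / r)"
        using r(1) by (simp add: field_simps)
      moreover have "g y = arcsin y / r"
        by (simp add: g_def r_def)
      ultimately show ?thesis
        by (simp only: g'_def r(2))
    qed
    finally show ?thesis .
  qed
  have dh: "(h has_field_derivative h' y) (at y)" if "\<bar>y\<bar> < 1" for y
    unfolding h_def h'_def using dg[OF that] by (auto intro!: derivative_eq_intros)
  have cont_g: "continuous_on S (\<lambda>z. g (f z))" if "continuous_on S f" "\<And>z. z \<in> S \<Longrightarrow> \<bar>f z\<bar> < 1"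
    for S :: "'b::t2_space set" and f
    by (rule continuous_on_compose2[OF _ that(1), of "{y. \<bar>y\<bar> < 1}"])
       (use that(2) dg in \<open>auto intro!: continuous_at_imp_continuous_on DERIV_isCont\<close>)
  have cont_g': "continuous_on S (\<lambda>z. g' (f z))" if "continuous_on S f" "\<And>z. z \<in> S \<Longrightarrow> \<bar>f z\<bar> < 1"
    for S :: "'b::t2_space set" and f
    unfolding g'_def using that one_minus_square_pos by (intro continuous_intros cont_g) (auto, force)
  have ks: "\<bar>k * sin u\<bar> < 1" if "0 \<le> k" "k < 1" for k u :: real
    using abs_mult_sin_le[of k u] that by simp
  have int_g': "(\<lambda>u. g' (k * sin u)) integrable_on {0..pi/2}"
    and int_h: "(\<lambda>u. h (k * sin u)) integrable_on {0..pi/2}"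
    and int_h': "(\<lambda>u. h' (k * sin u) * sin u) integrable_on {0..pi/2}" if "0 \<le> k" "k < 1" for k
    unfolding h_def h'_def using ks[OF that]
    by (intro integrable_continuous_real continuous_intros cont_g cont_g'; simp)+
  have F'_eq: "F' k = pi / 2 * k / (1 - k\<^sup>2)" if k: "0 \<le> k" "k < 1" for k
  proof -
    define I where "I = integral {0..pi/2} (\<lambda>u. g' (k * sin u))"
    have "((\<lambda>u. h' (k * sin u) * sin u - k * g' (k * sin u)) has_integral
        (- cos (pi/2) * g (k * sin (pi/2)) - (- cos 0 * g (k * sin 0)))) {0..pi/2}"
    proof (rule fundamental_theorem_of_calculus)
      fix u :: real
      have "((\<lambda>u. g (k * sin u)) has_field_derivative g' (k * sin u) * (k * cos u)) (at u)"
        by (rule DERIV_chain2[where f = g and g = "\<lambda>u. k * sin u", OF dg[OF ks[OF k]]])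
           (auto intro!: derivative_eq_intros)
      then have "((\<lambda>u. - cos u * g (k * sin u)) has_field_derivative
          sin u * g (k * sin u) - k * (cos u)\<^sup>2 * g' (k * sin u)) (at u)"
        by (auto intro!: derivative_eq_intros simp: power2_eq_square)
      also have "sin u * g (k * sin u) - k * (cos u)\<^sup>2 * g' (k * sin u) =
          h' (k * sin u) * sin u - k * g' (k * sin u)"
        unfolding cos_squared_eq by (simp add: h'_def power2_eq_square algebra_simps)
      finally show "((\<lambda>u. - cos u * g (k * sin u)) has_vector_derivative
          h' (k * sin u) * sin u - k * g' (k * sin u)) (at u within {0..pi/2})"
        by (simp add: has_real_derivative_iff_has_vector_derivative has_vector_derivative_at_within)
    qed auto
    moreover have "((\<lambda>u. h' (k * sin u) * sin u - k * g' (k * sin u)) has_integral F' k - k * I) {0..pi/2}"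
      unfolding F'_def I_def
      by (intro has_integral_diff has_integral_mult_right integrable_integral int_g' int_h' k)
    moreover have "g 0 = 0"
      by (simp add: g_def)
    ultimately have 1: "F' k = k * I"
      by (auto dest: has_integral_unique)
    have "((\<lambda>u. k * (h' (k * sin u) * sin u)) has_integral k * F' k) {0..pi/2}"
      unfolding F'_def by (intro has_integral_mult_right integrable_integral int_h' k)
    moreover have "((\<lambda>u. g' (k * sin u) - 1) has_integral I - (pi/2)) {0..pi/2}"
    proof -
      have "((\<lambda>u::real. 1::real) has_integral pi/2) {0..pi/2}"
        using has_integral_const_real[of "1::real" 0 "pi/2"] by simp
      then show ?thesis
        unfolding I_def by (intro has_integral_diff integrable_integral int_g' k)
    qed
    moreover have "k * (h' (k * sin u) * sin u) = g' (k * sin u) - 1" for u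
    proof -
      define y where "y = k * sin u"
      have "0 < 1 - y\<^sup>2"
        unfolding y_def by (rule one_minus_square_pos[OF ks[OF k]])
      then have "g' y * (1 - y\<^sup>2) = 1 + y * g y"
        by (simp add: g'_def)
      then have "y * h' y = g' y - 1"
        by (simp add: h'_def power2_eq_square algebra_simps)
      then show ?thesis
        by (simp add: y_def algebra_simps)
    qed
    ultimately have 2: "k * F' k = I - pi / 2"
      by (auto dest: has_integral_unique)
    have "0 < 1 - k\<^sup>2"
      using k by (intro one_minus_square_pos) simp
    moreover have "F' k * (1 - k\<^sup>2) = pi / 2 * k"
    proof -
      have "F' k * (1 - k\<^sup>2) = F' k - k * (k * F' k)"
        by (simp add: power2_eq_square algebra_simps)
      also have "\<dots> = k * I - k * (I - pi / 2)"
        by (simp only: 2) (simp only: 1)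
      finally show ?thesis
        by (simp add: algebra_simps)
    qed
    ultimately show ?thesis
      by (simp add: field_simps)
  qed
  have dF: "(F has_field_derivative F' k) (at k within {0..<1})" if k: "k \<in> {0..<1}" for k
  proof -
    have "((\<lambda>k. integral (cbox 0 (pi/2)) (\<lambda>u. h (k * sin u))) has_field_derivative
        integral (cbox 0 (pi/2)) (\<lambda>u. h' (k * sin u) * sin u)) (at k within {0..<1})"
    proof (rule leibniz_rule_field_derivative)
      show "((\<lambda>k. h (k * sin u)) has_field_derivative h' (k * sin u) * sin u) (at k within {0..<1})"
        if "k \<in> {0..<1}" for k u
        by (rule DERIV_chain2[where f = h and g = "\<lambda>k. k * sin u", OF dh[OF ks]])
           (use that in \<open>auto intro!: derivative_eq_intros\<close>)
      show "continuous_on ({0..<1} \<times> cbox 0 (pi/2)) (\<lambda>(k, u). h' (k * sin u) * sin u)"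
        unfolding split_def h'_def by (intro continuous_intros cont_g cont_g') (auto intro: ks)
    qed (use k int_h in auto)
    then show ?thesis
      by (simp add: F_def[abs_def] F'_def)
  qed
  have "((\<lambda>k. F k + pi / 4 * ln (1 - k\<^sup>2)) has_field_derivative 0) (at k within {0..<1})" if "k \<in> {0..<1}" for k
  proof -
    have p: "0 < 1 - k\<^sup>2"
      using that by (intro one_minus_square_pos) simp
    have "((\<lambda>k. F k + pi / 4 * ln (1 - k\<^sup>2)) has_field_derivative F' k + pi / 4 * (- (2 * k) / (1 - k\<^sup>2))) (at k within {0..<1})"
    proof (intro DERIV_add dF[OF that] DERIV_cmult)
      have "((\<lambda>k. 1 - k\<^sup>2) has_field_derivative - (2 * k)) (at k within {0..<1})"
        by (auto intro!: derivative_eq_intros)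
      from DERIV_chain2[OF DERIV_ln_divide[OF p] this]
      show "((\<lambda>k. ln (1 - k\<^sup>2)) has_field_derivative - (2 * k) / (1 - k\<^sup>2)) (at k within {0..<1})"
        by simp
    qed
    moreover have "F' k + pi / 4 * (- (2 * k) / (1 - k\<^sup>2)) = 0"
    proof -
      have "pi / 2 * k / q + pi / 4 * (- (2 * k) / q) = 0" for q
        by (cases "q = 0") (simp_all add: field_simps)
      moreover have "F' k = pi / 2 * k / (1 - k\<^sup>2)"
        using that by (intro F'_eq) auto
      ultimately show ?thesis
        by (simp only:)
    qed
    ultimately show ?thesis
      by simp
  qed
  then have "\<exists>c. \<forall>k\<in>{0..<1}. F k + pi / 4 * ln (1 - k\<^sup>2) = c"
    by (intro has_field_derivative_zero_constant) auto
  then obtain c where c: "\<And>k. k \<in> {0..<1} \<Longrightarrow> F k + pi / 4 * ln (1 - k\<^sup>2) = c"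
    by blast
  have "F 0 = 0"
    by (simp add: F_def h_def)
  then have "F k = - (pi / 4) * ln (1 - k\<^sup>2)"
    using c[of 0] c[of k] k by simp
  then show ?thesis
    by (simp add: F_def h_def g_def)
qed

lemma has_field_derivative_mehler_0:
  assumes k: "0 \<le> k" "k < 1"
  shows "((\<lambda>\<nu>. mehler \<nu> k) has_field_derivative of_real (pi / 2 * ln (1 - k\<^sup>2))) (at 0)"
proof -
  have "- 2 * complex_of_real (arcsin (k * sin u)) * sin ((2 * 0 + 1) * of_real (arcsin (k * sin u))) /
      of_real (sqrt (1 - (k * sin u)\<^sup>2)) =
      complex_of_real (- 2 * (k * sin u * arcsin (k * sin u) / sqrt (1 - (k * sin u)\<^sup>2)))" for u
  proof -
    have "\<bar>k * sin u\<bar> \<le> 1"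
      using abs_mult_sin_le[of k u] k by simp
    then have "sin (arcsin (k * sin u)) = k * sin u"
      by (intro sin_arcsin) (auto simp: abs_le_iff)
    then have "sin (complex_of_real (arcsin (k * sin u))) = of_real (k * sin u)"
      by (simp only: sin_of_real)
    then show ?thesis
      by simp
  qed
  moreover have "continuous_on {0..pi/2} (\<lambda>u. k * sin u * arcsin (k * sin u) / sqrt (1 - (k * sin u)\<^sup>2))"
  proof -
    have "\<bar>k * sin u\<bar> \<le> 1" "sqrt (1 - (k * sin u)\<^sup>2) \<noteq> 0" for u
      using abs_mult_sin_le[of k u] one_minus_mult_sin_square_pos[of k u] k by auto
    then show ?thesis
      by (intro continuous_intros) (auto simp: abs_le_iff minus_le_iff)
  qed
  then have "((\<lambda>u. - 2 * (k * sin u * arcsin (k * sin u) / sqrt (1 - (k * sin u)\<^sup>2))) has_integral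
      - 2 * (- (pi / 4) * ln (1 - k\<^sup>2))) {0..pi/2}"
    unfolding integral_arcsin_kernel[OF k, symmetric]
    by (intro has_integral_mult_right integrable_integral integrable_continuous_real)
  then have "((\<lambda>u. complex_of_real (- 2 * (k * sin u * arcsin (k * sin u) / sqrt (1 - (k * sin u)\<^sup>2)))) has_integral
      of_real (- 2 * (- (pi / 4) * ln (1 - k\<^sup>2)))) {0..pi/2}"
    by (rule has_integral_of_real)
  then have "integral {0..pi/2} (\<lambda>u. complex_of_real (- 2 * (k * sin u * arcsin (k * sin u) / sqrt (1 - (k * sin u)\<^sup>2)))) =
      of_real (- 2 * (- (pi / 4) * ln (1 - k\<^sup>2)))"
    by (rule integral_unique)
  moreover have "- 2 * (- (pi / 4) * ln (1 - k\<^sup>2)) = pi / 2 * ln (1 - k\<^sup>2)"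
    by simp
  ultimately show ?thesis
    using has_field_derivative_mehler[OF k, of 0] by (simp only:)
qed

lemma norm_cos_le_exp_Im: "norm (cos z) \<le> exp \<bar>Im z\<bar>"
proof -
  have "norm (cos z) = norm (exp (\<i> * z) + exp (- (\<i> * z))) / 2"
    by (simp add: cos_exp_eq norm_divide)
  also have "norm (exp (\<i> * z) + exp (- (\<i> * z))) \<le> exp (- Im z) + exp (Im z)"
    using norm_triangle_ineq[of "exp (\<i> * z)" "exp (- (\<i> * z))"] by simp
  also have "\<dots> \<le> exp \<bar>Im z\<bar> + exp \<bar>Im z\<bar>"
    by (intro add_mono) auto
  finally show ?thesis
    by simp
qed

lemma norm_mehler_kernel_le:
  assumes y: "0 \<le> y" "y < 1"
  shows "norm (mehler_kernel \<nu> y) \<le> exp (\<bar>Im \<nu>\<bar> * (2 * arcsin y)) / sqrt (1 - y\<^sup>2)"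
proof -
  have "0 \<le> arcsin y"
    using arcsin_le_arcsin[of 0 y] y by simp
  then have "\<bar>Im ((2 * \<nu> + 1) * of_real (arcsin y))\<bar> = \<bar>Im \<nu>\<bar> * (2 * arcsin y)"
    by (simp add: abs_mult)
  then have "norm (cos ((2 * \<nu> + 1) * of_real (arcsin y))) \<le> exp (\<bar>Im \<nu>\<bar> * (2 * arcsin y))"
    by (metis norm_cos_le_exp_Im)
  moreover have "0 < sqrt (1 - y\<^sup>2)"
    using one_minus_square_pos[of y] y by simp
  ultimately show ?thesis
    by (simp add: mehler_kernel_def norm_divide divide_right_mono)
qed

text \<open>
  A crude bound for the complete elliptic integral, whose true singularity at \<open>k = 1\<close> is logarithmic. Since
  \<open>1 - k\<^sup>2 sin\<^sup>2 u\<close> dominates both \<open>1 - k\<^sup>2\<close> and \<open>cos\<^sup>2 u\<close>, it dominates their geometric mean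
  \<open>sqrt (1 - k\<^sup>2) cos u\<close>, and \<open>cos u \<ge> 1 - 2u/\<pi>\<close> by concavity. The square of the resulting bound is still
  integrable near \<open>x = -1\<close>, which is all that the quartic integral requires.
\<close>

lemma integral_elliptic_le:
  assumes k: "0 \<le> k" "k < 1"
  shows "integral {0..pi/2} (\<lambda>u. 1 / sqrt (1 - (k * sin u)\<^sup>2)) \<le> pi / sqrt (sqrt (1 - k\<^sup>2))"
proof -
  define m where "m = sqrt (1 - k\<^sup>2)"
  have m: "0 < m"
    using k one_minus_square_pos[of k] by (simp add: m_def)
  have "((\<lambda>u. 1 / sqrt (1 - 2 * u / pi)) has_integral (- pi * sqrt (1 - 2 * (pi/2) / pi) - (- pi * sqrt (1 - 2 * 0 / pi)))) {0..pi/2}"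
  proof (rule fundamental_theorem_of_calculus_interior)
    fix u :: real assume "u \<in> {0<..<pi/2}"
    then have "0 < 1 - 2 * u / pi"
      by (simp add: field_simps)
    moreover have "((\<lambda>u. 1 - 2 * u / pi) has_field_derivative - (2 / pi)) (at u)"
      by (auto intro!: derivative_eq_intros)
    ultimately have "((\<lambda>u. - pi * sqrt (1 - 2 * u / pi)) has_field_derivative
        - pi * (inverse (sqrt (1 - 2 * u / pi)) / 2 * - (2 / pi))) (at u)"
      by (intro DERIV_cmult DERIV_chain2[OF DERIV_real_sqrt])
    moreover have "- pi * (i / 2 * - (2 / pi)) = i" for i
      by simp
    ultimately have "((\<lambda>u. - pi * sqrt (1 - 2 * u / pi)) has_field_derivative 1 / sqrt (1 - 2 * u / pi)) (at u)"
      by (simp only: inverse_eq_divide)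
    then show "((\<lambda>u. - pi * sqrt (1 - 2 * u / pi)) has_vector_derivative 1 / sqrt (1 - 2 * u / pi)) (at u)"
      by (simp add: has_real_derivative_iff_has_vector_derivative)
  qed (auto intro!: continuous_intros)
  from has_integral_mult_right[OF this, of "1 / sqrt m"]
  have J: "((\<lambda>u. 1 / sqrt m * (1 / sqrt (1 - 2 * u / pi))) has_integral pi / sqrt m) {0..pi/2}"
    by simp
  have "continuous_on {0..pi/2} (\<lambda>u. 1 / sqrt (1 - (k * sin u)\<^sup>2))"
    using one_minus_mult_sin_square_pos[OF k] by (intro continuous_intros ballI) (metis less_irrefl real_sqrt_eq_zero_cancel_iff)
  then have I: "(\<lambda>u. 1 / sqrt (1 - (k * sin u)\<^sup>2)) integrable_on {0..pi/2}"
    by (rule integrable_continuous_real)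
  have "integral {0..pi/2} (\<lambda>u. 1 / sqrt (1 - (k * sin u)\<^sup>2)) = integral {0<..<pi/2} (\<lambda>u. 1 / sqrt (1 - (k * sin u)\<^sup>2))"
    by (simp add: integral_open_interval_real)
  also have "\<dots> \<le> integral {0<..<pi/2} (\<lambda>u. 1 / sqrt m * (1 / sqrt (1 - 2 * u / pi)))"
  proof (rule integral_le)
    show "(\<lambda>u. 1 / sqrt (1 - (k * sin u)\<^sup>2)) integrable_on {0<..<pi/2}"
         "(\<lambda>u. 1 / sqrt m * (1 / sqrt (1 - 2 * u / pi))) integrable_on {0<..<pi/2}"
      using I J by (auto simp: integrable_on_open_interval_real)
    fix u :: real assume u: "u \<in> {0<..<pi/2}"
    define A where "A = 1 - (k * sin u)\<^sup>2"
    have cos: "1 - 2 * u / pi \<le> cos u" "0 < 1 - 2 * u / pi"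
    proof -
      show pos: "0 < 1 - 2 * u / pi"
        using u by (simp add: field_simps)
      have convex: "convex_on {0..pi/2} (\<lambda>x. - cos x)"
        by (rule f''_ge0_imp_convex[where f' = sin and f'' = cos])
           (auto intro!: derivative_eq_intros cos_ge_zero)
      have "- cos ((1 - 2 * u / pi) *\<^sub>R 0 + (2 * u / pi) *\<^sub>R (pi / 2)) \<le>
          (1 - 2 * u / pi) * - cos 0 + 2 * u / pi * - cos (pi / 2)"
        using pos u by (intro convex_onD[OF convex]) auto
      then show "1 - 2 * u / pi \<le> cos u"
        by simp
    qed
    have k2: "k\<^sup>2 \<le> 1"
      using k by (simp add: power_le_one)
    have "m * cos u \<le> A"
    proof (rule power2_le_imp_le)
      have "m\<^sup>2 \<le> A"
        using k sin_squared_eq[of u] mult_left_mono[of "(sin u)\<^sup>2" 1 "k\<^sup>2"] m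
        by (simp add: m_def A_def power_mult_distrib abs_square_le_1 k2)
      moreover have "(cos u)\<^sup>2 \<le> A"
        using k2 mult_right_mono[OF k2, of "(sin u)\<^sup>2"] by (simp add: A_def power_mult_distrib cos_squared_eq)
      ultimately show "(m * cos u)\<^sup>2 \<le> A\<^sup>2"
        unfolding power_mult_distrib power2_eq_square[of A]
        by (intro mult_mono) (auto intro: order_trans[OF zero_le_power2])
      show "0 \<le> A"
        using one_minus_mult_sin_square_pos[OF k, of u] by (simp add: A_def)
    qed
    then have "m * (1 - 2 * u / pi) \<le> A"
      using cos m mult_left_mono[OF cos(1), of m] by linarith
    then have "sqrt m * sqrt (1 - 2 * u / pi) \<le> sqrt A"
      by (simp flip: real_sqrt_mult)
    moreover have "0 < sqrt m * sqrt (1 - 2 * u / pi)"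
      using m cos by simp
    moreover have "0 < A"
      using one_minus_mult_sin_square_pos[OF k, of u] by (simp add: A_def)
    ultimately have "1 / sqrt A \<le> 1 / (sqrt m * sqrt (1 - 2 * u / pi))"
      using m cos(2) by (intro divide_left_mono mult_pos_pos) auto
    then show "1 / sqrt (1 - (k * sin u)\<^sup>2) \<le> 1 / sqrt m * (1 / sqrt (1 - 2 * u / pi))"
      by (simp add: A_def)
  qed
  also have "\<dots> = pi / sqrt m"
    unfolding integral_open_interval_real[symmetric] by (rule integral_unique[OF J])
  finally show ?thesis
    by (simp add: m_def)
qed

lemma norm_mehler_le:
  assumes k: "0 \<le> k" "k < 1"
  shows "norm (mehler \<nu> k) \<le> exp (\<bar>Im \<nu>\<bar> * (2 * arcsin k)) * (pi / sqrt (sqrt (1 - k\<^sup>2)))"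
proof -
  define K where "K u = 1 / sqrt (1 - (k * sin u)\<^sup>2)" for u
  have K: "K integrable_on {0..pi/2}"
    unfolding K_def using one_minus_mult_sin_square_pos[OF k]
    by (intro integrable_continuous_real continuous_intros ballI) (metis less_irrefl real_sqrt_eq_zero_cancel_iff)
  have "norm (mehler \<nu> k) \<le> integral {0..pi/2} (\<lambda>u. exp (\<bar>Im \<nu>\<bar> * (2 * arcsin k)) * K u)"
    unfolding mehler_def
  proof (rule Henstock_Kurzweil_Integration.integral_norm_bound_integral)
    show "(\<lambda>u. exp (\<bar>Im \<nu>\<bar> * (2 * arcsin k)) * K u) integrable_on {0..pi/2}"
      by (intro integrable_on_mult_right K)
    fix u :: real assume u: "u \<in> {0..pi/2}"
    then have s: "0 \<le> k * sin u" "k * sin u \<le> k" "k * sin u < 1"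
      using abs_mult_sin_le[of k u] k sin_ge_zero[of u] by auto
    have "norm (mehler_kernel \<nu> (k * sin u)) \<le> exp (\<bar>Im \<nu>\<bar> * (2 * arcsin (k * sin u))) * K u"
      using norm_mehler_kernel_le[OF s(1,3), of \<nu>] by (simp add: K_def)
    also have "\<dots> \<le> exp (\<bar>Im \<nu>\<bar> * (2 * arcsin k)) * K u"
      using s k one_minus_mult_sin_square_pos[OF k, of u] arcsin_le_arcsin[of "k * sin u" k]
      by (intro mult_right_mono) (auto simp: K_def mult.commute[of "\<bar>Im \<nu>\<bar>"] intro!: mult_right_mono)
    finally show "norm (mehler_kernel \<nu> (k * sin u)) \<le> exp (\<bar>Im \<nu>\<bar> * (2 * arcsin k)) * K u" .
  qed (rule integrable_on_mehler_kernel[OF k])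
  also have "\<dots> = exp (\<bar>Im \<nu>\<bar> * (2 * arcsin k)) * integral {0..pi/2} K"
    by (simp add: integral_mult_right)
  also have "\<dots> \<le> exp (\<bar>Im \<nu>\<bar> * (2 * arcsin k)) * (pi / sqrt (sqrt (1 - k\<^sup>2)))"
    using integral_elliptic_le[OF k] by (intro mult_left_mono) (auto simp: K_def[abs_def])
  finally show ?thesis .
qed

text \<open>
  For \<open>\<nu> = i t - 1/2\<close> the integrand is at most \<open>e\<^bsup>t \<beta>\<^esup>\<close> times a bounded factor, and \<open>\<beta> < \<theta>\<close> except at the
  end of the interval; so after division by \<open>e\<^bsup>t \<theta>\<^esup>\<close> it tends to 0 pointwise and boundedly.
\<close>

lemma mehler_decay:
  assumes k: "0 < k" "k < 1"
  shows "((\<lambda>t. of_real (exp (- t * (2 * arcsin k))) * mehler (\<i> * of_real t - 1/2) k) \<longlongrightarrow> 0) at_top"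
proof -
  define f where "f t u = of_real (exp (- t * (2 * arcsin k))) * mehler_kernel (\<i> * of_real t - 1/2) (k * sin u)" for t u
  have f_int: "set_integrable lborel {0<..<pi/2} (f t)" for t
  proof -
    have "set_integrable lborel {0..pi/2} (f t)"
      unfolding f_def using k
      by (intro borel_integrable_atLeastAtMost' continuous_intros continuous_on_mehler_kernel_sin) auto
    then show ?thesis
      by (rule set_integrable_subset) auto
  qed
  have "((\<lambda>t. \<integral>u. indicator {0<..<pi/2} u *\<^sub>R f t u \<partial>lborel) \<longlongrightarrow> integral\<^sup>L lborel (\<lambda>_::real. 0)) at_top"
  proof (rule integral_dominated_convergence_at_top[where s = "\<lambda>t u. indicator {0<..<pi/2} u *\<^sub>R f t u"
        and f = "\<lambda>_. 0" and M = lborel and w = "\<lambda>u. indicator {0<..<pi/2::real} u *\<^sub>R (1 / sqrt (1 - k\<^sup>2))"])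
    show "(\<lambda>u. indicator {0<..<pi/2} u *\<^sub>R f t u) \<in> borel_measurable lborel" for t
      using f_int unfolding set_integrable_def by (rule borel_measurable_integrable)
    show "integrable lborel (\<lambda>u. indicator {0<..<pi/2::real} u *\<^sub>R (1 / sqrt (1 - k\<^sup>2)))"
      by (intro integrable_scaleR_left) auto
    have bound: "norm (f t u) \<le> exp (- t * (2 * (arcsin k - arcsin (k * sin u)))) * (1 / sqrt (1 - k\<^sup>2))"
      if u: "u \<in> {0<..<pi/2}" and t: "t \<ge> 0" for t u
    proof -
      have "0 \<le> k * sin u" "\<bar>k * sin u\<bar> \<le> k"
        using u abs_mult_sin_le[of k u] k sin_ge_zero[of u] by auto
      then have s: "0 \<le> k * sin u" "k * sin u \<le> k" "k * sin u < 1"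
        using k by linarith+
      have "sqrt (1 - k\<^sup>2) \<le> sqrt (1 - (k * sin u)\<^sup>2)"
        using s by (simp add: power_mono)
      moreover have "0 < sqrt (1 - k\<^sup>2)"
        using k one_minus_square_pos[of k] by simp
      ultimately have r: "1 / sqrt (1 - (k * sin u)\<^sup>2) \<le> 1 / sqrt (1 - k\<^sup>2)"
        by (intro divide_left_mono) auto
      have "norm (f t u) \<le> exp (- t * (2 * arcsin k)) * (exp (t * (2 * arcsin (k * sin u))) / sqrt (1 - (k * sin u)\<^sup>2))"
        using mult_left_mono[OF norm_mehler_kernel_le[OF s(1,3), of "\<i> * of_real t - 1/2"], of "exp (- t * (2 * arcsin k))"] t
        by (simp add: f_def norm_mult)
      also have "\<dots> = exp (- t * (2 * (arcsin k - arcsin (k * sin u)))) * (1 / sqrt (1 - (k * sin u)\<^sup>2))"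
        by (simp add: algebra_simps flip: exp_add)
      also have "\<dots> \<le> exp (- t * (2 * (arcsin k - arcsin (k * sin u)))) * (1 / sqrt (1 - k\<^sup>2))"
        using r by (intro mult_left_mono) auto
      finally show ?thesis .
    qed
    have gap: "arcsin (k * sin u) < arcsin k" if u: "u \<in> {0<..<pi/2}" for u
    proof -
      have "sin u < sin (pi/2)"
        using u by (intro sin_monotone_2pi) auto
      then have "k * sin u < k"
        using k by simp
      moreover have "0 \<le> k * sin u"
        using u k sin_ge_zero[of u] by auto
      ultimately show ?thesis
        using k by (intro arcsin_less_arcsin) auto
    qed
    show "\<forall>\<^sub>F t in at_top. AE u in lborel. norm (indicator {0<..<pi/2} u *\<^sub>R f t u) \<le> indicator {0<..<pi/2} u *\<^sub>R (1 / sqrt (1 - k\<^sup>2))"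
      using eventually_ge_at_top[of "0::real"]
    proof eventually_elim
      fix t :: real assume t: "0 \<le> t"
      show "AE u in lborel. norm (indicator {0<..<pi/2} u *\<^sub>R f t u) \<le> indicator {0<..<pi/2} u *\<^sub>R (1 / sqrt (1 - k\<^sup>2))"
      proof (intro AE_I2)
        fix u :: real
        show "norm (indicator {0<..<pi/2} u *\<^sub>R f t u) \<le> indicator {0<..<pi/2} u *\<^sub>R (1 / sqrt (1 - k\<^sup>2))"
        proof (cases "u \<in> {0<..<pi/2}")
          case True
          have "exp (- t * (2 * (arcsin k - arcsin (k * sin u)))) \<le> 1"
            using gap[OF True] t by (simp add: mult_nonneg_nonneg)
          then have "exp (- t * (2 * (arcsin k - arcsin (k * sin u)))) * (1 / sqrt (1 - k\<^sup>2)) \<le> 1 * (1 / sqrt (1 - k\<^sup>2))"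
            using k one_minus_square_pos[of k] by (intro mult_right_mono) auto
          with bound[OF True t] True show ?thesis
            by simp
        qed simp
      qed
    qed
    show "AE u in lborel. ((\<lambda>t. indicator {0<..<pi/2} u *\<^sub>R f t u) \<longlongrightarrow> 0) at_top"
    proof (intro AE_I2)
      fix u :: real
      show "((\<lambda>t. indicator {0<..<pi/2} u *\<^sub>R f t u) \<longlongrightarrow> 0) at_top"
      proof (cases "u \<in> {0<..<pi/2}")
        case True
        define d where "d = 2 * (arcsin k - arcsin (k * sin u))"
        have "d > 0"
          using gap[OF True] by (simp add: d_def)
        then have "((\<lambda>t. exp (- t * d) * (1 / sqrt (1 - k\<^sup>2))) \<longlongrightarrow> 0) at_top"
          by real_asymp
        moreover have "\<forall>\<^sub>F t in at_top. norm (f t u) \<le> exp (- t * d) * (1 / sqrt (1 - k\<^sup>2))"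
          using eventually_ge_at_top[of "0::real"] by eventually_elim (use bound[OF True] in \<open>auto simp: d_def\<close>)
        ultimately have "((\<lambda>t. f t u) \<longlongrightarrow> 0) at_top"
          by (rule Lim_null_comparison[rotated])
        with True show ?thesis
          by simp
      qed simp
    qed
  qed simp
  moreover have "(\<integral>u. indicator {0<..<pi/2} u *\<^sub>R f t u \<partial>lborel) =
      of_real (exp (- t * (2 * arcsin k))) * mehler (\<i> * of_real t - 1/2) k" for t
  proof -
    have "(\<integral>u. indicator {0<..<pi/2} u *\<^sub>R f t u \<partial>lborel) = integral {0<..<pi/2} (f t)"
      using set_borel_integral_eq_integral(2)[OF f_int[of t]] by (simp add: set_lebesgue_integral_def)
    also have "\<dots> = integral {0..pi/2} (f t)"
      by (simp add: integral_open_interval_real)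
    finally show ?thesis
      by (simp add: f_def[abs_def] mehler_def)
  qed
  ultimately show ?thesis
    by simp
qed

section \<open>An interpolation theorem for even entire functions\<close>

text \<open>
  The zeros of \<open>cos (\<pi> s)\<close> are the points \<open>\<plusminus> (k + 1/2)\<close>; the positive ones correspond to the degrees
  \<open>\<nu> = 0, 1, 2, \<dots>\<close>.
\<close>

definition half_int :: "nat \<Rightarrow> real" where
  "half_int k = real k + 1 / 2"

text \<open>
  The bracket of the closed form, in the variable \<open>s = \<nu> + 1/2\<close>, in which it is even.
\<close>

definition psi_sym :: "complex \<Rightarrow> complex" where
  "psi_sym s = (Digamma (1/2 + s) + Digamma (1/2 - s)) / 2 + euler_mascheroni + 2 * of_real (ln 2)"

lemma psi_sym_minus: "psi_sym (-s) = psi_sym s"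
  by (simp add: psi_sym_def add.commute)

lemma psi_sym_0: "psi_sym 0 = 0"
  by (simp add: psi_sym_def Digamma_one_half field_simps)

lemma cos_pi_eq_0_iff:
  fixes s :: complex
  shows "cos (of_real pi * s) = 0 \<longleftrightarrow> (\<exists>k. s = of_real (half_int k) \<or> s = - of_real (half_int k))"
proof -
  have "cos (of_real pi * s) = 0 \<longleftrightarrow> (\<exists>n::int. s = of_int n + 1/2)"
  proof -
    have "of_real pi * s = of_real (real_of_int n * pi) + of_real pi / 2 \<longleftrightarrow> s = of_int n + 1/2" for n :: int
    proof -
      have "complex_of_real (real_of_int n * pi) + of_real pi / 2 = of_real pi * (of_int n + 1/2)"
        by (simp add: algebra_simps)
      then show ?thesis
        by (simp only: mult_cancel_left) simp
    qed
    then show ?thesis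
      unfolding cos_eq_0 by simp
  qed
  also have "\<dots> \<longleftrightarrow> (\<exists>k. s = of_real (half_int k) \<or> s = - of_real (half_int k))"
  proof
    assume "\<exists>n::int. s = of_int n + 1/2"
    then obtain n :: int where n: "s = of_int n + 1/2"
      by blast
    show "\<exists>k. s = of_real (half_int k) \<or> s = - of_real (half_int k)"
    proof (cases "n \<ge> 0")
      case True
      then show ?thesis
        by (intro exI[of _ "nat n"]) (simp add: n half_int_def)
    next
      case False
      then have "(of_nat (nat (- n - 1)) :: complex) = - of_int n - 1"
        by simp
      then show ?thesis
        by (intro exI[of _ "nat (- n - 1)"]) (simp add: n half_int_def)
    qed
  next
    assume "\<exists>k. s = of_real (half_int k) \<or> s = - of_real (half_int k)"
    then obtain k where "s = of_real (half_int k) \<or> s = - of_real (half_int k)"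
      by blast
    then have "s = of_int (int k) + 1/2 \<or> s = of_int (- int k - 1) + 1/2"
      by (auto simp: half_int_def)
    then show "\<exists>n::int. s = of_int n + 1/2"
      by blast
  qed
  finally show ?thesis .
qed

lemma half_plus_minus_notin_nonpos_Ints:
  fixes s :: complex
  assumes "cos (of_real pi * s) \<noteq> 0"
  shows "1/2 + s \<notin> \<int>\<^sub>\<le>\<^sub>0" "1/2 - s \<notin> \<int>\<^sub>\<le>\<^sub>0"
proof -
  have *: "\<exists>k. z = - of_nat k" if "z \<in> \<int>\<^sub>\<le>\<^sub>0" for z :: complex
    using that by (auto elim!: nonpos_Ints_cases')
  show "1/2 + s \<notin> \<int>\<^sub>\<le>\<^sub>0"
  proof
    assume "1/2 + s \<in> \<int>\<^sub>\<le>\<^sub>0"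
    then obtain k where "1/2 + s = - of_nat k" using * by blast
    then have "s = - of_real (half_int k)"
      by (simp add: half_int_def algebra_simps eq_neg_iff_add_eq_0)
    then show False
      using assms cos_pi_eq_0_iff by blast
  qed
  show "1/2 - s \<notin> \<int>\<^sub>\<le>\<^sub>0"
  proof
    assume "1/2 - s \<in> \<int>\<^sub>\<le>\<^sub>0"
    then obtain k where "1/2 - s = - of_nat k" using * by blast
    then have "s = of_real (half_int k)"
      by (simp add: half_int_def algebra_simps)
    then show False
      using assms cos_pi_eq_0_iff by blast
  qed
qed

lemma open_cos_pi_nonzero: "open {s. cos (of_real pi * s :: complex) \<noteq> 0}"
  by (intro open_Collect_neq continuous_intros)

lemma holomorphic_psi_sym: "psi_sym holomorphic_on {s. cos (of_real pi * s) \<noteq> 0}"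
proof -
  have 1: "(\<lambda>s. Digamma (1/2 + s)) holomorphic_on {s. cos (of_real pi * s :: complex) \<noteq> 0}"
    using half_plus_minus_notin_nonpos_Ints(1)
    by (intro holomorphic_on_compose_gen[of "\<lambda>s. 1/2 + s" _ Digamma "-\<int>\<^sub>\<le>\<^sub>0", unfolded o_def] holomorphic_intros) auto
  have 2: "(\<lambda>s. Digamma (1/2 - s)) holomorphic_on {s. cos (of_real pi * s :: complex) \<noteq> 0}"
    using half_plus_minus_notin_nonpos_Ints(2)
    by (intro holomorphic_on_compose_gen[of "\<lambda>s. 1/2 - s" _ Digamma "-\<int>\<^sub>\<le>\<^sub>0", unfolded o_def] holomorphic_intros) auto
  show ?thesis
    unfolding psi_sym_def[abs_def] using 1 2 by (intro holomorphic_intros) auto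
qed

text \<open>
  Adding the digamma series at \<open>1/2 + s\<close> and \<open>1/2 - s\<close> combines the poles at \<open>\<plusminus> (k + 1/2)\<close> in one term.
\<close>

lemma psi_sym_sums:
  assumes "cos (of_real pi * s) \<noteq> 0"
  shows "(\<lambda>k. 1 / of_nat (Suc k) - of_real (half_int k) / ((of_real (half_int k))\<^sup>2 - s\<^sup>2))
    sums (psi_sym s - 2 * of_real (ln 2))"
proof -
  have ne: "1/2 + s \<noteq> 0" "1/2 - s \<noteq> 0"
    using half_plus_minus_notin_nonpos_Ints[OF assms] by (metis zero_in_nonpos_Ints)+
  have D: "(\<lambda>k. inverse (of_nat (Suc k)) - inverse (z + of_nat k)) sums (Digamma z + euler_mascheroni)"
    if "z \<noteq> 0" for z :: complex
    using summable_Digamma[OF that] by (simp add: Digamma_def summable_sums)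
  have "(\<lambda>k. ((inverse (of_nat (Suc k)) - inverse (1/2 + s + of_nat k)) +
      (inverse (of_nat (Suc k)) - inverse (1/2 - s + of_nat k))) / 2)
    sums ((Digamma (1/2 + s) + euler_mascheroni + (Digamma (1/2 - s) + euler_mascheroni)) / 2)"
    by (intro sums_divide sums_add D ne)
  also have "(Digamma (1/2 + s) + euler_mascheroni + (Digamma (1/2 - s) + euler_mascheroni)) / 2 =
      psi_sym s - 2 * of_real (ln 2)"
    by (simp add: psi_sym_def field_simps)
  also have "(\<lambda>k. ((inverse (of_nat (Suc k)) - inverse (1/2 + s + of_nat k)) +
      (inverse (of_nat (Suc k)) - inverse (1/2 - s + of_nat k))) / 2) =
    (\<lambda>k. 1 / of_nat (Suc k) - of_real (half_int k) / ((of_real (half_int k))\<^sup>2 - s\<^sup>2))"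
  proof
    fix k
    define a :: complex where "a = of_real (half_int k)"
    have "s \<noteq> a" "s \<noteq> -a"
      using assms cos_pi_eq_0_iff[of s] unfolding a_def by blast+
    then have ne: "a + s \<noteq> 0" "a - s \<noteq> 0"
      by (auto simp: add_eq_0_iff2)
    have "inverse (a + s) + inverse (a - s) = 2 * (a / (a\<^sup>2 - s\<^sup>2))"
      using ne by (simp add: field_simps power2_eq_square)
    moreover have "1/2 + s + of_nat k = a + s" "1/2 - s + of_nat k = a - s"
      by (simp_all add: a_def half_int_def)
    moreover have "((u - x) + (u - y)) / 2 = u - w" if "x + y = 2 * w" for u x y w :: complex
      using that by (simp add: field_simps)
    ultimately show "((inverse (of_nat (Suc k)) - inverse (1/2 + s + of_nat k)) +
      (inverse (of_nat (Suc k)) - inverse (1/2 - s + of_nat k))) / 2 =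
      1 / of_nat (Suc k) - of_real (half_int k) / ((of_real (half_int k))\<^sup>2 - s\<^sup>2)"
      unfolding a_def [symmetric] by (metis inverse_eq_divide)
  qed
  finally show ?thesis .
qed

definition basel :: real where "basel = (\<Sum>k. 1 / (real k + 1)\<^sup>2)"

lemma summable_basel: "summable (\<lambda>k. 1 / (real k + 1)\<^sup>2)"
  using inverse_power_summable[of 2, where 'a = real] summable_Suc_iff[of "\<lambda>n. inverse (real n ^ 2)"]
  by (simp add: field_simps)

text \<open>
  A term of the series has numerator \<open>s\<^sup>2 + a / 2\<close> and denominator \<open>(k + 1) (a\<^sup>2 - s\<^sup>2)\<close>, where
  \<open>a = k + 1/2\<close>; the hypothesis bounds it by \<open>M / (k + 1)\<^sup>2\<close>.
\<close>

lemma norm_psi_sym_le: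
  assumes s: "cos (of_real pi * s) \<noteq> 0"
    and le: "\<And>k. norm (s\<^sup>2 + of_real (half_int k) / 2) * (real k + 1)
        \<le> M * norm ((of_real (half_int k))\<^sup>2 - s\<^sup>2)"
  shows "norm (psi_sym s) \<le> M * basel + 2 * ln 2"
proof -
  define t where "t k = 1 / of_nat (Suc k) - of_real (half_int k) / ((of_real (half_int k))\<^sup>2 - s\<^sup>2)" for k
  have t: "norm (t k) \<le> M * (1 / (real k + 1)\<^sup>2)" for k
  proof -
    define a :: complex where "a = of_real (half_int k)"
    have "s \<noteq> a" "s \<noteq> -a"
      using s cos_pi_eq_0_iff[of s] unfolding a_def by blast+
    then have ne: "a\<^sup>2 - s\<^sup>2 \<noteq> 0"
      by (auto simp: power2_eq_iff)
    have k: "of_nat (Suc k) = a + 1/2"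
      by (simp add: a_def half_int_def)
    have k0: "a + 1/2 \<noteq> 0"
      unfolding k[symmetric] by (rule of_nat_neq_0)
    have "t k = - ((s\<^sup>2 + a / 2) / (of_nat (Suc k) * (a\<^sup>2 - s\<^sup>2)))"
    proof -
      have "1 / (a + 1/2) - a / (a\<^sup>2 - s\<^sup>2) = ((a\<^sup>2 - s\<^sup>2) - a * (a + 1/2)) / ((a + 1/2) * (a\<^sup>2 - s\<^sup>2))"
        using ne k0 by (simp add: diff_frac_eq)
      also have "(a\<^sup>2 - s\<^sup>2) - a * (a + 1/2) = - (s\<^sup>2 + a / 2)"
        by (simp add: power2_eq_square algebra_simps)
      finally show ?thesis
        unfolding t_def a_def[symmetric] k by (metis minus_divide_left)
    qed
    then have "norm (t k) = norm (s\<^sup>2 + a / 2) / ((real k + 1) * norm (a\<^sup>2 - s\<^sup>2))"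
      by (simp add: norm_divide norm_mult del: of_nat_Suc)
    also have "\<dots> \<le> M * (1 / (real k + 1)\<^sup>2)"
      using le[of k] ne unfolding a_def[symmetric]
      by (simp add: divide_simps power2_eq_square)
    finally show ?thesis .
  qed
  have sums: "(\<lambda>k. M * (1 / (real k + 1)\<^sup>2)) sums (M * basel)"
    unfolding basel_def by (intro sums_mult summable_sums summable_basel)
  have "norm (suminf t) \<le> (\<Sum>k. M * (1 / (real k + 1)\<^sup>2))"
    using t by (intro norm_suminf_le sums_summable[OF sums]) auto
  moreover have "suminf t = psi_sym s - 2 * of_real (ln 2)"
    using psi_sym_sums[OF s] by (simp add: t_def[abs_def] sums_iff)
  ultimately have "norm (psi_sym s - 2 * of_real (ln 2)) \<le> M * basel"
    using sums by (simp add: sums_iff)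
  moreover have "norm (psi_sym s) \<le> norm (psi_sym s - 2 * of_real (ln 2)) + norm (2 * of_real (ln 2) :: complex)"
    by (metis diff_add_cancel norm_triangle_ineq)
  ultimately show ?thesis
    by (simp add: norm_mult)
qed

text \<open>
  The circles \<open>\<bar>s\<bar> = N\<close> stay at distance at least 1/2 from the poles. One of \<open>\<bar>a - s\<bar>\<close>, \<open>\<bar>a + s\<bar>\<close> is at least
  \<open>\<bar>a - N\<bar>\<close> and the other one at least \<open>max a N\<close>. For \<open>k + 1 \<le> 2N\<close> the gap 1/2 is enough; for larger
  \<open>k\<close> one has \<open>\<bar>a - N\<bar> \<ge> a / 2\<close>.
\<close>

lemma norm_psi_sym_circle:
  assumes s: "norm s = real N" "N \<ge> 1"
  shows "cos (of_real pi * s) \<noteq> 0" "norm (psi_sym s) \<le> 10 * (real N)\<^sup>2 * basel + 2 * ln 2"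
proof -
  show 1: "cos (of_real pi * s) \<noteq> 0"
  proof
    assume "cos (of_real pi * s) = 0"
    then obtain k where "s = of_real (half_int k) \<or> s = - of_real (half_int k)"
      unfolding cos_pi_eq_0_iff by blast
    then have "norm s = half_int k"
      by (auto simp: half_int_def norm_minus_cancel simp del: of_real_add)
    then have "real N = real k + 1/2"
      using s by (simp add: half_int_def)
    then have "real (2 * N) = real (2 * k + 1)"
      by simp
    then have "2 * N = 2 * k + 1"
      by (simp only: of_nat_eq_iff)
    then show False
      by presburger
  qed
  show "norm (psi_sym s) \<le> 10 * (real N)\<^sup>2 * basel + 2 * ln 2"
  proof (rule norm_psi_sym_le[OF 1])
    fix k
    define a where "a = half_int k"
    have a: "a > 0" "a = real k + 1/2"
      by (auto simp: a_def half_int_def)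
    have na: "norm (complex_of_real a) = a"
      using a(1) by simp
    have N: "real N \<ge> 1" using s by simp
    have gap: "\<bar>a - real N\<bar> \<ge> 1/2"
    proof (cases "k < N")
      case True
      then have "real k + 1 \<le> real N" by linarith
      then show ?thesis using a by linarith
    next
      case False
      then show ?thesis using a by linarith
    qed
    have l1: "norm (of_real a - s) \<ge> \<bar>a - real N\<bar>" "norm (of_real a + s) \<ge> \<bar>a - real N\<bar>"
      using norm_triangle_ineq3[of "of_real a" s] norm_triangle_ineq3[of "of_real a" "-s"] s
      by (simp_all only: na diff_minus_eq_add norm_minus_cancel)
    have "(of_real a - s) + (of_real a + s) = of_real (2 * a)"
        "(of_real a + s) - (of_real a - s) = 2 * s"
      by simp_all
    then have nn: "norm ((of_real a - s) + (of_real a + s)) = 2 * a"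
        "norm ((of_real a + s) - (of_real a - s)) = 2 * real N"
      using a(1) s(1) by (simp_all only: norm_of_real norm_mult) auto
    have "norm (of_real a - s) + norm (of_real a + s) \<ge> 2 * a"
      using norm_triangle_ineq[of "of_real a - s" "of_real a + s"] unfolding nn by linarith
    moreover have "norm (of_real a - s) + norm (of_real a + s) \<ge> 2 * real N"
      using norm_triangle_ineq4[of "of_real a + s" "of_real a - s"] unfolding nn by linarith
    ultimately have l2: "norm (of_real a - s) \<ge> max a (real N) \<or> norm (of_real a + s) \<ge> max a (real N)"
      by linarith
    have prod: "norm ((of_real a)\<^sup>2 - s\<^sup>2) \<ge> \<bar>a - real N\<bar> * max a (real N)"
    proof -
      have "norm ((of_real a)\<^sup>2 - s\<^sup>2) = norm (of_real a - s) * norm (of_real a + s)"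
        by (simp add: norm_mult[symmetric] power2_eq_square algebra_simps)
      then show ?thesis
        using l1 l2 a by (metis abs_ge_zero max.coboundedI1 mult.commute mult_mono norm_ge_zero less_imp_le)
    qed
    have num: "norm (s\<^sup>2 + of_real a / 2) \<le> (real N)\<^sup>2 + a / 2"
    proof -
      have "norm (complex_of_real a / 2) = a / 2" "norm (s\<^sup>2) = (real N)\<^sup>2"
        using na s by (simp_all only: norm_divide norm_numeral norm_power)
      then show ?thesis
        using norm_triangle_ineq[of "s\<^sup>2" "of_real a / 2"] by (simp only:)
    qed
    have "((real N)\<^sup>2 + a / 2) * (real k + 1) \<le> 10 * (real N)\<^sup>2 * (\<bar>a - real N\<bar> * max a (real N))"
    proof (cases "real k + 1 \<le> 2 * real N")
      case True
      have "1/2 * real N \<le> \<bar>a - real N\<bar> * max a (real N)"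
        using gap N by (intro mult_mono) auto
      then have "10 * (real N)\<^sup>2 * (1/2 * real N) \<le> 10 * (real N)\<^sup>2 * (\<bar>a - real N\<bar> * max a (real N))"
        by (intro mult_left_mono) auto
      moreover have "real N \<le> (real N)\<^sup>2"
        using N by (simp add: power2_eq_square)
      then have "(real N)\<^sup>2 + a / 2 \<le> 2 * (real N)\<^sup>2"
        using True a by linarith
      then have "((real N)\<^sup>2 + a / 2) * (real k + 1) \<le> (2 * (real N)\<^sup>2) * (2 * real N)"
        using True a N by (intro mult_mono) auto
      moreover have "0 \<le> (real N)\<^sup>2 * real N" by simp
      ultimately show ?thesis by linarith
    next
      case False
      then have "real (2 * N) < real (k + 1)"
        by simp
      then have "2 * N \<le> k"
        by (simp only: of_nat_less_iff)
      then have "real (2 * N) \<le> real k"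
        by (simp only: of_nat_le_iff)
      then have *: "a \<ge> 2 * real N + 1/2"
        using a by simp
      then have "1/2 * a * a \<le> \<bar>a - real N\<bar> * max a (real N)"
        using a by (intro mult_mono) auto
      then have "10 * (real N)\<^sup>2 * (1/2 * a * a) \<le> 10 * (real N)\<^sup>2 * (\<bar>a - real N\<bar> * max a (real N))"
        by (intro mult_left_mono) auto
      moreover have "((real N)\<^sup>2 + a / 2) * (real k + 1) \<le> ((real N)\<^sup>2 * a + (real N)\<^sup>2 * a / 2) * (2 * a)"
      proof (intro mult_mono add_mono)
        show "(real N)\<^sup>2 \<le> (real N)\<^sup>2 * a" using * N by (intro mult_right_le_one_le[of "(real N)^2" a, THEN order_trans] | simp)+
        show "a / 2 \<le> (real N)\<^sup>2 * a / 2"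
          using mult_right_mono[of 1 "(real N)\<^sup>2" a] a(1) N by simp
      qed (use a N in auto)
      moreover have "0 \<le> (real N)\<^sup>2 * a * a" using a by simp
      ultimately show ?thesis
        by (simp add: algebra_simps)
    qed
    also have "\<dots> \<le> 10 * (real N)\<^sup>2 * norm ((of_real a)\<^sup>2 - s\<^sup>2)"
      by (intro mult_left_mono prod) auto
    finally have "((real N)\<^sup>2 + a / 2) * (real k + 1) \<le> 10 * (real N)\<^sup>2 * norm ((of_real a)\<^sup>2 - s\<^sup>2)" .
    with num show "norm (s\<^sup>2 + of_real (half_int k) / 2) * (real k + 1) \<le>
        10 * (real N)\<^sup>2 * norm ((of_real (half_int k))\<^sup>2 - s\<^sup>2)"
      unfolding a_def[symmetric] by (meson mult_right_mono order_trans add_nonneg_nonneg of_nat_0_le_iff zero_le_one)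
  qed
qed

lemma cos_pi_imaginary_nonzero: "cos (of_real pi * (\<i> * of_real t)) \<noteq> 0"
proof
  assume "cos (of_real pi * (\<i> * of_real t)) = 0"
  then obtain k where "\<i> * of_real t = complex_of_real (half_int k) \<or> \<i> * of_real t = - complex_of_real (half_int k)"
    unfolding cos_pi_eq_0_iff by blast
  then have "half_int k = 0"
    by (auto simp: complex_eq_iff)
  then show False
    by (simp add: half_int_def)
qed

text \<open>
  On the imaginary axis there is no cancellation in \<open>a\<^sup>2 - s\<^sup>2 = a\<^sup>2 + t\<^sup>2\<close>, and \<open>a\<^sup>2 + t\<^sup>2 \<ge> 2 a t\<close> yields
  linear growth, better than the quadratic bound on the circles; this matters for the quadratic
  coefficient in the Liouville argument.
\<close>

lemma norm_psi_sym_imaginary: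
  assumes "t \<ge> 1"
  shows "norm (psi_sym (\<i> * of_real t)) \<le> (t + 1) * basel + 2 * ln 2"
proof (rule norm_psi_sym_le[OF cos_pi_imaginary_nonzero])
  fix k
  define a where "a = half_int k"
  have a: "a > 0" "a = real k + 1/2"
    by (auto simp: a_def half_int_def)
  have "(of_real a)\<^sup>2 - (\<i> * of_real t)\<^sup>2 = of_real (a\<^sup>2 + t\<^sup>2)"
    by (simp add: power_mult_distrib)
  then have n1: "norm ((of_real a)\<^sup>2 - (\<i> * of_real t)\<^sup>2) = a\<^sup>2 + t\<^sup>2"
    by (metis abs_of_nonneg norm_of_real sum_power2_ge_zero)
  have "(\<i> * of_real t)\<^sup>2 + of_real a / 2 = of_real (a / 2 - t\<^sup>2)"
    by (simp add: power_mult_distrib)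
  then have n2: "norm ((\<i> * of_real t)\<^sup>2 + of_real a / 2) = \<bar>a / 2 - t\<^sup>2\<bar>"
    by (metis norm_of_real)
  have "\<bar>a / 2 - t\<^sup>2\<bar> \<le> a / 2 + t\<^sup>2"
    using a(1) zero_le_power2[of t] by linarith
  then have "\<bar>a / 2 - t\<^sup>2\<bar> * (real k + 1) \<le> (a / 2 + t\<^sup>2) * (2 * a)"
    using a by (intro mult_mono) auto
  also have "\<dots> = a\<^sup>2 + t * (2 * a * t)"
    by (simp add: power2_eq_square algebra_simps)
  also have "\<dots> \<le> (a\<^sup>2 + t\<^sup>2) + t * (a\<^sup>2 + t\<^sup>2)"
    using assms sum_squares_bound[of a t] by (intro add_mono mult_left_mono) auto
  finally show "norm ((\<i> * of_real t)\<^sup>2 + of_real (half_int k) / 2) * (real k + 1) \<le>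
      (t + 1) * norm ((of_real (half_int k))\<^sup>2 - (\<i> * of_real t)\<^sup>2)"
    unfolding a_def[symmetric] n1 n2 by (simp add: algebra_simps)
qed

lemma psi_sym_residue:
  "((\<lambda>s. (s - of_real (half_int n)) * psi_sym s) \<longlongrightarrow> 1/2) (at (of_real (half_int n)))"
proof -
  define a where "a = complex_of_real (half_int n)"
  have a: "a = of_nat n + 1/2"
    by (simp add: a_def half_int_def)
  \<comment> \<open>after the pole at \<open>s = a\<close> is split off by the functional equation, the rest is analytic at \<open>a\<close>\<close>
  define r where "r s = (Digamma (1/2 + s) + (Digamma (1 + (a - s)) -
      (\<Sum>k<n. 1 / (1/2 - s + of_nat k)))) / 2 + euler_mascheroni + 2 * of_real (ln 2)" for s :: complex
  have ev: "\<forall>\<^sub>F s in at a. 1/2 * 1 + (s - a) * r s = (s - a) * psi_sym s"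
  proof -
    have "\<forall>\<^sub>F s in at a. s \<in> ball a (1/2) - {a}"
      by (intro eventually_at_in_open) auto
    then show ?thesis
    proof eventually_elim
      fix s assume s: "s \<in> ball a (1/2) - {a}"
      have "1/2 - s \<noteq> - of_nat k" for k
      proof
        assume k: "1/2 - s = - of_nat k"
        then have "a - s = of_int (int n - int k)"
          by (simp add: a algebra_simps)
        then have "\<bar>real_of_int (int n - int k)\<bar> < 1/2"
          using s by (metis DiffD1 dist_norm mem_ball norm_of_int)
        then have "int n = int k"
          by linarith
        then show False
          using s k by (simp add: a algebra_simps)
      qed
      then have "\<forall>k<Suc n. 1/2 - s \<noteq> - of_nat k"
        by blast
      then have "Digamma (1/2 - s + of_nat (Suc n)) = Digamma (1/2 - s) + (\<Sum>k<Suc n. 1 / (1/2 - s + of_nat k))"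
        using Polygamma_plus_of_nat[of "Suc n" "1/2 - s" 0]
        by (simp del: of_nat_Suc sum.lessThan_Suc)
      then have "Digamma (1/2 - s) = Digamma (1/2 - s + of_nat (Suc n)) - (\<Sum>k<Suc n. 1 / (1/2 - s + of_nat k))"
        by (simp only: add_diff_cancel_right')
      moreover have "1/2 - s + of_nat (Suc n) = 1 + (a - s)" "1/2 - s + of_nat n = a - s"
        by (simp_all add: a)
      moreover have alg: "(X + (D - (S + q))) / 2 + c + d = (X + (D - S)) / 2 + c + d - q / 2"
        for X D S q c d :: complex
        by (simp add: field_simps)
      ultimately have psi: "psi_sym s = r s - 1 / (a - s) / 2"
        unfolding psi_sym_def r_def by (simp only: sum.lessThan_Suc)
      then show "1/2 * 1 + (s - a) * r s = (s - a) * psi_sym s"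
      proof -
        have "(s - a) * (1 / (a - s) / 2) = - 1/2"
          using s by (simp add: divide_simps) (auto simp: algebra_simps)
        then show ?thesis
          by (simp add: psi right_diff_distrib)
      qed
    qed
  qed
  have "isCont r a"
  proof -
    have ne: "1/2 - a + of_nat k \<noteq> 0" if "k < n" for k
    proof -
      have "1/2 - a + of_nat k = of_int (int k - int n)"
        by (simp add: a)
      then show ?thesis
        using that by (simp only: of_int_eq_0_iff)
    qed
    have "1/2 + a = of_nat (Suc n)"
      by (simp add: a)
    then have nonpos: "1/2 + a \<notin> \<int>\<^sub>\<le>\<^sub>0"
      by (simp only: of_nat_in_nonpos_Ints_iff)
    then have "isCont (\<lambda>s. Digamma (1/2 + s)) a"
      by (intro isCont_Polygamma continuous_intros) auto
    moreover have "isCont (\<lambda>s. Digamma (1 + (a - s))) a"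
      by (intro isCont_Polygamma continuous_intros) auto
    ultimately show ?thesis
      unfolding r_def[abs_def] using ne nonpos by (intro continuous_intros) auto
  qed
  then have "((\<lambda>s. 1/2 * 1 + (s - a) * r s) \<longlongrightarrow> 1/2 * 1 + (a - a) * r a) (at a)"
    by (intro tendsto_intros isContD)
  then have "((\<lambda>s. (s - a) * psi_sym s) \<longlongrightarrow> 1/2 * 1 + (a - a) * r a) (at a)"
    using ev by (rule Lim_transform_eventually)
  then show ?thesis
    by (simp add: a_def)
qed

text \<open>
  The exact square of the modulus is \<open>cos\<^sup>2 (\<pi> Re s) + sinh\<^sup>2 (\<pi> Im s)\<close>. For \<open>\<bar>Im s\<bar> \<ge> 1/2\<close> the second
  summand suffices. Otherwise \<open>s\<close> is near one of the points \<open>\<plusminus> N\<close>, within 1/4 in the real part, where the first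
  summand is at least 1/2.
\<close>

lemma norm_cos_pi_circle:
  assumes s: "norm (s::complex) = real N" "N \<ge> 1"
  shows "exp (2 * pi * \<bar>Im s\<bar>) \<le> 16 * norm (cos (of_real pi * s)) ^ 2"
proof -
  define x where "x = Re s"
  define y where "y = \<bar>Im s\<bar>"
  define E where "E = exp (pi * y)"
  have E: "E \<ge> 1" "exp (2 * pi * y) = E\<^sup>2"
    by (simp_all add: E_def y_def power2_eq_square flip: exp_add)
  have cos: "norm (cos (of_real pi * s)) ^ 2 = cos (pi * x) ^ 2 + (E - inverse E) ^ 2 / 4"
  proof (cases "Im s \<ge> 0")
    case True
    then show ?thesis
      by (simp add: norm_cos_squared E_def x_def y_def)
  next
    case False
    then show ?thesis
      by (simp add: norm_cos_squared E_def x_def y_def exp_minus power2_commute)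
  qed
  have xy: "x\<^sup>2 + y\<^sup>2 = (real N)\<^sup>2"
    using s by (simp add: x_def y_def cmod_power2[symmetric])
  have iE: "0 < inverse E" "inverse E \<le> 1"
    using E by (simp_all add: inverse_le_1_iff)
  show ?thesis
  proof (cases "y \<ge> 1/2")
    case True
    have "2 \<le> 1 + pi * y"
      using mult_mono[of 2 pi "1/2" y] True pi_ge_two by simp
    also have "\<dots> \<le> E"
      unfolding E_def by (rule exp_ge_add_one_self)
    finally have "E / 2 \<le> E - inverse E"
      using iE by linarith
    then have "(E / 2) ^ 2 \<le> (E - inverse E) ^ 2"
      using E by (intro power_mono) auto
    then have "E\<^sup>2 \<le> 4 * (E - inverse E) ^ 2"
      by (simp add: power_divide)
    moreover have "A \<le> 16 * (B + D / 4)" if "A \<le> 4 * D" "0 \<le> B" for A B D :: real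
      using that by simp
    ultimately show ?thesis
      unfolding cos y_def[symmetric] E(2) using zero_le_power2 by blast
  next
    case False
    have x: "\<bar>x\<bar> \<le> real N" "\<bar>x\<bar> \<ge> real N - 1/4"
    proof -
      have "\<bar>x\<bar>\<^sup>2 \<le> (real N)\<^sup>2"
        using xy zero_le_power2[of y] by (simp only: power2_abs)
      then show 1: "\<bar>x\<bar> \<le> real N"
        by (rule power2_le_imp_le) simp
      have "(real N - \<bar>x\<bar>) * 1 \<le> (real N - \<bar>x\<bar>) * (real N + \<bar>x\<bar>)"
        using 1 s(2) by (intro mult_left_mono) auto
      also have "\<dots> = y\<^sup>2"
        using xy by (simp add: algebra_simps power2_eq_square)
      also have "\<dots> \<le> (1/2)\<^sup>2"
        using False by (intro power_mono) (auto simp: y_def)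
      finally show "\<bar>x\<bar> \<ge> real N - 1/4"
        by (simp add: power2_eq_square)
    qed
    have "cos (2 * (pi * x)) = cos (2 * pi * \<bar>x\<bar>)"
      by (cases "x \<ge> 0") (simp_all add: mult_ac)
    also have "\<dots> = cos (2 * pi * (real N - \<bar>x\<bar>))"
      using cos_diff[of "real N * (2 * pi)" "2 * pi * \<bar>x\<bar>"] cos_2npi[of N] sin_2npi[of N]
      by (simp add: algebra_simps)
    also have "\<dots> \<ge> 0"
    proof (rule cos_ge_zero)
      have "2 * pi * (real N - \<bar>x\<bar>) \<ge> 0" using x by simp
      then show "- (pi / 2) \<le> 2 * pi * (real N - \<bar>x\<bar>)" using pi_ge_two by linarith
      have "2 * pi * (real N - \<bar>x\<bar>) \<le> 2 * pi * (1/4)"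
        using x by (intro mult_left_mono) auto
      then show "2 * pi * (real N - \<bar>x\<bar>) \<le> pi / 2" by simp
    qed
    finally have "cos (pi * x) ^ 2 \<ge> 1/2"
      by (simp add: cos_double_cos)
    moreover have "(E - inverse E) ^ 2 \<ge> E\<^sup>2 - 2"
    proof -
      have "(E - inverse E) ^ 2 = E\<^sup>2 - 2 + (inverse E)\<^sup>2"
        using E by (simp add: power2_eq_square algebra_simps)
      then show ?thesis by simp
    qed
    moreover have "A \<le> 16 * (B + D / 4)" if "1/2 \<le> B" "A - 2 \<le> D" "0 \<le> A" for A B D :: real
      using that by simp
    ultimately show ?thesis
      unfolding cos y_def[symmetric] E(2) using zero_le_power2 by blast
  qed
qed

lemma cos_pi_half_int: "cos (of_real pi * complex_of_real (half_int n)) = 0"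
  unfolding cos_pi_eq_0_iff by blast

lemma cos_pi_half_int_quotient:
  "((\<lambda>s. (cos (of_real pi * s))\<^sup>2 / (s - of_real (half_int n))\<^sup>2) \<longlongrightarrow> (of_real pi)\<^sup>2)
     (at (complex_of_real (half_int n)))"
proof -
  define a where "a = complex_of_real (half_int n)"
  have "((\<lambda>s. cos (of_real pi * s)) has_field_derivative - sin (of_real pi * a) * of_real pi) (at a)"
    by (auto intro!: derivative_eq_intros)
  then have "((\<lambda>s. cos (of_real pi * s) / (s - a)) \<longlongrightarrow> - sin (of_real pi * a) * of_real pi) (at a)"
    using cos_pi_half_int[of n] by (simp add: has_field_derivative_iff a_def)
  then have "((\<lambda>s. (cos (of_real pi * s) / (s - a))\<^sup>2) \<longlongrightarrow> (- sin (of_real pi * a) * of_real pi)\<^sup>2) (at a)"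
    by (rule tendsto_power)
  moreover have "(sin (of_real pi * a))\<^sup>2 = 1"
    using sin_cos_squared_add[of "of_real pi * a"] cos_pi_half_int[of n] by (simp add: a_def)
  ultimately show ?thesis
    by (simp add: power_divide power_mult_distrib a_def)
qed

text \<open>
  An even entire function of the growth of \<open>cos\<^sup>2 (\<pi> s)\<close> is determined by its values and derivatives at
  the points \<open>k + 1/2\<close>, provided that it is of smaller growth on the imaginary axis. Indeed the
  difference \<open>g\<close> of \<open>s\<^sup>2 \<pi>\<^sup>2 f / cos\<^sup>2 (\<pi> s)\<close> and \<open>psi_sym\<close> has removable singularities: the zeros of \<open>f\<close>
  reduce the double poles to simple ones, and the derivatives are such that the residue \<open>1/2\<close> of \<open>psi_sym\<close>
  is matched. By the bounds on the circles and the maximum principle its extension \<open>G\<close> is a polynomial of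
  degree at most 2, and the three coefficients vanish by \<open>G(0) = 0\<close>, evenness, and the decay of \<open>f\<close>.
\<close>

theorem entire_eq_cos_squared_mult_psi_sym:
  fixes f :: "complex \<Rightarrow> complex"
  assumes holo: "f holomorphic_on UNIV"
    and even: "\<And>s. f (-s) = f s"
    and bound: "\<And>s. norm (f s) \<le> C * exp (2 * pi * \<bar>Im s\<bar>)"
    and decay: "((\<lambda>t::real. f (\<i> * of_real t) * of_real (exp (- 2 * pi * t))) \<longlongrightarrow> 0) at_top"
    and zero: "\<And>n. f (of_real (half_int n)) = 0"
    and deriv: "\<And>n. (f has_field_derivative 1 / (2 * (of_real (half_int n))\<^sup>2)) (at (of_real (half_int n)))"
    and s: "cos (of_real pi * s) \<noteq> 0"
  shows "s\<^sup>2 * (of_real pi)\<^sup>2 * f s = (cos (of_real pi * s))\<^sup>2 * psi_sym s"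
proof -
  define U where "U = {s. cos (of_real pi * s :: complex) \<noteq> 0}"
  define g where "g = (\<lambda>s. s\<^sup>2 * (of_real pi)\<^sup>2 * f s / (cos (of_real pi * s))\<^sup>2 - psi_sym s)"
  have U: "open U"
    unfolding U_def by (rule open_cos_pi_nonzero)
  have g_holo: "g holomorphic_on U"
    unfolding g_def using holomorphic_psi_sym holomorphic_on_subset[OF holo]
    by (intro holomorphic_intros) (auto simp: U_def)
  have g_even: "g (-s) = g s" for s
    by (simp add: g_def even psi_sym_minus)
  have near: "\<forall>\<^sub>F s in at a. s \<in> U" if a: "a = of_real (half_int n)" for a n
  proof -
    have "\<forall>\<^sub>F s in at a. (cos (of_real pi * s))\<^sup>2 / (s - a)\<^sup>2 \<in> - {0}"
      using cos_pi_half_int_quotient[of n] unfolding a[symmetric]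
      by (rule topological_tendstoD) auto
    then show ?thesis
      by eventually_elim (auto simp: U_def)
  qed
  have residue: "((\<lambda>s. (s - a) * g s) \<longlongrightarrow> 0) (at a)" if a: "a = of_real (half_int n)" for a n
  proof -
    have a0: "a \<noteq> 0"
      by (simp add: a half_int_def add_nonneg_eq_0_iff del: of_real_add)
    have "((\<lambda>s. f s / (s - a)) \<longlongrightarrow> 1 / (2 * a\<^sup>2)) (at a)"
      using deriv[of n] zero[of n] unfolding a[symmetric] by (simp add: has_field_derivative_iff)
    moreover have "((\<lambda>s. s\<^sup>2 * (of_real pi)\<^sup>2 * q s / r s - w s) \<longlongrightarrow> a\<^sup>2 * (of_real pi)\<^sup>2 * l / m - v) (at a)"
      if "(q \<longlongrightarrow> l) (at a)" "(r \<longlongrightarrow> m) (at a)" "(w \<longlongrightarrow> v) (at a)" "m \<noteq> 0"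
      for q r w :: "complex \<Rightarrow> complex" and l m v
      using that by (intro tendsto_intros) auto
    moreover note cos_pi_half_int_quotient[of n, folded a] psi_sym_residue[of n, folded a]
    moreover have "(complex_of_real pi)\<^sup>2 \<noteq> 0"
      by simp
    ultimately have "((\<lambda>s. s\<^sup>2 * (of_real pi)\<^sup>2 * (f s / (s - a)) / ((cos (of_real pi * s))\<^sup>2 / (s - a)\<^sup>2) - (s - a) * psi_sym s)
        \<longlongrightarrow> a\<^sup>2 * (of_real pi)\<^sup>2 * (1 / (2 * a\<^sup>2)) / (of_real pi)\<^sup>2 - 1/2) (at a)"
      by blast
    also have "a\<^sup>2 * (of_real pi)\<^sup>2 * (1 / (2 * a\<^sup>2)) / (of_real pi)\<^sup>2 - 1/2 = 0"
      using a0 by simp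
    finally show ?thesis
    proof (rule Lim_transform_eventually)
      have "\<forall>\<^sub>F s in at a. s \<noteq> a"
        by (rule eventually_neq_at_within)
      then show "\<forall>\<^sub>F s in at a. s\<^sup>2 * (of_real pi)\<^sup>2 * (f s / (s - a)) / ((cos (of_real pi * s))\<^sup>2 / (s - a)\<^sup>2) -
          (s - a) * psi_sym s = (s - a) * g s"
      proof eventually_elim
        fix s assume "s \<noteq> a"
        then show "s\<^sup>2 * (of_real pi)\<^sup>2 * (f s / (s - a)) / ((cos (of_real pi * s))\<^sup>2 / (s - a)\<^sup>2) -
          (s - a) * psi_sym s = (s - a) * g s"
          by (simp add: g_def right_diff_distrib power2_eq_square divide_simps) (simp add: algebra_simps)
      qed
    qed
  qed
  \<comment> \<open>the poles on the negative axis are reduced to those on the positive axis by evenness\<close>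
  have minus_at: "filterlim uminus (at a) (at (-a))" for a :: complex
    using filtermap_at_minus[of "-a"] by (simp add: filterlim_def)
  have residue_minus: "((\<lambda>s. (s - (-a)) * g s) \<longlongrightarrow> 0) (at (-a))" if a: "a = of_real (half_int n)" for a n
  proof -
    have "((\<lambda>s. - ((-s - a) * g (-s))) \<longlongrightarrow> - 0) (at (-a))"
      by (intro tendsto_minus filterlim_compose[OF residue[OF a] minus_at])
    then show ?thesis
      by (simp add: g_even algebra_simps)
  qed
  define G where "G = remove_sings g"
  have G_eq: "G s = g s" if "s \<in> U" for s
    unfolding G_def using that g_holo U
    by (intro remove_sings_at_analytic) (metis analytic_on_open analytic_on_subset empty_subsetI insert_subset)
  have extend: "G analytic_on {a}" if lim: "((\<lambda>s. (s - a) * g s) \<longlongrightarrow> 0) (at a)" and ev: "\<forall>\<^sub>F s in at a. s \<in> U" for a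
  proof -
    from ev obtain d where "d > 0" "\<forall>x. x \<noteq> a \<and> dist x a < d \<longrightarrow> x \<in> U"
      unfolding eventually_at by auto
    then have d: "d > 0" "ball a d - {a} \<subseteq> U"
      by (auto simp: dist_commute)
    have g_ball: "g holomorphic_on (ball a d - {a})"
      using g_holo d holomorphic_on_subset by blast
    have "a \<in> interior (ball a d)"
      using d by simp
    from holomorphic_on_extend_lim[OF g_ball this] lim
    obtain h where h: "h holomorphic_on ball a d" "\<And>z. z \<in> ball a d - {a} \<Longrightarrow> h z = g z"
      by blast
    have "isCont h a"
      using h(1) d by (metis centre_in_ball continuous_on_eq_continuous_at holomorphic_on_imp_continuous_on open_ball)
    then have "(h \<longlongrightarrow> h a) (at a)"
      by (rule isContD)
    moreover have "\<forall>\<^sub>F z in at a. h z = g z"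
      using eventually_at_in_open[of "ball a d" a] d h(2) by (auto elim!: eventually_mono)
    ultimately have "(g \<longlongrightarrow> h a) (at a)"
      by (rule Lim_transform_eventually)
    moreover have "isolated_singularity_at g a"
      unfolding isolated_singularity_at_def using d(1) g_ball
      by (intro exI[of _ d]) (auto simp: analytic_on_open open_Diff)
    ultimately show ?thesis
      unfolding G_def by (rule remove_sings_analytic_at[rotated])
  qed
  have G_holo: "G holomorphic_on UNIV"
  proof -
    have "G analytic_on {s}" for s
    proof (cases "s \<in> U")
      case True
      then have "g analytic_on {s}"
        using g_holo U by (metis analytic_on_open analytic_on_subset empty_subsetI insert_subset)
      then show ?thesis
        unfolding G_def by (rule remove_sings_analytic_on)
    next
      case False
      then obtain n where "s = of_real (half_int n) \<or> s = - of_real (half_int n)"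
        unfolding U_def using cos_pi_eq_0_iff by blast
      then show ?thesis
      proof
        assume "s = of_real (half_int n)"
        then show ?thesis
          using residue near by (intro extend) auto
      next
        assume s: "s = - of_real (half_int n)"
        have "\<forall>\<^sub>F z in at s. - z \<in> U"
          using near[OF refl, of n] unfolding s
          by (rule eventually_compose_filterlim[OF _ minus_at])
        then have "\<forall>\<^sub>F z in at s. z \<in> U"
          by eventually_elim (simp add: U_def)
        then show ?thesis
          using residue_minus[OF refl, of n] unfolding s by (intro extend) auto
      qed
    qed
    then show ?thesis
      by (meson analytic_on_analytic_at analytic_imp_holomorphic)
  qed
  have C: "C \<ge> 0"
    using bound[of 0] by (auto intro: order_trans[OF norm_ge_zero])
  have basel: "basel \<ge> 0"
    unfolding basel_def by (intro suminf_nonneg summable_basel) simp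
  define K where "K = 16 * pi\<^sup>2 * C + 10 * basel + 2 * ln 2"
  have K: "K \<ge> 0"
    using C basel by (simp add: K_def)
  \<comment> \<open>\<open>G\<close> is bounded by a multiple of \<open>N\<^sup>2\<close> on the circle of radius \<open>N\<close>, hence in the disc; as every point of modulus
    at least 1 lies in a disc of at most twice that radius, the growth is quadratic\<close>
  have circle: "norm (G s) \<le> K * (real N)\<^sup>2" if s: "norm s = real N" "N \<ge> 1" for s N
  proof -
    have sU: "s \<in> U"
      using norm_psi_sym_circle(1)[OF s] by (simp add: U_def)
    then have c: "norm (cos (of_real pi * s)) ^ 2 > 0"
      by (simp add: U_def)
    have "norm (f s) \<le> C * (16 * norm (cos (of_real pi * s)) ^ 2)"
      using bound[of s] mult_left_mono[OF norm_cos_pi_circle[OF s] C] by (rule order_trans)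
    then have "norm (f s) / norm (cos (of_real pi * s)) ^ 2 \<le> 16 * C"
      using c by (simp add: pos_divide_le_eq mult_ac)
    then have "pi\<^sup>2 * (real N)\<^sup>2 * (norm (f s) / norm (cos (of_real pi * s)) ^ 2) \<le> pi\<^sup>2 * (real N)\<^sup>2 * (16 * C)"
      by (intro mult_left_mono) auto
    moreover have "norm (s\<^sup>2 * (of_real pi)\<^sup>2 * f s / (cos (of_real pi * s))\<^sup>2) =
        pi\<^sup>2 * (real N)\<^sup>2 * (norm (f s) / norm (cos (of_real pi * s)) ^ 2)"
      using s by (simp add: norm_mult norm_divide norm_power)
    moreover have "norm (g s) \<le> norm (s\<^sup>2 * (of_real pi)\<^sup>2 * f s / (cos (of_real pi * s))\<^sup>2) + norm (psi_sym s)"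
      unfolding g_def by (rule norm_triangle_ineq4)
    moreover have "norm (psi_sym s) \<le> 10 * (real N)\<^sup>2 * basel + 2 * ln 2"
      by (rule norm_psi_sym_circle(2)[OF s])
    moreover have "2 * ln 2 * 1 \<le> 2 * ln 2 * (real N)\<^sup>2"
      using s(2) by (intro mult_left_mono) auto
    moreover have "K * (real N)\<^sup>2 = pi\<^sup>2 * (real N)\<^sup>2 * (16 * C) + 10 * (real N)\<^sup>2 * basel + 2 * ln 2 * (real N)\<^sup>2"
      by (simp add: K_def algebra_simps)
    ultimately show ?thesis
      unfolding G_eq[OF sU] by linarith
  qed
  have disc: "norm (G z) \<le> K * (real N)\<^sup>2" if "norm z \<le> real N" "N \<ge> 1" for z N
  proof (rule maximum_modulus_frontier[of G "cball 0 (real N)"])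
    show "continuous_on (closure (cball 0 (real N))) G"
      using G_holo by (meson continuous_on_subset holomorphic_on_imp_continuous_on subset_UNIV)
    show "norm (G w) \<le> K * (real N)\<^sup>2" if "w \<in> frontier (cball 0 (real N))" for w
      using that \<open>N \<ge> 1\<close> by (intro circle) (auto simp: frontier_cball)
  qed (use that G_holo in \<open>auto intro: holomorphic_on_subset\<close>)
  have growth: "norm (G z) \<le> 4 * K * norm z ^ 2" if "1 \<le> norm z" for z
  proof -
    define N where "N = nat \<lceil>norm z\<rceil>"
    have N: "norm z \<le> real N" "real N \<le> norm z + 1" "N \<ge> 1"
      using that unfolding N_def by linarith+
    have "norm (G z) \<le> K * (real N)\<^sup>2"
      by (rule disc[OF N(1,3)])
    also have "\<dots> \<le> K * (2 * norm z)\<^sup>2"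
      using N that K by (intro mult_left_mono power_mono) auto
    finally show ?thesis
      by (simp add: power_mult_distrib)
  qed
  define c where "c k = (deriv ^^ k) G 0 / fact k" for k
  have G_poly: "G z = c 0 + c 1 * z + c 2 * z\<^sup>2" for z
    using Liouville_polynomial[OF G_holo growth, of 1 z] unfolding c_def
    by (simp add: numeral_2_eq_2 atMost_Suc)
  have "0 \<in> U" "1 \<in> U" "-1 \<in> U"
    by (auto simp: U_def)
  have "c 0 = 0"
    using G_poly[of 0] G_eq[OF \<open>0 \<in> U\<close>] by (simp add: g_def psi_sym_0)
  moreover have "c 1 = 0"
    using G_poly[of 1] G_poly[of "-1"] G_eq[OF \<open>1 \<in> U\<close>] G_eq[OF \<open>-1 \<in> U\<close>] g_even[of 1] by simp
  moreover have "c 2 = 0"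
  proof -
    have "((\<lambda>t::real. c 2) \<longlongrightarrow> 0) at_top"
    proof (rule Lim_null_comparison)
      have "((\<lambda>t. pi\<^sup>2 * 4 * norm (f (\<i> * of_real t) * of_real (exp (- 2 * pi * t))) +
          ((t + 1) * basel + 2 * ln 2) / t\<^sup>2) \<longlongrightarrow> pi\<^sup>2 * 4 * norm (0::complex) + 0) at_top"
        by (intro tendsto_intros decay) real_asymp
      then show "((\<lambda>t. pi\<^sup>2 * 4 * norm (f (\<i> * of_real t) * of_real (exp (- 2 * pi * t))) +
          ((t + 1) * basel + 2 * ln 2) / t\<^sup>2) \<longlongrightarrow> 0) at_top"
        by simp
      show "\<forall>\<^sub>F t in at_top. norm (c 2) \<le> pi\<^sup>2 * 4 * norm (f (\<i> * of_real t) * of_real (exp (- 2 * pi * t))) +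
          ((t + 1) * basel + 2 * ln 2) / t\<^sup>2"
        using eventually_ge_at_top[of "1::real"]
      proof eventually_elim
        fix t :: real assume t: "t \<ge> 1"
        define w where "w = \<i> * complex_of_real t"
        have wU: "w \<in> U"
          using cos_pi_imaginary_nonzero by (simp add: U_def w_def)
        have cosh: "norm (cos (of_real pi * w)) ^ 2 \<ge> exp (2 * pi * t) / 4"
        proof -
          have "norm (cos (of_real pi * w)) ^ 2 = 1 + (exp (pi * t) - inverse (exp (pi * t)))\<^sup>2 / 4"
            by (simp add: norm_cos_squared w_def)
          also have "\<dots> = (exp (pi * t) ^ 2 + 2 + inverse (exp (pi * t)) ^ 2) / 4"
            by (simp add: power2_diff) (simp add: field_simps)
          also have "exp (pi * t) ^ 2 = exp (2 * pi * t)"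
            by (simp add: power2_eq_square flip: exp_add)
          finally show ?thesis
            by (simp add: add_nonneg_nonneg)
        qed
        have n_w: "norm w = t" "norm (w\<^sup>2) = t\<^sup>2"
          using t by (simp_all add: w_def norm_mult norm_power)
        have "norm (c 2) * t\<^sup>2 = norm (G w)"
          using G_poly[of w] \<open>c 0 = 0\<close> \<open>c 1 = 0\<close> n_w by (simp add: norm_mult)
        also have "\<dots> \<le> norm (w\<^sup>2 * (of_real pi)\<^sup>2 * f w / (cos (of_real pi * w))\<^sup>2) + norm (psi_sym w)"
          unfolding G_eq[OF wU] g_def by (rule norm_triangle_ineq4)
        also have "\<dots> \<le> t\<^sup>2 * pi\<^sup>2 * (4 * norm (f w * of_real (exp (- 2 * pi * t)))) +
            ((t + 1) * basel + 2 * ln 2)"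
        proof (rule add_mono)
          show "norm (psi_sym w) \<le> (t + 1) * basel + 2 * ln 2"
            unfolding w_def by (rule norm_psi_sym_imaginary[OF t])
          have "norm (f w) / norm (cos (of_real pi * w)) ^ 2 \<le> norm (f w) / (exp (2 * pi * t) / 4)"
            using cosh by (intro divide_left_mono mult_pos_pos less_le_trans[OF _ cosh]) auto
          also have "\<dots> = 4 * norm (f w * of_real (exp (- 2 * pi * t)))"
            unfolding norm_mult norm_of_real abs_exp_cancel by (simp add: exp_minus divide_simps flip: exp_add)
          finally have "t\<^sup>2 * pi\<^sup>2 * (norm (f w) / norm (cos (of_real pi * w)) ^ 2) \<le>
              t\<^sup>2 * pi\<^sup>2 * (4 * norm (f w * of_real (exp (- 2 * pi * t))))"
            by (intro mult_left_mono) auto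
          then show "norm (w\<^sup>2 * (of_real pi)\<^sup>2 * f w / (cos (of_real pi * w))\<^sup>2) \<le>
              t\<^sup>2 * pi\<^sup>2 * (4 * norm (f w * of_real (exp (- 2 * pi * t))))"
            by (simp add: norm_mult norm_divide norm_power n_w)
        qed
        finally have "norm (c 2) \<le> (t\<^sup>2 * pi\<^sup>2 * (4 * norm (f w * of_real (exp (- 2 * pi * t)))) +
            ((t + 1) * basel + 2 * ln 2)) / t\<^sup>2"
          using t by (subst pos_le_divide_eq) auto
        also have "\<dots> = pi\<^sup>2 * 4 * norm (f w * of_real (exp (- 2 * pi * t))) + ((t + 1) * basel + 2 * ln 2) / t\<^sup>2"
          using t by (simp add: add_divide_distrib)
        finally show "norm (c 2) \<le> pi\<^sup>2 * 4 * norm (f (\<i> * of_real t) * of_real (exp (- 2 * pi * t))) +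
          ((t + 1) * basel + 2 * ln 2) / t\<^sup>2"
          unfolding w_def .
      qed
    qed
    then show ?thesis
      by (simp add: tendsto_const_iff)
  qed
  ultimately have "G s = 0"
    by (simp add: G_poly)
  then have "g s = 0"
    using G_eq[of s] assms(7) by (simp add: U_def)
  then show ?thesis
    using assms(7) by (simp add: g_def field_simps)
qed

section \<open>Differentiation under the integral sign\<close>

lemma norm_deriv_entire_le:
  fixes f :: "complex \<Rightarrow> complex"
  assumes "f holomorphic_on UNIV" "\<And>w. norm (w - z) = 1 \<Longrightarrow> norm (f w) \<le> B"
  shows "norm (deriv f z) \<le> B"
  using Cauchy_inequality[of f z 1 B 1] assms
  by (simp add: holomorphic_on_imp_continuous_on holomorphic_on_subset norm_minus_commute)

text \<open>
  By Cauchy's inequality the bound on the disc of radius 2 also bounds the derivatives on the disc of radius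
  1, hence the difference quotients at \<open>z0\<close>; dominated convergence along sequences does the rest.
\<close>

lemma has_field_derivative_dominated_integral:
  fixes f :: "complex \<Rightarrow> 'a \<Rightarrow> complex"
  assumes holo: "\<And>x. (\<lambda>z. f z x) holomorphic_on UNIV"
    and int: "\<And>z. integrable M (f z)"
    and B: "integrable M B" "\<And>z x. norm (z - z0) \<le> 2 \<Longrightarrow> norm (f z x) \<le> B x"
  shows "((\<lambda>z. \<integral>x. f z x \<partial>M) has_field_derivative (\<integral>x. deriv (\<lambda>z. f z x) z0 \<partial>M)) (at z0)"
proof -
  have diff: "((\<lambda>z. f z x) has_field_derivative deriv (\<lambda>z. f z x) z) (at z)" for z x
    by (rule holomorphic_derivI[OF holo[of x]]) auto
  have bound: "norm (deriv (\<lambda>z. f z x) z) \<le> B x" if "norm (z - z0) \<le> 1" for z x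
  proof (rule norm_deriv_entire_le[OF holo])
    fix w assume "norm (w - z) = 1"
    then have "norm (w - z0) \<le> 2"
      using that norm_triangle_ineq[of "w - z" "z - z0"] by simp
    then show "norm (f w x) \<le> B x"
      by (rule B(2))
  qed
  have quot_bound: "norm ((f (z0 + h) x - f z0 x) / h) \<le> B x" if h: "norm h \<le> 1" "h \<noteq> 0" for h x
  proof -
    have "norm (f (z0 + h) x - f z0 x) \<le> B x * norm (z0 + h - z0)"
    proof (rule field_differentiable_bound[of "cball z0 1" "\<lambda>z. f z x" "\<lambda>z. deriv (\<lambda>z. f z x) z"])
      show "norm (deriv (\<lambda>z. f z x) z) \<le> B x" if "z \<in> cball z0 1" for z
        using that by (intro bound) (auto simp: dist_norm norm_minus_commute)
    qed (use h diff in \<open>auto simp: dist_norm intro: has_field_derivative_at_within\<close>)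
    then show ?thesis
      using h by (simp add: norm_divide divide_le_eq)
  qed
  have lim: "(\<lambda>n. (f (z0 + h n) x - f z0 x) / h n) \<longlonglongrightarrow> deriv (\<lambda>z. f z x) z0"
    if h: "h \<longlonglongrightarrow> 0" "\<And>n. h n \<noteq> 0" for h :: "nat \<Rightarrow> complex" and x
  proof -
    have "((\<lambda>h. (f (z0 + h) x - f z0 x) / h) \<longlongrightarrow> deriv (\<lambda>z. f z x) z0) (at 0)"
      using diff[of x z0] by (simp add: DERIV_def)
    moreover have "filterlim h (at 0) sequentially"
      using h by (simp add: filterlim_at)
    ultimately show ?thesis
      by (rule filterlim_compose)
  qed
  have [measurable]: "f z \<in> borel_measurable M" for z
    using int by (rule borel_measurable_integrable)
  have seq: "(\<lambda>n. \<integral>x. (f (z0 + h n) x - f z0 x) / h n \<partial>M) \<longlonglongrightarrow> (\<integral>x. deriv (\<lambda>z. f z x) z0 \<partial>M)"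
    if h: "h \<longlonglongrightarrow> 0" "\<And>n. h n \<noteq> 0" "\<And>n. norm (h n) \<le> 1" for h :: "nat \<Rightarrow> complex"
  proof -
    have meas: "(\<lambda>x. (f (z0 + h n) x - f z0 x) / h n) \<in> borel_measurable M" for n
      by measurable
    have meas': "(\<lambda>x. deriv (\<lambda>z. f z x) z0) \<in> borel_measurable M"
      by (rule borel_measurable_LIMSEQ_metric[OF meas lim[OF h(1,2)]])
    have AE: "AE x in M. (\<lambda>n. (f (z0 + h n) x - f z0 x) / h n) \<longlonglongrightarrow> deriv (\<lambda>z. f z x) z0"
      "\<And>n. AE x in M. norm ((f (z0 + h n) x - f z0 x) / h n) \<le> B x"
      using lim[OF h(1,2)] quot_bound[OF h(3,2)] by simp_all
    show "(\<lambda>n. \<integral>x. (f (z0 + h n) x - f z0 x) / h n \<partial>M) \<longlonglongrightarrow> (\<integral>x. deriv (\<lambda>z. f z x) z0 \<partial>M)"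
      by (rule integral_dominated_convergence[OF meas' meas B(1) AE])
  qed
  show ?thesis
    unfolding DERIV_def tendsto_at_iff_sequentially o_def
  proof (intro allI impI)
    fix h :: "nat \<Rightarrow> complex"
    assume "\<forall>i. h i \<in> UNIV - {0}" and h: "h \<longlonglongrightarrow> 0"
    then have h_nz: "h i \<noteq> 0" for i
      by blast
    have "\<forall>\<^sub>F n in sequentially. norm (h n) < 1"
      using tendstoD[OF h, of 1] by simp
    then obtain N where N: "\<And>n. n \<ge> N \<Longrightarrow> norm (h n) < 1"
      by (auto simp: eventually_sequentially)
    have "(\<lambda>n. \<integral>x. (f (z0 + h (n + N)) x - f z0 x) / h (n + N) \<partial>M) \<longlonglongrightarrow> (\<integral>x. deriv (\<lambda>z. f z x) z0 \<partial>M)"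
      using N by (intro seq LIMSEQ_ignore_initial_segment h h_nz less_imp_le) auto
    also have "(\<lambda>n. \<integral>x. (f (z0 + h (n + N)) x - f z0 x) / h (n + N) \<partial>M) =
        (\<lambda>n. ((\<integral>x. f (z0 + h (n + N)) x \<partial>M) - (\<integral>x. f z0 x \<partial>M)) / h (n + N))"
      using int by simp
    finally show "(\<lambda>n. ((\<integral>x. f (z0 + h n) x \<partial>M) - (\<integral>x. f z0 x \<partial>M)) / h n) \<longlonglongrightarrow> (\<integral>x. deriv (\<lambda>z. f z x) z0 \<partial>M)"
      by (rule LIMSEQ_offset)
  qed
qed

section \<open>Legendre functions as functions of the degree\<close>

lemma Legendre_P_reflect:
  assumes "-1 < x" "x < 1"
  shows "Legendre_P (- 1 - \<nu>) x = Legendre_P \<nu> x"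
  by (simp add: Legendre_P_eq_mehler[OF assms] mehler_reflect)

lemma has_field_derivative_Legendre_P:
  assumes "-1 < x" "x < 1"
  shows "((\<lambda>\<nu>. Legendre_P \<nu> x) has_field_derivative deriv (\<lambda>\<nu>. Legendre_P \<nu> x) \<nu>) (at \<nu>)"
proof -
  have "(\<lambda>\<nu>. mehler \<nu> (half_chord x)) field_differentiable at \<nu>"
    using has_field_derivative_mehler[of "half_chord x" \<nu>] half_chord_bounds[OF assms]
    unfolding field_differentiable_def by force
  then have "(\<lambda>\<nu>. Legendre_P \<nu> x) field_differentiable at \<nu>"
    unfolding Legendre_P_eq_mehler[OF assms] by (intro derivative_intros)
  then show ?thesis
    by (simp add: DERIV_deriv_iff_field_differentiable)
qed

lemma holomorphic_Legendre_P:
  assumes "-1 < x" "x < 1"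
  shows "(\<lambda>\<nu>. Legendre_P \<nu> x) holomorphic_on A"
  using has_field_derivative_Legendre_P[OF assms]
  by (meson field_differentiable_at_within field_differentiable_def holomorphic_on_def)

lemma Legendre_P_Bonnet:
  assumes x: "-1 < x" "x < 1"
  shows "(\<nu> + 1) * Legendre_P (\<nu> + 1) x - (2 * \<nu> + 1) * of_real x * Legendre_P \<nu> x + \<nu> * Legendre_P (\<nu> - 1) x = 0"
proof -
  have "1 - 2 * (half_chord x)\<^sup>2 = x"
    using half_chord_bounds[OF x] by simp
  then have "2 / of_real pi * ((\<nu> + 1) * mehler (\<nu> + 1) (half_chord x) -
      (2 * \<nu> + 1) * of_real x * mehler \<nu> (half_chord x) + \<nu> * mehler (\<nu> - 1) (half_chord x)) = 0"
    using mehler_Bonnet[of "half_chord x" \<nu>] half_chord_bounds[OF x] by simp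
  then show ?thesis
    unfolding Legendre_P_eq_mehler[OF x] by (simp only: algebra_simps)
qed

lemma deriv_Legendre_P_Bonnet:
  fixes \<nu> :: complex and x :: real
  assumes x: "-1 < x" "x < 1"
  defines "d \<equiv> deriv (\<lambda>\<nu>. Legendre_P \<nu> x)"
  shows "Legendre_P (\<nu> + 1) x + (\<nu> + 1) * d (\<nu> + 1) - 2 * of_real x * Legendre_P \<nu> x -
    (2 * \<nu> + 1) * of_real x * d \<nu> + Legendre_P (\<nu> - 1) x + \<nu> * d (\<nu> - 1) = 0"
proof -
  note D = has_field_derivative_Legendre_P[OF x, folded d_def]
  have shift: "((\<lambda>\<nu>. Legendre_P (\<nu> + c) x) has_field_derivative d (\<nu> + c)) (at \<nu>)" for c
    using D[of "\<nu> + c"] by (simp add: DERIV_shift)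
  have der: "((\<lambda>\<nu>. (\<nu> + 1) * Legendre_P (\<nu> + 1) x - (2 * \<nu> + 1) * of_real x * Legendre_P \<nu> x + \<nu> * Legendre_P (\<nu> + - 1) x)
     has_field_derivative (1 * Legendre_P (\<nu> + 1) x + d (\<nu> + 1) * (\<nu> + 1)) -
       ((2 * of_real x) * Legendre_P \<nu> x + d \<nu> * ((2 * \<nu> + 1) * of_real x)) +
       (1 * Legendre_P (\<nu> + - 1) x + d (\<nu> + - 1) * \<nu>)) (at \<nu>)"
    by (intro DERIV_add DERIV_diff DERIV_mult shift D) (auto intro!: derivative_eq_intros)
  have zero: "(\<lambda>\<nu>. (\<nu> + 1) * Legendre_P (\<nu> + 1) x - (2 * \<nu> + 1) * of_real x * Legendre_P \<nu> x + \<nu> * Legendre_P (\<nu> + - 1) x) = (\<lambda>_. 0)"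
    using Legendre_P_Bonnet[OF x] by simp
  have "(1 * Legendre_P (\<nu> + 1) x + d (\<nu> + 1) * (\<nu> + 1)) -
       ((2 * of_real x) * Legendre_P \<nu> x + d \<nu> * ((2 * \<nu> + 1) * of_real x)) +
       (1 * Legendre_P (\<nu> + - 1) x + d (\<nu> + - 1) * \<nu>) = 0"
    by (rule DERIV_unique[OF der[unfolded zero] DERIV_const])
  then show ?thesis
    by (simp add: algebra_simps)
qed

lemma Legendre_P_0:
  assumes "-1 < x" "x < 1"
  shows "Legendre_P 0 x = 1"
  using half_chord_bounds[OF assms] by (simp add: Legendre_P_eq_mehler[OF assms] mehler_0)

lemma of_nat_plus_2_neq_0: "of_nat n + 2 \<noteq> (0 :: complex)"
  using of_nat_neq_0[of "Suc n", where 'a = complex] by (simp add: add.commute)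

lemma Legendre_P_of_nat:
  assumes x: "-1 < x" "x < 1"
  shows "Legendre_P (of_nat n) x = of_real (poly (legendre_poly n) x)"
proof (induction n rule: legendre_poly.induct)
  case 1
  show ?case
    by (simp add: Legendre_P_0[OF x])
next
  case 2
  show ?case
    using Legendre_P_Bonnet[OF x, of 0] by (simp add: Legendre_P_0[OF x])
next
  case (3 n)
  have "(of_nat n + 2) * Legendre_P (of_nat (Suc (Suc n))) x =
      (2 * of_nat n + 3) * of_real x * Legendre_P (of_nat (Suc n)) x - (of_nat n + 1) * Legendre_P (of_nat n) x"
    using Legendre_P_Bonnet[OF x, of "of_nat (Suc n)"] by (simp add: algebra_simps)
  also have "\<dots> = of_real ((2 * real n + 3) * x * poly (legendre_poly (Suc n)) x - (real n + 1) * poly (legendre_poly n) x)"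
    unfolding 3 by simp
  also have "\<dots> = of_real ((real n + 2) * poly (legendre_poly (Suc (Suc n))) x)"
    by (simp only: poly_legendre_rec)
  also have "\<dots> = (of_nat n + 2) * of_real (poly (legendre_poly (Suc (Suc n))) x)"
    by (simp del: legendre_poly.simps)
  finally have "(of_nat n + 2) * Legendre_P (of_nat (Suc (Suc n))) x =
      (of_nat n + 2) * complex_of_real (poly (legendre_poly (Suc (Suc n))) x)" .
  then show ?case
    by (rule mult_left_cancel[OF of_nat_plus_2_neq_0, THEN iffD1])
qed

lemma deriv_Legendre_P_0:
  assumes x: "-1 < x" "x < 1"
  shows "deriv (\<lambda>\<nu>. Legendre_P \<nu> x) 0 = of_real (ln ((1 + x) / 2))"
proof -
  have "((\<lambda>\<nu>. Legendre_P \<nu> x) has_field_derivative 2 / of_real pi * of_real (pi / 2 * ln (1 - (half_chord x)\<^sup>2))) (at 0)"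
    unfolding Legendre_P_eq_mehler[OF x] using half_chord_bounds[OF x]
    by (intro DERIV_cmult has_field_derivative_mehler_0) auto
  then have "deriv (\<lambda>\<nu>. Legendre_P \<nu> x) 0 = 2 / of_real pi * of_real (pi / 2 * ln (1 - (half_chord x)\<^sup>2))"
    by (rule DERIV_imp_deriv)
  also have "1 - (half_chord x)\<^sup>2 = (1 + x) / 2"
    using half_chord_bounds[OF x] by (simp add: field_simps)
  finally show ?thesis
    by simp
qed

text \<open>
  Both sides obey Bonnet's recurrence in \<open>n\<close>. On the left, the undifferentiated terms of
  \<open>deriv_Legendre_P_Bonnet\<close> cancel because of the parity of the Legendre polynomials. The derivative at
  \<open>\<nu> = 0\<close> starts the recurrence.
\<close>

lemma deriv_Legendre_P_of_nat:
  assumes x: "-1 < x" "x < 1"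
  shows "deriv (\<lambda>\<nu>. Legendre_P \<nu> x) (of_nat n) - (-1) ^ n * deriv (\<lambda>\<nu>. Legendre_P \<nu> (-x)) (of_nat n) =
    of_real (log_transform (legendre_poly n) x)"
proof -
  have mx: "-1 < -x" "-x < 1"
    using x by auto
  define d where "d = deriv (\<lambda>\<nu>. Legendre_P \<nu> x)"
  define e where "e = deriv (\<lambda>\<nu>. Legendre_P \<nu> (-x))"
  note rec_d = deriv_Legendre_P_Bonnet[OF x, folded d_def]
  note rec_e = deriv_Legendre_P_Bonnet[OF mx, folded e_def]
  have P: "Legendre_P (of_nat k) (-x) = (-1) ^ k * Legendre_P (of_nat k) x" for k
    by (simp add: Legendre_P_of_nat[OF x] Legendre_P_of_nat[OF mx] poly_legendre_minus)
  have Pm1: "Legendre_P (-1) x = 1" "Legendre_P (-1) (-x) = 1"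
    using Legendre_P_reflect[OF x, of 0] Legendre_P_reflect[OF mx, of 0] Legendre_P_0[OF x] Legendre_P_0[OF mx]
    by simp_all
  have "ln ((1 + x) / 2) - ln ((1 + - x) / 2) = log_ratio x"
    using x by (simp add: log_ratio_def ln_div)
  then have de0: "d 0 - e 0 = of_real (log_ratio x)"
    using deriv_Legendre_P_0[OF x] deriv_Legendre_P_0[OF mx]
    unfolding d_def e_def by (metis of_real_diff)
  have "d (of_nat n) - (-1) ^ n * e (of_nat n) = of_real (log_transform (legendre_poly n) x)"
  proof (induction n rule: legendre_poly.induct)
    case 1
    show ?case
      using de0 by (simp add: log_transform_1)
  next
    case 2
    \<comment> \<open>the recurrence at \<open>\<nu> = 0\<close> still contains \<open>P\<^sub>-\<^sub>1 = P\<^sub>0 = 1\<close>, because the derivative of its coefficient \<open>\<nu>\<close> is 1;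
      this is the source of the summand \<open>- 2\<close>\<close>
    have "Legendre_P 1 x + d 1 - 2 * of_real x * Legendre_P 0 x - of_real x * d 0 + 1 = 0"
      using rec_d[of 0] Pm1 by simp
    then have "d 1 = of_real x * d 0 + 2 * of_real x * Legendre_P 0 x - Legendre_P 1 x - 1"
      by algebra
    moreover have "Legendre_P 1 (-x) + e 1 + 2 * of_real x * Legendre_P 0 (-x) + of_real x * e 0 + 1 = 0"
      using rec_e[of 0] Pm1 by simp
    then have "e 1 = - of_real x * e 0 - 2 * of_real x * Legendre_P 0 (-x) - Legendre_P 1 (-x) - 1"
      by algebra
    moreover have "Legendre_P 1 (-x) = - Legendre_P 1 x" "Legendre_P 0 (-x) = 1" "Legendre_P 0 x = 1"
      using P[of 0] P[of 1] Legendre_P_0[OF x] by simp_all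
    ultimately have "d 1 + e 1 = of_real x * (d 0 - e 0) - 2"
      by (simp only:) (simp add: algebra_simps)
    moreover have "poly_integral 1 = 2"
      using poly_integral_monom[of 0] by simp
    ultimately show ?case
      using de0 by (simp add: log_transform_pCons_0 log_transform_1)
  next
    case (3 n)
    define D where "D k = d (of_nat k) - (-1) ^ k * e (of_nat k)" for k
    have d: "(of_nat n + 2) * d (of_nat (Suc (Suc n))) = (2 * of_nat n + 3) * of_real x * d (of_nat (Suc n)) -
        (of_nat n + 1) * d (of_nat n) -
        (Legendre_P (of_nat (Suc (Suc n))) x - 2 * of_real x * Legendre_P (of_nat (Suc n)) x + Legendre_P (of_nat n) x)"
      using rec_d[of "of_nat (Suc n)"] by (simp add: algebra_simps)
    have e: "(of_nat n + 2) * e (of_nat (Suc (Suc n))) = - (2 * of_nat n + 3) * of_real x * e (of_nat (Suc n)) -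
        (of_nat n + 1) * e (of_nat n) -
        (-1) ^ n * (Legendre_P (of_nat (Suc (Suc n))) x - 2 * of_real x * Legendre_P (of_nat (Suc n)) x + Legendre_P (of_nat n) x)"
      using rec_e[of "of_nat (Suc n)"] P[of n] P[of "Suc n"] P[of "Suc (Suc n)"] by (simp add: algebra_simps)
    have sq: "(-1) ^ n * (-1) ^ n = (1 :: complex)"
      by (simp flip: power_add)
    have "(of_nat n + 2) * D (Suc (Suc n)) =
        (of_nat n + 2) * d (of_nat (Suc (Suc n))) - (-1) ^ n * ((of_nat n + 2) * e (of_nat (Suc (Suc n))))"
      by (simp add: D_def algebra_simps)
    also have "\<dots> = (2 * of_nat n + 3) * of_real x * D (Suc n) - (of_nat n + 1) * D n"
      unfolding d e using sq by (simp add: D_def algebra_simps)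
    also have "\<dots> = of_real ((2 * real n + 3) * x * log_transform (legendre_poly (Suc n)) x -
        (real n + 1) * log_transform (legendre_poly n) x)"
      using 3 by (simp add: D_def)
    also have "\<dots> = (of_nat n + 2) * of_real (log_transform (legendre_poly (Suc (Suc n))) x)"
      unfolding log_transform_legendre_rec[symmetric] by simp
    finally have "(of_nat n + 2) * D (Suc (Suc n)) =
        (of_nat n + 2) * of_real (log_transform (legendre_poly (Suc (Suc n))) x)" .
    then have "D (Suc (Suc n)) = of_real (log_transform (legendre_poly (Suc (Suc n))) x)"
      by (rule mult_left_cancel[OF of_nat_plus_2_neq_0, THEN iffD1])
    then show ?case
      by (simp only: D_def)
  qed
  then show ?thesis
    by (simp add: d_def e_def)
qed

lemma continuous_on_Legendre_P: "continuous_on {-1<..<1} (Legendre_P \<nu>)"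
proof -
  have "continuous_on {-1<..<1} (\<lambda>x. 2 / of_real pi * mehler \<nu> (half_chord x))"
    unfolding half_chord_def
    by (intro continuous_intros continuous_on_compose2[OF continuous_on_mehler]) auto
  then show ?thesis
    by (rule continuous_on_eq) (simp add: Legendre_P_eq_mehler)
qed

lemma norm_Legendre_P_le:
  assumes x: "-1 < x" "x < 1"
  shows "norm (Legendre_P \<nu> x) \<le> 2 * exp (\<bar>Im \<nu>\<bar> * arccos x) / sqrt (sqrt ((1 + x) / 2))"
proof -
  have "1 - (half_chord x)\<^sup>2 = (1 + x) / 2"
    using half_chord_bounds[OF x] by (simp add: field_simps)
  then have "norm (mehler \<nu> (half_chord x)) \<le> exp (\<bar>Im \<nu>\<bar> * arccos x) * (pi / sqrt (sqrt ((1 + x) / 2)))"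
    using norm_mehler_le[of "half_chord x" \<nu>] half_chord_bounds(1,2)[OF x]
    by (simp only: arccos_eq_arcsin_half_chord[OF x] less_imp_le)
  then have "2 / pi * norm (mehler \<nu> (half_chord x)) \<le> 2 / pi * (exp (\<bar>Im \<nu>\<bar> * arccos x) * (pi / sqrt (sqrt ((1 + x) / 2))))"
    by (intro mult_left_mono) auto
  then show ?thesis
    by (simp add: Legendre_P_eq_mehler[OF x] norm_mult norm_divide)
qed

lemma Legendre_P_decay:
  assumes x: "-1 < x" "x < 1"
  shows "((\<lambda>t. of_real (exp (- t * arccos x)) * Legendre_P (\<i> * of_real t - 1/2) x) \<longlongrightarrow> 0) at_top"
proof -
  have "((\<lambda>t. 2 / of_real pi * (of_real (exp (- t * (2 * arcsin (half_chord x)))) *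
      mehler (\<i> * of_real t - 1/2) (half_chord x))) \<longlongrightarrow> 2 / of_real pi * 0) at_top"
    using half_chord_bounds[OF x] by (intro tendsto_intros mehler_decay)
  then show ?thesis
    by (simp add: Legendre_P_eq_mehler[OF x] arccos_eq_arcsin_half_chord[OF x] mult_ac)
qed

section \<open>The quartic integral\<close>

definition quartic_integrand :: "complex \<Rightarrow> real \<Rightarrow> complex" where
  "quartic_integrand \<nu> x =
     of_real x * (Legendre_P \<nu> x)\<^sup>2 * ((Legendre_P \<nu> x)\<^sup>2 - (Legendre_P \<nu> (- x))\<^sup>2)"

definition quartic_integral :: "complex \<Rightarrow> complex" where
  "quartic_integral \<nu> = (LBINT x:{0<..<1}. quartic_integrand \<nu> x)"

text \<open>
  The integrand divided by its exponential growth in \<open>Im \<nu>\<close> stays below this function. Its singularity at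
  \<open>x = 1\<close> is due to \<open>P\<^sub>\<nu>(-x)\<close>.
\<close>

definition quartic_bound :: "real \<Rightarrow> real" where
  "quartic_bound x = 64 + 32 / sqrt ((1 - x) / 2)"

lemma set_integrable_quartic_bound: "set_integrable lborel {0<..<1} quartic_bound"
proof -
  have "set_integrable lborel {0<..<1::real} (\<lambda>x. inverse (sqrt ((1 - x) / 2)))"
  proof (rule FTC_open_interval_nonneg)
    fix x :: real assume x: "0 < x" "x < 1"
    have "((\<lambda>x. (1 - x) / 2) has_field_derivative - (1 / 2)) (at x)"
      by (auto intro!: derivative_eq_intros)
    then have "((\<lambda>x. - 4 * sqrt ((1 - x) / 2)) has_field_derivative - 4 * (inverse (sqrt ((1 - x) / 2)) / 2 * - (1 / 2))) (at x)"
      using x by (intro DERIV_cmult DERIV_chain2[OF DERIV_real_sqrt]) auto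
    then show "((\<lambda>x. - 4 * sqrt ((1 - x) / 2)) has_field_derivative inverse (sqrt ((1 - x) / 2))) (at x)"
      by simp
    show "isCont (\<lambda>x. inverse (sqrt ((1 - x) / 2))) x"
      using x by (intro continuous_intros) auto
    show "0 \<le> inverse (sqrt ((1 - x) / 2))"
      using x by simp
  next
    show "((\<lambda>x. - 4 * sqrt ((1 - x) / 2)) \<longlongrightarrow> - 4 * sqrt ((1 - 0) / 2)) (at_right 0)"
      "((\<lambda>x. - 4 * sqrt ((1 - x) / 2)) \<longlongrightarrow> - 4 * sqrt ((1 - 1) / 2)) (at_left 1)"
      by (intro tendsto_intros; simp)+
  qed simp
  then have "set_integrable lborel {0<..<1::real} (\<lambda>x. 32 * inverse (sqrt ((1 - x) / 2)))"
    by simp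
  moreover have "set_integrable lborel {0<..<1} (\<lambda>x::real. 64 :: real)"
    unfolding set_integrable_def by (intro integrable_scaleR_left) auto
  ultimately have "set_integrable lborel {0<..<1} (\<lambda>x::real. 64 + 32 * inverse (sqrt ((1 - x) / 2)))"
    by (rule set_integral_add(1)[rotated])
  moreover have "quartic_bound = (\<lambda>x. 64 + 32 * inverse (sqrt ((1 - x) / 2)))"
    by (rule ext) (simp only: quartic_bound_def divide_inverse)
  ultimately show ?thesis
    by (simp only:)
qed

lemma norm_Legendre_P_square_le:
  assumes "-1 < x" "x < 1"
  shows "(norm (Legendre_P \<nu> x))\<^sup>2 \<le> 4 * exp (2 * \<bar>Im \<nu>\<bar> * arccos x) / sqrt ((1 + x) / 2)"
proof -
  have "(norm (Legendre_P \<nu> x))\<^sup>2 \<le> (2 * exp (\<bar>Im \<nu>\<bar> * arccos x) / sqrt (sqrt ((1 + x) / 2)))\<^sup>2"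
    by (intro power_mono norm_Legendre_P_le assms) auto
  also have "\<dots> = 4 * exp (2 * \<bar>Im \<nu>\<bar> * arccos x) / sqrt ((1 + x) / 2)"
    using assms by (simp add: power_divide power_mult_distrib mult.assoc flip: exp_double)
  finally show ?thesis .
qed

text \<open>
  With \<open>\<theta> = arccos x\<close>, the first factor grows like \<open>e\<^bsup>2 \<bar>Im \<nu>\<bar> \<theta>\<^esup>\<close> and the second one, which contains
  \<open>P\<^sub>\<nu>(-x)\<close>, like \<open>e\<^bsup>2 \<bar>Im \<nu>\<bar> (\<pi> - \<theta>)\<^esup>\<close>. The second bound also covers \<open>P\<^sub>\<nu>(x)\<^sup>2\<close> because \<open>\<theta> \<le> \<pi>/2\<close>; it is
  here that \<open>x > 0\<close> is essential.
\<close>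

lemma norm_quartic_factors_le:
  assumes x: "0 < x" "x < 1"
  shows "(norm (Legendre_P \<nu> x))\<^sup>2 \<le> 8 * exp (2 * \<bar>Im \<nu>\<bar> * arccos x)"
    and "norm ((Legendre_P \<nu> x)\<^sup>2 - (Legendre_P \<nu> (-x))\<^sup>2) \<le>
      exp (2 * \<bar>Im \<nu>\<bar> * (pi - arccos x)) * (8 + 4 / sqrt ((1 - x) / 2))"
proof -
  define \<theta> where "\<theta> = arccos x"
  define \<tau> where "\<tau> = \<bar>Im \<nu>\<bar>"
  have \<theta>: "2 * \<theta> \<le> pi"
    using x arccos_le_pi2[of x] by (simp add: \<theta>_def)
  have "1 / 2 = sqrt (1 / 4)"
    by (simp add: real_sqrt_divide)
  also have "\<dots> \<le> sqrt ((1 + x) / 2)"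
    using x by simp
  finally have "4 * exp (2 * \<tau> * \<theta>) / sqrt ((1 + x) / 2) \<le> 4 * exp (2 * \<tau> * \<theta>) / (1 / 2)"
    using x by (intro divide_left_mono) auto
  then show 1: "(norm (Legendre_P \<nu> x))\<^sup>2 \<le> 8 * exp (2 * \<bar>Im \<nu>\<bar> * arccos x)"
    using norm_Legendre_P_square_le[of x \<nu>] x by (simp add: \<theta>_def \<tau>_def)
  have "\<tau> * (2 * \<theta>) \<le> \<tau> * pi"
    using \<theta> by (intro mult_left_mono) (auto simp: \<tau>_def)
  then have "exp (2 * \<tau> * \<theta>) \<le> exp (2 * \<tau> * (pi - \<theta>))"
    by (simp add: algebra_simps)
  with 1 have "(norm (Legendre_P \<nu> x))\<^sup>2 \<le> 8 * exp (2 * \<tau> * (pi - \<theta>))"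
    unfolding \<theta>_def[symmetric] \<tau>_def[symmetric] by linarith
  moreover have "(norm (Legendre_P \<nu> (-x)))\<^sup>2 \<le> 4 * exp (2 * \<tau> * (pi - \<theta>)) / sqrt ((1 - x) / 2)"
    using norm_Legendre_P_square_le[of "-x" \<nu>] x by (simp add: \<theta>_def \<tau>_def arccos_minus)
  moreover have "norm ((Legendre_P \<nu> x)\<^sup>2 - (Legendre_P \<nu> (-x))\<^sup>2) \<le> (norm (Legendre_P \<nu> x))\<^sup>2 + (norm (Legendre_P \<nu> (-x)))\<^sup>2"
    using norm_triangle_ineq4[of "(Legendre_P \<nu> x)\<^sup>2" "(Legendre_P \<nu> (-x))\<^sup>2"] by (simp add: norm_power)
  ultimately have "norm ((Legendre_P \<nu> x)\<^sup>2 - (Legendre_P \<nu> (-x))\<^sup>2) \<le>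
      8 * exp (2 * \<tau> * (pi - \<theta>)) + 4 * exp (2 * \<tau> * (pi - \<theta>)) / sqrt ((1 - x) / 2)"
    by linarith
  also have "\<dots> = exp (2 * \<tau> * (pi - \<theta>)) * (8 + 4 / sqrt ((1 - x) / 2))"
    by (simp only: algebra_simps times_divide_eq_left times_divide_eq_right)
  finally show "norm ((Legendre_P \<nu> x)\<^sup>2 - (Legendre_P \<nu> (-x))\<^sup>2) \<le>
      exp (2 * \<bar>Im \<nu>\<bar> * (pi - arccos x)) * (8 + 4 / sqrt ((1 - x) / 2))"
    by (simp add: \<theta>_def \<tau>_def)
qed

lemma norm_quartic_integrand_le_Legendre_P:
  assumes x: "0 < x" "x < 1"
  shows "norm (quartic_integrand \<nu> x) \<le>
    (norm (Legendre_P \<nu> x))\<^sup>2 * (exp (2 * \<bar>Im \<nu>\<bar> * (pi - arccos x)) * (8 + 4 / sqrt ((1 - x) / 2)))"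
proof -
  have "norm (quartic_integrand \<nu> x) = x * ((norm (Legendre_P \<nu> x))\<^sup>2 * norm ((Legendre_P \<nu> x)\<^sup>2 - (Legendre_P \<nu> (-x))\<^sup>2))"
    using x by (simp add: quartic_integrand_def norm_mult norm_power mult.assoc)
  also have "\<dots> \<le> 1 * ((norm (Legendre_P \<nu> x))\<^sup>2 * norm ((Legendre_P \<nu> x)\<^sup>2 - (Legendre_P \<nu> (-x))\<^sup>2))"
    using x by (intro mult_right_mono) auto
  also have "\<dots> \<le> (norm (Legendre_P \<nu> x))\<^sup>2 * (exp (2 * \<bar>Im \<nu>\<bar> * (pi - arccos x)) * (8 + 4 / sqrt ((1 - x) / 2)))"
    unfolding mult_1 by (intro mult_left_mono norm_quartic_factors_le x) auto
  finally show ?thesis .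
qed

lemma norm_quartic_integrand_le:
  assumes x: "0 < x" "x < 1"
  shows "norm (quartic_integrand \<nu> x) \<le> exp (2 * pi * \<bar>Im \<nu>\<bar>) * quartic_bound x"
proof -
  have "norm (quartic_integrand \<nu> x) \<le> (8 * exp (2 * \<bar>Im \<nu>\<bar> * arccos x)) *
      (exp (2 * \<bar>Im \<nu>\<bar> * (pi - arccos x)) * (8 + 4 / sqrt ((1 - x) / 2)))"
    by (rule order_trans[OF norm_quartic_integrand_le_Legendre_P[OF x, of \<nu>]])
       (intro mult_right_mono norm_quartic_factors_le x mult_nonneg_nonneg add_nonneg_nonneg; use x in simp)
  also have "\<dots> = exp (2 * \<bar>Im \<nu>\<bar> * arccos x + 2 * \<bar>Im \<nu>\<bar> * (pi - arccos x)) * quartic_bound x"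
    unfolding exp_add quartic_bound_def by (simp add: field_simps)
  also have "2 * \<bar>Im \<nu>\<bar> * arccos x + 2 * \<bar>Im \<nu>\<bar> * (pi - arccos x) = 2 * pi * \<bar>Im \<nu>\<bar>"
    by (simp add: algebra_simps)
  finally show ?thesis .
qed

lemma set_integrable_quartic_integrand: "set_integrable lborel {0<..<1} (quartic_integrand \<nu>)"
proof (rule set_integrable_bound)
  show "set_integrable lborel {0<..<1} (\<lambda>x. exp (2 * pi * \<bar>Im \<nu>\<bar>) * quartic_bound x)"
    using set_integrable_quartic_bound by simp
  have "continuous_on {0<..<1} (quartic_integrand \<nu>)"
    unfolding quartic_integrand_def[abs_def]
    by (intro continuous_intros continuous_on_compose2[OF continuous_on_Legendre_P]) auto
  then have "(\<lambda>x. indicator {0<..<1} x *\<^sub>R quartic_integrand \<nu> x) \<in> borel_measurable borel"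
    by (intro borel_measurable_continuous_on_indicator) auto
  then show "set_borel_measurable lborel {0<..<1} (quartic_integrand \<nu>)"
    by (simp add: set_borel_measurable_def)
  show "AE x in lborel. x \<in> {0<..<1} \<longrightarrow> norm (quartic_integrand \<nu> x) \<le> norm (exp (2 * pi * \<bar>Im \<nu>\<bar>) * quartic_bound x)"
    using norm_quartic_integrand_le[of _ \<nu>] by (intro AE_I2) (auto intro: order_trans[OF _ abs_ge_self])
qed

lemma holomorphic_quartic_integrand:
  "(\<lambda>\<nu>. indicator {0<..<1} x *\<^sub>R quartic_integrand \<nu> x) holomorphic_on A"
proof (cases "x \<in> {0<..<1}")
  case True
  then have "(\<lambda>\<nu>. Legendre_P \<nu> x) holomorphic_on A" "(\<lambda>\<nu>. Legendre_P \<nu> (-x)) holomorphic_on A"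
    by (intro holomorphic_Legendre_P; simp)+
  then show ?thesis
    unfolding quartic_integrand_def using True by (auto intro!: holomorphic_intros)
qed auto

lemma has_field_derivative_quartic_integral:
  "(quartic_integral has_field_derivative
     (\<integral>x. deriv (\<lambda>\<nu>. indicator {0<..<1} x *\<^sub>R quartic_integrand \<nu> x) \<nu>0 \<partial>lborel)) (at \<nu>0)"
proof -
  define B where "B x = indicator {0<..<1} x * (exp (2 * pi * (\<bar>Im \<nu>0\<bar> + 2)) * quartic_bound x)" for x
  have 1: "integrable lborel B"
    using set_integrable_mult_right[OF set_integrable_quartic_bound, of "exp (2 * pi * (\<bar>Im \<nu>0\<bar> + 2))"]
    unfolding set_integrable_def B_def[abs_def] by simp
  have 2: "norm (indicator {0<..<1} x *\<^sub>R quartic_integrand \<nu> x) \<le> B x" if "norm (\<nu> - \<nu>0) \<le> 2" for \<nu> x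
  proof (cases "x \<in> {0<..<1}")
    case True
    have "\<bar>Im \<nu>\<bar> \<le> \<bar>Im \<nu>0\<bar> + 2"
      using that abs_Im_le_cmod[of "\<nu> - \<nu>0"] by simp
    then have "exp (2 * pi * \<bar>Im \<nu>\<bar>) * quartic_bound x \<le> exp (2 * pi * (\<bar>Im \<nu>0\<bar> + 2)) * quartic_bound x"
      using True by (intro mult_right_mono) (auto simp: quartic_bound_def intro!: add_nonneg_nonneg)
    then show ?thesis
      using norm_quartic_integrand_le[of x \<nu>] True by (simp add: B_def)
  qed (simp add: B_def)
  have 3: "integrable lborel (\<lambda>x. indicator {0<..<1} x *\<^sub>R quartic_integrand \<nu> x)" for \<nu>
    using set_integrable_quartic_integrand unfolding set_integrable_def .
  from has_field_derivative_dominated_integral[OF holomorphic_quartic_integrand 3 1 2]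
  show ?thesis
    by (simp add: quartic_integral_def[abs_def] set_lebesgue_integral_def)
qed

lemma holomorphic_quartic_integral: "quartic_integral holomorphic_on A"
  using has_field_derivative_quartic_integral
  by (meson field_differentiable_at_within field_differentiable_def holomorphic_on_def)

lemma norm_quartic_integral_le:
  "norm (quartic_integral \<nu>) \<le> (LBINT x:{0<..<1}. quartic_bound x) * exp (2 * pi * \<bar>Im \<nu>\<bar>)"
proof -
  have "norm (quartic_integral \<nu>) \<le> (LBINT x:{0<..<1}. exp (2 * pi * \<bar>Im \<nu>\<bar>) * quartic_bound x)"
    unfolding quartic_integral_def set_lebesgue_integral_def
  proof (rule Bochner_Integration.integral_norm_bound_integral)
    show "integrable lborel (\<lambda>x. indicator {0<..<1} x *\<^sub>R quartic_integrand \<nu> x)"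
      using set_integrable_quartic_integrand unfolding set_integrable_def .
    show "integrable lborel (\<lambda>x. indicator {0<..<1} x *\<^sub>R (exp (2 * pi * \<bar>Im \<nu>\<bar>) * quartic_bound x))"
      using set_integrable_mult_right[OF set_integrable_quartic_bound] unfolding set_integrable_def .
    show "norm (indicator {0<..<1} x *\<^sub>R quartic_integrand \<nu> x) \<le> indicator {0<..<1} x *\<^sub>R (exp (2 * pi * \<bar>Im \<nu>\<bar>) * quartic_bound x)" for x
      using norm_quartic_integrand_le[of x \<nu>] by (auto simp: indicator_def)
  qed
  then show ?thesis
    by (simp add: mult.commute)
qed

lemma quartic_integral_reflect: "quartic_integral (- 1 - \<nu>) = quartic_integral \<nu>"
  unfolding quartic_integral_def
  by (rule set_lebesgue_integral_cong) (auto simp: quartic_integrand_def Legendre_P_reflect)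

text \<open>
  Dominated convergence: of the four Legendre factors, the two factors \<open>P\<^sub>\<nu>(x)\<close> in front of the
  difference already tend to 0 after division by their exponential growth.
\<close>

lemma quartic_integral_decay:
  "((\<lambda>t::real. quartic_integral (\<i> * of_real t - 1/2) * of_real (exp (- 2 * pi * t))) \<longlongrightarrow> 0) at_top"
proof -
  define f where "f t x = indicator {0<..<1} x *\<^sub>R (quartic_integrand (\<i> * of_real t - 1/2) x * of_real (exp (- 2 * pi * t)))" for t x
  have f_int: "integrable lborel (f t)" for t
    using set_integrable_mult_left[of "of_real (exp (- 2 * pi * t))", OF set_integrable_quartic_integrand[of "\<i> * of_real t - 1/2"]]
    unfolding set_integrable_def f_def[abs_def] by simp
  have "((\<lambda>t. integral\<^sup>L lborel (f t)) \<longlongrightarrow> integral\<^sup>L lborel (\<lambda>_::real. 0)) at_top"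
  proof (rule integral_dominated_convergence_at_top)
    show "f t \<in> borel_measurable lborel" for t
      using f_int by (rule borel_measurable_integrable)
    show "integrable lborel (\<lambda>x. indicator {0<..<1} x *\<^sub>R quartic_bound x)"
      using set_integrable_quartic_bound unfolding set_integrable_def .
    show "\<forall>\<^sub>F t in at_top. AE x in lborel. norm (f t x) \<le> indicator {0<..<1} x *\<^sub>R quartic_bound x"
      using eventually_ge_at_top[of "0::real"]
    proof (eventually_elim, intro AE_I2)
      fix t x :: real assume t: "0 \<le> t"
      show "norm (f t x) \<le> indicator {0<..<1} x *\<^sub>R quartic_bound x"
      proof (cases "x \<in> {0<..<1}")
        case True
        have "norm (f t x) = norm (quartic_integrand (\<i> * of_real t - 1/2) x) * exp (- 2 * pi * t)"
          using True by (simp add: f_def norm_mult)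
        also have "\<dots> \<le> (exp (2 * pi * t) * quartic_bound x) * exp (- 2 * pi * t)"
          using norm_quartic_integrand_le[of x "\<i> * of_real t - 1/2"] True t by (intro mult_right_mono) auto
        also have "\<dots> = quartic_bound x"
          by (simp add: exp_minus)
        finally show ?thesis
          using True by simp
      qed (simp add: f_def)
    qed
    show "AE x in lborel. ((\<lambda>t. f t x) \<longlongrightarrow> 0) at_top"
    proof (intro AE_I2)
      fix x :: real
      show "((\<lambda>t. f t x) \<longlongrightarrow> 0) at_top"
      proof (cases "x \<in> {0<..<1}")
        case True
        define u where "u t = of_real (exp (- t * arccos x)) * Legendre_P (\<i> * of_real t - 1/2) x" for t
        define c where "c = 8 + 4 / sqrt ((1 - x) / 2)"
        have "((\<lambda>t. (norm (u t))\<^sup>2 * c) \<longlongrightarrow> (norm (0::complex))\<^sup>2 * c) at_top"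
          unfolding u_def using True by (intro tendsto_intros Legendre_P_decay) auto
        then have "((\<lambda>t. (norm (u t))\<^sup>2 * c) \<longlongrightarrow> 0) at_top"
          by simp
        moreover have "\<forall>\<^sub>F t in at_top. norm (f t x) \<le> (norm (u t))\<^sup>2 * c"
          using eventually_ge_at_top[of "0::real"]
        proof eventually_elim
          fix t :: real assume t: "0 \<le> t"
          define P where "P = (norm (Legendre_P (\<i> * of_real t - 1/2) x))\<^sup>2"
          have "norm (f t x) = norm (quartic_integrand (\<i> * of_real t - 1/2) x) * exp (- 2 * pi * t)"
            using True by (simp add: f_def norm_mult)
          also have "\<dots> \<le> (P * (exp (2 * t * (pi - arccos x)) * c)) * exp (- 2 * pi * t)"
            using norm_quartic_integrand_le_Legendre_P[of x "\<i> * of_real t - 1/2"] True t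
            by (intro mult_right_mono) (auto simp: P_def c_def)
          also have "\<dots> = P * c * (exp (2 * t * (pi - arccos x)) * exp (- 2 * pi * t))"
            by (simp only: mult_ac)
          also have "exp (2 * t * (pi - arccos x)) * exp (- 2 * pi * t) = (exp (- t * arccos x))\<^sup>2"
            by (simp add: power2_eq_square algebra_simps flip: exp_add)
          also have "P * c * (exp (- t * arccos x))\<^sup>2 = (norm (u t))\<^sup>2 * c"
            by (simp add: u_def P_def norm_mult power_mult_distrib)
          finally show "norm (f t x) \<le> (norm (u t))\<^sup>2 * c" .
        qed
        ultimately show ?thesis
          by (rule Lim_null_comparison[rotated])
      qed (simp add: f_def)
    qed
  qed simp
  moreover have "integral\<^sup>L lborel (f t) = quartic_integral (\<i> * of_real t - 1/2) * of_real (exp (- 2 * pi * t))" for t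
    unfolding quartic_integral_def set_lebesgue_integral_def f_def
    by (simp flip: mult_scaleR_left)
  ultimately show ?thesis
    by simp
qed

lemma quartic_integral_of_nat: "quartic_integral (of_nat n) = 0"
proof -
  have "quartic_integrand (of_nat n) x = 0" if "x \<in> {0<..<1}" for x
    using that by (simp add: quartic_integrand_def Legendre_P_of_nat poly_legendre_minus power_mult_distrib flip: power_mult)
  then have "quartic_integral (of_nat n) = (LBINT x:{0<..<1::real}. 0)"
    unfolding quartic_integral_def by (intro set_lebesgue_integral_cong) auto
  then show ?thesis
    by (simp add: set_lebesgue_integral_def)
qed

lemma log_transform_legendre_minus:
  assumes x: "-1 < x" "x < 1"
  shows "log_transform (legendre_poly n) (-x) = - ((-1) ^ n * log_transform (legendre_poly n) x)"
proof -
  have mx: "-1 < -x" "-x < 1"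
    using x by auto
  have sq: "(-1) ^ n * (-1) ^ n = (1 :: complex)"
    by (simp flip: power_add)
  have swap: "b - s * a = - (s * (a - s * b))" if "s * s = 1" for a b s :: complex
  proof -
    have "- (s * (a - s * b)) = s * s * b - s * a"
      by (simp add: algebra_simps)
    then show ?thesis
      by (simp add: that)
  qed
  have "complex_of_real (log_transform (legendre_poly n) (-x)) = - ((-1) ^ n * of_real (log_transform (legendre_poly n) x))"
    unfolding deriv_Legendre_P_of_nat[OF x, symmetric] deriv_Legendre_P_of_nat[OF mx, symmetric] minus_minus
    by (rule swap[OF sq])
  also have "\<dots> = of_real (- ((-1) ^ n * log_transform (legendre_poly n) x))"
    by simp
  finally show ?thesis
    by (simp only: of_real_eq_iff)
qed

lemma set_integral_even:
  fixes h :: "real \<Rightarrow> real"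
  assumes a: "0 \<le> a" and even: "\<And>x. -a < x \<Longrightarrow> x < a \<Longrightarrow> h (-x) = h x" and int: "set_integrable lborel {-a<..<a} h"
  shows "(LBINT x:{-a<..<a}. h x) = 2 * (LBINT x:{0<..<a}. h x)"
proof -
  have "(LBINT x=ereal (-a)..ereal a. h x) = (LBINT x=ereal (-a)..ereal 0. h x) + (LBINT x=ereal 0..ereal a. h x)"
    using a int by (intro interval_integral_sum[symmetric]) (simp add: interval_lebesgue_integrable_def min_def max_def)
  also have "(LBINT x=ereal (-a)..ereal 0. h x) = (LBINT x=ereal 0..ereal a. h (-x))"
    using interval_integral_reflect[of "ereal (-a)" "ereal 0" h] by simp
  also have "\<dots> = (LBINT x=ereal 0..ereal a. h x)"
    using a by (intro interval_integral_cong) (auto simp: min_def max_def intro!: even)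
  finally show ?thesis
    using a by (simp add: interval_lebesgue_integral_def)
qed

text \<open>
  At \<open>\<nu> = n\<close> the difference \<open>P\<^sub>\<nu>(x)\<^sup>2 - P\<^sub>\<nu>(-x)\<^sup>2\<close> vanishes, so only its derivative contributes, and that
  produces the combination of derivatives evaluated in \<open>deriv_Legendre_P_of_nat\<close>.
\<close>

lemma has_field_derivative_quartic_integral_of_nat:
  "(quartic_integral has_field_derivative of_real (2 / (2 * real n + 1)\<^sup>2)) (at (of_nat n))"
proof -
  define h where "h x = x * poly (legendre_poly n) x ^ 3 * log_transform (legendre_poly n) x" for x
  have deriv: "deriv (\<lambda>\<nu>. indicator {0<..<1} x *\<^sub>R quartic_integrand \<nu> x) (of_nat n) = of_real (indicator {0<..<1} x *\<^sub>R (2 * h x))" for x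
  proof (cases "x \<in> {0<..<1}")
    case True
    then have x: "-1 < x" "x < 1" "-1 < -x" "-x < 1"
      by auto
    define p :: complex where "p = of_real (poly (legendre_poly n) x)"
    define s :: complex where "s = (-1) ^ n"
    define u v where "u = deriv (\<lambda>\<nu>. Legendre_P \<nu> x) (of_nat n)" and "v = deriv (\<lambda>\<nu>. Legendre_P \<nu> (-x)) (of_nat n)"
    have P: "Legendre_P (of_nat n) x = p" "Legendre_P (of_nat n) (-x) = s * p"
      by (simp_all add: Legendre_P_of_nat x p_def s_def poly_legendre_minus)
    have s: "s * s = 1"
      by (simp add: s_def flip: power_add)
    have uv: "u - s * v = of_real (log_transform (legendre_poly n) x)"
      unfolding u_def v_def s_def by (rule deriv_Legendre_P_of_nat) (use x in auto)
    have du: "((\<lambda>\<nu>. Legendre_P \<nu> x) has_field_derivative u) (at (of_nat n))"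
         and dv: "((\<lambda>\<nu>. Legendre_P \<nu> (-x)) has_field_derivative v) (at (of_nat n))"
      unfolding u_def v_def by (intro has_field_derivative_Legendre_P x)+
    have "((\<lambda>\<nu>. quartic_integrand \<nu> x) has_field_derivative
        of_real x * (2 * p * u) * (p\<^sup>2 - (s * p)\<^sup>2) + of_real x * p\<^sup>2 * (2 * p * u - 2 * (s * p) * v)) (at (of_nat n))"
      unfolding quartic_integrand_def
      by (rule derivative_eq_intros refl du dv | simp add: P)+
    also have "of_real x * (2 * p * u) * (p\<^sup>2 - (s * p)\<^sup>2) + of_real x * p\<^sup>2 * (2 * p * u - 2 * (s * p) * v) =
        2 * of_real x * p ^ 3 * (u - s * v)"
    proof -
      have sp: "(s * p)\<^sup>2 = p\<^sup>2"
        using s by (simp add: power2_eq_square)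
      show ?thesis
        unfolding sp by (simp add: power2_eq_square power3_eq_cube algebra_simps)
    qed
    also have "\<dots> = of_real (2 * h x)"
      unfolding uv by (simp add: h_def p_def)
    finally have "deriv (\<lambda>\<nu>. quartic_integrand \<nu> x) (of_nat n) = of_real (2 * h x)"
      by (rule DERIV_imp_deriv)
    then show ?thesis
      using True by simp
  qed simp
  have h_int: "set_integrable lborel {-1<..<1} h"
    using set_integrable_poly_log_transform[of "pCons 0 (legendre_poly n ^ 3)" "legendre_poly n"]
    by (simp add: h_def[abs_def] poly_power)
  have "h (-x) = h x" if "-1 < x" "x < 1" for x
  proof -
    define s :: real where "s = (-1) ^ n"
    have s: "s * s = 1"
      by (simp add: s_def flip: power_add)
    have "(- x) * (s * p) ^ 3 * - (s * e) = (s * s) * (s * s) * (x * p ^ 3 * e)" for p e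
      by (simp add: power3_eq_cube mult_ac)
    then show ?thesis
      using that by (simp only: h_def poly_legendre_minus log_transform_legendre_minus s_def[symmetric] s)
  qed
  then have "2 * (LBINT x:{0<..<1}. h x) = (LBINT x:{-1<..<1}. h x)"
    using set_integral_even[of 1 h] h_int by simp
  also have "\<dots> = 2 / (2 * real n + 1)\<^sup>2"
    unfolding h_def by (rule integral_x_legendre_cubed_log_transform)
  finally have "(LBINT x:{0<..<1}. 2 * h x) = 2 / (2 * real n + 1)\<^sup>2"
    by simp
  then have "(\<integral>x. deriv (\<lambda>\<nu>. indicator {0<..<1} x *\<^sub>R quartic_integrand \<nu> x) (of_nat n) \<partial>lborel) = of_real (2 / (2 * real n + 1)\<^sup>2)"
    unfolding deriv by (simp only: integral_complex_of_real set_lebesgue_integral_def)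
  then show ?thesis
    using has_field_derivative_quartic_integral[of "of_nat n"] by simp
qed

lemma quartic_integral_closed_form:
  assumes "\<nu> \<notin> \<int> \<union> {-1/2}"
  shows "quartic_integral \<nu> = digamma_expr \<nu>"
proof -
  define s where "s = \<nu> + 1/2"
  define f where "f s = quartic_integral (s - 1/2)" for s
  have "cos (of_real pi * s) = - sin (\<nu> * of_real pi)"
    using cos_add[of "\<nu> * of_real pi" "of_real pi / 2"] cos_of_real[of "pi / 2"] sin_of_real[of "pi / 2"]
    by (simp add: s_def algebra_simps)
  then have cos2: "(cos (of_real pi * s))\<^sup>2 = (sin (\<nu> * of_real pi))\<^sup>2"
    by simp
  have s0: "s \<noteq> 0"
    using assms by (auto simp: s_def add_eq_0_iff2)
  have "cos (of_real pi * s) \<noteq> 0"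
  proof
    assume "cos (of_real pi * s) = 0"
    then obtain k where "s = of_real (half_int k) \<or> s = - of_real (half_int k)"
      unfolding cos_pi_eq_0_iff by blast
    then have "\<nu> = of_int (int k) \<or> \<nu> = of_int (- int k - 1)"
      by (auto simp: s_def half_int_def algebra_simps eq_neg_iff_add_eq_0)
    then have "\<nu> \<in> \<int>"
      by (metis Ints_of_int)
    then show False
      using assms by blast
  qed
  then have "s\<^sup>2 * (of_real pi)\<^sup>2 * f s = (cos (of_real pi * s))\<^sup>2 * psi_sym s"
  proof (rule entire_eq_cos_squared_mult_psi_sym[rotated -1])
    show "f holomorphic_on UNIV"
      unfolding f_def
      by (intro holomorphic_on_compose_gen[OF _ holomorphic_quartic_integral, unfolded o_def] holomorphic_intros) auto
    show "f (- s) = f s" for s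
    proof -
      have "- 1 - (s - 1/2) = - s - 1/2"
        by simp
      then show ?thesis
        using quartic_integral_reflect[of "s - 1/2"] by (simp only: f_def)
    qed
    show "norm (f s) \<le> (LBINT x:{0<..<1}. quartic_bound x) * exp (2 * pi * \<bar>Im s\<bar>)" for s
      using norm_quartic_integral_le[of "s - 1/2"] by (simp add: f_def)
    show "((\<lambda>t::real. f (\<i> * of_real t) * of_real (exp (- 2 * pi * t))) \<longlongrightarrow> 0) at_top"
      using quartic_integral_decay by (simp add: f_def)
    show "f (of_real (half_int n)) = 0" for n
      by (simp add: f_def half_int_def quartic_integral_of_nat)
    show "(f has_field_derivative 1 / (2 * (of_real (half_int n))\<^sup>2)) (at (of_real (half_int n)))" for n
    proof -
      have "(quartic_integral has_field_derivative of_real (2 / (2 * real n + 1)\<^sup>2)) (at (of_real (half_int n) + - 1/2))"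
        using has_field_derivative_quartic_integral_of_nat[of n] by (simp add: half_int_def)
      then have "((\<lambda>s. quartic_integral (s + - 1/2)) has_field_derivative of_real (2 / (2 * real n + 1)\<^sup>2)) (at (of_real (half_int n)))"
        by (simp only: DERIV_shift)
      moreover have "2 / (2 * real n + 1)\<^sup>2 = 1 / (2 * (half_int n)\<^sup>2)"
      proof -
        have "half_int n = (2 * real n + 1) / 2"
          by (simp add: half_int_def)
        then show ?thesis
          by (simp only: power_divide) simp
      qed
      then have "complex_of_real (2 / (2 * real n + 1)\<^sup>2) = 1 / (2 * (of_real (half_int n))\<^sup>2)"
        by (metis of_real_1 of_real_divide of_real_mult of_real_numeral of_real_power)
      ultimately show ?thesis
        by (simp add: f_def[abs_def])
    qed
  qed
  then have "s\<^sup>2 * (of_real pi)\<^sup>2 * quartic_integral \<nu> = (sin (\<nu> * of_real pi))\<^sup>2 * psi_sym s"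
    unfolding cos2 by (simp add: f_def s_def)
  then have "quartic_integral \<nu> = (sin (\<nu> * of_real pi))\<^sup>2 * psi_sym s / (s\<^sup>2 * (of_real pi)\<^sup>2)"
    using s0 by (simp add: nonzero_eq_divide_eq mult.commute)
  also have "psi_sym s = (Digamma (\<nu> + 1) + Digamma (- \<nu>)) / 2 + euler_mascheroni + 2 * of_real (ln 2)"
    by (simp add: psi_sym_def s_def add.commute)
  also have "s\<^sup>2 = (2 * \<nu> + 1)\<^sup>2 / 4"
    by (simp add: s_def power2_eq_square field_simps)
  finally show ?thesis
    by (simp add: digamma_expr_def mult_ac)
qed

theorem proposition3p3:
  shows "\<exists>R :: complex \<Rightarrow> complex.
    continuous_on UNIV R \<and>
    (\<forall>\<nu>. \<nu> \<notin> \<int> \<union> {-1/2} \<longrightarrow> R \<nu> = digamma_expr \<nu>) \<and>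
    (\<forall>\<nu>. interval_lebesgue_integrable lborel 0 1
           (\<lambda>x. of_real x * (Legendre_P \<nu> x)\<^sup>2 * ((Legendre_P \<nu> x)\<^sup>2 - (Legendre_P \<nu> (- x))\<^sup>2)) \<and>
         (LBINT x=0..1.
            of_real x * (Legendre_P \<nu> x)\<^sup>2 * ((Legendre_P \<nu> x)\<^sup>2 - (Legendre_P \<nu> (- x))\<^sup>2)) = R \<nu>)"
proof (intro exI[of _ quartic_integral] conjI allI impI)
  show "continuous_on UNIV quartic_integral"
    by (intro holomorphic_on_imp_continuous_on holomorphic_quartic_integral)
  show "quartic_integral \<nu> = digamma_expr \<nu>" if "\<nu> \<notin> \<int> \<union> {-1/2}" for \<nu>
    using that by (rule quartic_integral_closed_form)
  fix \<nu>
  have 01: "einterval 0 1 = {0<..<1}"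
    by (simp add: zero_ereal_def one_ereal_def)
  show "interval_lebesgue_integrable lborel 0 1
      (\<lambda>x. of_real x * (Legendre_P \<nu> x)\<^sup>2 * ((Legendre_P \<nu> x)\<^sup>2 - (Legendre_P \<nu> (- x))\<^sup>2))"
    using set_integrable_quartic_integrand[of \<nu>]
    by (simp add: interval_lebesgue_integrable_def 01 quartic_integrand_def[abs_def])
  show "(LBINT x=0..1. of_real x * (Legendre_P \<nu> x)\<^sup>2 * ((Legendre_P \<nu> x)\<^sup>2 - (Legendre_P \<nu> (- x))\<^sup>2)) =
      quartic_integral \<nu>"
    by (simp add: interval_lebesgue_integral_def 01 quartic_integral_def quartic_integrand_def)
qed

end
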